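(* Let $\mu_+,\mu_-\in\mathbb{R}$, $\beta\in(-1,1)$, $q>0$, $x\in\mathbb{R}$, and let $X=(X_t)_{t\ge0}$ be the refracted skew Brownian motion with parameters $(\beta,\mu_+,\mu_-)$, skew level $a=0$ and starting point $X_0=x$ (law $\mathbb{P}_x$). Let $e_q$ be an exponential random variable with rate $q$, independent of $X$. Put $$D_q:=(1+\beta)\mu_+-(1-\beta)\mu_-+(1+\beta)\sqrt{\mu_+^2+2q}+(1-\beta)\sqrt{\mu_-^2+2q}.$$ Then the potential measure of $X$ is given as follows. For $y>0$, $$\mathbb{P}_x(X_{e_q}\in\mathrm{d}y)=\begin{cases}\dfrac{q\,e^{\mu_+(y-x)}}{\sqrt{\mu_+^2+2q}}\Big(e^{-|y-x|\sqrt{\mu_+^2+2q}}-e^{-(x+y)\sqrt{\mu_+^2+2q}}\Big)\mathrm{d}y+\dfrac{2(1+\beta)q}{D_q}\,e^{\mu_+(y-x)-(x+y)\sqrt{\mu_+^2+2q}}\,\mathrm{d}y, & x\ge0,\\[3mm] \dfrac{2(1+\beta)q}{D_q}\,e^{(-\mu_-+\sqrt{\mu_-^2+2q})\,x}\,e^{(\mu_+-\sqrt{\mu_+^2+2q})\,y}\,\mathrm{d}y, & x\le0,\end{cases}$$ and for $y<0$, $$\mathbb{P}_x(X_{e_q}\in\mathrm{d}y)=\begin{cases}\dfrac{2(1-\beta)q}{D_q}\,e^{(-\mu_+-\sqrt{\mu_+^2+2q})\,x}\,e^{(\mu_-+\sqrt{\mu_-^2+2q})\,y}\,\mathrm{d}y,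 & x\ge0,\\[3mm] \dfrac{q\,e^{\mu_-(y-x)}}{\sqrt{\mu_-^2+2q}}\Big(e^{-|y-x|\sqrt{\mu_-^2+2q}}-e^{(x+y)\sqrt{\mu_-^2+2q}}\Big)\mathrm{d}y+\dfrac{2(1-\beta)q}{D_q}\,e^{\mu_-(y-x)+(x+y)\sqrt{\mu_-^2+2q}}\,\mathrm{d}y, & x\le0.\end{cases}$$
   Context: The refracted skew Brownian motion with parameters $\beta\in(-1,1)$, $\mu_+,\mu_-\in\mathbb{R}$ and skew level $a\in\mathbb{R}$ is the pathwise unique (strong) solution $X$ of $$X_t=X_0+B_t+\beta L^X(t,a)+\mu_+\int_0^t \mathbf{1}_{\{X_s>a\}}\,\mathrm{d}s+\mu_-\int_0^t\mathbf{1}_{\{X_s<a\}}\,\mathrm{d}s,\qquad t\ge 0,$$ where $B$ is a standard Brownian motion and $L^X(t,a)=\lim_{\epsilon\to0^+}\frac{1}{2\epsilon}\mathrm{Leb}(\{s\le t:|X_s-a|\le\epsilon\})$ is the symmetric local time of $X$ at level $a$. "Potential measure" here means the law of $X_{e_q}$, i.e. $\mathbb{P}_x(X_{e_q}\in \mathrm{d}y)=\int_0^\infty q e^{-qt}\,\mathbb{P}_x(X_t\in \mathrm{d}y)\,\mathrm{d}t$. *)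

theory Defs
  imports "HOL-Probability.Probability"
begin

text \<open>
  Processes are indexed by \<^typ>\<open>real\<close>, and only times \<open>t \<ge> 0\<close> matter. The library locale
  \<^locale>\<open>filtration\<close> also asks for \<open>F t\<close> at \<open>t < 0\<close>; this is no restriction, since one may
  put \<open>F t = F 0\<close> there. No completeness or right-continuity of \<open>F\<close> is required.
\<close>

locale brownian_motion = prob_space M + filtration "space M" F
  for M :: "'a measure" and F :: "real \<Rightarrow> 'a measure" +
  fixes B :: "real \<Rightarrow> 'a \<Rightarrow> real"
  assumes F_subalgebra: "\<And>t. 0 \<le> t \<Longrightarrow> subalgebra M (F t)"
    and B_adapted: "\<And>t. 0 \<le> t \<Longrightarrow> B t \<in> borel_measurable (F t)"
    and B_zero: "AE \<omega> in M. B 0 \<omega> = 0"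
    and B_continuous: "AE \<omega> in M. continuous_on {0..} (\<lambda>t. B t \<omega>)"
    and B_increment: "\<And>s t. 0 \<le> s \<Longrightarrow> s < t \<Longrightarrow>
      distributed M lborel (\<lambda>\<omega>. B t \<omega> - B s \<omega>) (\<lambda>z. ennreal (normal_density 0 (sqrt (t - s)) z))"
    and B_indep: "\<And>s t. 0 \<le> s \<Longrightarrow> s < t \<Longrightarrow>
      indep_set (sets (F s)) {(\<lambda>\<omega>. B t \<omega> - B s \<omega>) -` A \<inter> space M | A. A \<in> sets borel}"

text \<open>\<open>l\<close> is the symmetric local time at level \<open>a\<close>, up to time \<open>t\<close>, of the path \<open>w\<close>; this
  includes the claim that the limit exists.\<close>

definition has_symmetric_local_time :: "(real \<Rightarrow> real) \<Rightarrow> real \<Rightarrow> real \<Rightarrow> real \<Rightarrow> bool" where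
  "has_symmetric_local_time w a t l \<longleftrightarrow>
     ((\<lambda>\<epsilon>. measure lborel {s \<in> {0..t}. \<bar>w s - a\<bar> \<le> \<epsilon>} / (2 * \<epsilon>)) \<longlongrightarrow> l) (at_right 0)"

text \<open>
  \<open>X\<close> solves the equation on a filtered probability space that carries the \<open>F\<close>-Brownian motion
  \<open>B\<close>. By pathwise uniqueness such an \<open>X\<close> is indistinguishable from the strong solution driven
  by \<open>B\<close>. All paths of \<open>X\<close> are continuous (not just almost all), so that \<open>X\<close> evaluated at a
  random time is measurable although \<open>M\<close> need not be complete.
\<close>

locale refracted_skew_brownian_motion = brownian_motion M F B
  for M :: "'a measure" and F :: "real \<Rightarrow> 'a measure" and B :: "real \<Rightarrow> 'a \<Rightarrow> real" +
  fixes X :: "real \<Rightarrow> 'a \<Rightarrow> real" and \<beta> \<mu>p \<mu>m a :: real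
  assumes \<beta>_bounds: "- 1 < \<beta>" "\<beta> < 1"
    and X_adapted: "\<And>t. 0 \<le> t \<Longrightarrow> X t \<in> borel_measurable (F t)"
    and X_continuous: "\<And>\<omega>. \<omega> \<in> space M \<Longrightarrow> continuous_on {0..} (\<lambda>t. X t \<omega>)"
    and X_equation: "AE \<omega> in M. \<forall>t\<ge>0. \<exists>l. has_symmetric_local_time (\<lambda>s. X s \<omega>) a t l \<and>
      X t \<omega> = X 0 \<omega> + B t \<omega> + \<beta> * l
        + \<mu>p * (LINT s:{0..t}|lborel. indicator {a<..} (X s \<omega>))
        + \<mu>m * (LINT s:{0..t}|lborel. indicator {..<a} (X s \<omega>))"

definition D_const :: "real \<Rightarrow> real \<Rightarrow> real \<Rightarrow> real \<Rightarrow> real" where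
  "D_const \<beta> \<mu>p \<mu>m q =
     (1 + \<beta>) * \<mu>p - (1 - \<beta>) * \<mu>m + (1 + \<beta>) * sqrt (\<mu>p\<^sup>2 + 2 * q) + (1 - \<beta>) * sqrt (\<mu>m\<^sup>2 + 2 * q)"

end

theory Submission
  imports Defs "HOL-Real_Asymp.Real_Asymp"
begin

text \<open>
  Let \<open>g\<close> be bounded and continuous, and let \<open>f\<close> be the bounded continuous function that solves
  \<open>f'' / 2 + \<mu>p f' = q (f - g)\<close> on the right half line, \<open>f'' / 2 + \<mu>m f' = q (f - g)\<close> on the left one,
  and satisfies the transmission condition \<open>(1 + \<beta>) f'(0+) = (1 - \<beta>) f'(0-)\<close>. The level \<open>0\<close> acts on
  \<open>f(X)\<close> in two ways: the push \<open>\<beta> dL\<close> contributes \<open>\<beta> (f'(0+) + f'(0-)) / 2 dL\<close>, and the atom of \<open>f''\<close>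
  at the kink contributes \<open>(f'(0+) - f'(0-)) / 2 dL\<close>. The transmission condition says exactly that
  the two cancel. Hence \<open>E f(X_t) = f(x) + q \<integral>_0^t (E f(X_s) - E g(X_s)) ds\<close>, and multiplication by
  \<open>exp (- q t)\<close> and integration over all \<open>t\<close> turn this into \<open>f(x) = E g(X_e)\<close>
  (\<open>resolvent_potential\<close> together with \<open>expectation_at_independent_time\<close>). For \<open>g(y) = exp (\<i> \<theta> y)\<close> the
  function \<open>f\<close> is a sum of two exponentials on each half line, so the characteristic function of
  \<open>X_e\<close> is explicit (\<open>characteristic_at_exponential_time\<close>). It is also the Fourier transform of the
  asserted density (\<open>potential_density_right_characteristic\<close> and its mirror image), and the
  uniqueness theorem of Levy identifies the two laws.

  The role of the stochastic integral is played by the sums of \<open>f'(X_{t_k}) (B_{t_{k+1}} - B_{t_k})\<close> over dyadic partitions. They have mean zero and second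
  moment at most \<open>t sup |f'|^2\<close>. Therefore their almost sure limit also has mean zero
  (\<open>expectation_zero_of_AE_limit\<close>); this involves no integrability of the local time. Identifying
  the limit is deterministic analysis of a single path (\<open>pathwise_Ito\<close>): a second-order Taylor
  expansion, in which the local time enters as a nondecreasing function that stays constant while
  the path is away from \<open>0\<close>.

  This covers smooth \<open>f\<close> (\<open>Ito_martingale\<close>). A function with a kink is smoothed by replacing
  \<open>|y|\<close> with \<open>sqrt (y^2 + \<epsilon>^2)\<close>, whose second derivative is twice an approximate delta function; its time
  integral along the path converges to twice the symmetric local time, because the latter is by definition a limit
  of occupation densities (\<open>local_time_kernel_limit\<close>). The second-moment bound is uniform in \<open>\<epsilon>\<close>, so the
  same limit lemma gives the formula for the kinked function (\<open>kink_Ito_expectation\<close>).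
\<close>

section \<open>Limits of square integrable variables and martingale transforms\<close>

text \<open>
  A bound in \<open>L\<^sup>2\<close> makes the sequence uniformly integrable: cutting a variable off at height \<open>K\<close> changes its
  mean by at most \<open>C / K\<close>, since \<open>|y| \<le> y\<^sup>2 / K\<close> where the cut acts. The bound on the second moment of
  the limit is Fatou's lemma; it allows the lemma to be applied to limits of such limits.
\<close>

lemma (in prob_space) expectation_zero_of_AE_limit:
  fixes T :: "nat \<Rightarrow> 'a \<Rightarrow> real"
  assumes T[measurable]: "\<And>n. T n \<in> borel_measurable M"
    and T2: "\<And>n. integrable M (\<lambda>\<omega>. (T n \<omega>)\<^sup>2)"
    and ET: "\<And>n. expectation (T n) = 0"
    and bound: "\<And>n. expectation (\<lambda>\<omega>. (T n \<omega>)\<^sup>2) \<le> C"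
    and Y[measurable]: "Y \<in> borel_measurable M"
    and lim: "AE \<omega> in M. (\<lambda>n. T n \<omega>) \<longlonglongrightarrow> Y \<omega>"
  shows "integrable M (\<lambda>\<omega>. (Y \<omega>)\<^sup>2)" "integrable M Y" "expectation (\<lambda>\<omega>. (Y \<omega>)\<^sup>2) \<le> C" "expectation Y = 0"
proof -
  have C: "0 \<le> C"
    using bound[of 0] by (rule order_trans[rotated]) simp
  have "(\<integral>\<^sup>+\<omega>. ennreal ((Y \<omega>)\<^sup>2) \<partial>M) = (\<integral>\<^sup>+\<omega>. liminf (\<lambda>n. ennreal ((T n \<omega>)\<^sup>2)) \<partial>M)"
  proof (rule nn_integral_cong_AE, use lim in eventually_elim)
    case (elim \<omega>)
    then have "(\<lambda>n. ennreal ((T n \<omega>)\<^sup>2)) \<longlonglongrightarrow> ennreal ((Y \<omega>)\<^sup>2)"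
      by (intro tendsto_ennrealI tendsto_intros)
    then show ?case
      by (rule lim_imp_Liminf[OF sequentially_bot, symmetric])
  qed
  also have "\<dots> \<le> liminf (\<lambda>n. \<integral>\<^sup>+\<omega>. ennreal ((T n \<omega>)\<^sup>2) \<partial>M)"
    by (rule nn_integral_liminf) simp
  also have "\<dots> \<le> liminf (\<lambda>n::nat. ennreal C)"
    using bound T2 by (intro Liminf_mono always_eventually allI) (simp add: nn_integral_eq_integral ennreal_leI)
  also have "\<dots> = ennreal C"
    by (simp add: Liminf_const)
  finally have nn: "(\<integral>\<^sup>+\<omega>. ennreal ((Y \<omega>)\<^sup>2) \<partial>M) \<le> ennreal C" .
  then show Y2: "integrable M (\<lambda>\<omega>. (Y \<omega>)\<^sup>2)"
    using Y by (intro integrableI_bounded) (simp_all add: le_less_trans[OF nn])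
  show EY2: "expectation (\<lambda>\<omega>. (Y \<omega>)\<^sup>2) \<le> C"
    using nn C Y2 by (simp add: nn_integral_eq_integral)
  show intY: "integrable M Y"
    using Y Y2 by (rule square_integrable_imp_integrable)
  have intT: "integrable M (T n)" for n
    using T T2 by (rule square_integrable_imp_integrable)
  define tr where "tr K y = max (- K) (min K y)" for K y :: real
  have [measurable]: "tr K \<in> borel_measurable borel" for K
    unfolding tr_def by measurable
  have tr_bd: "\<bar>tr K y\<bar> \<le> K" if "0 < K" for K y
    using that by (auto simp: tr_def)
  have tr_err: "\<bar>y - tr K y\<bar> \<le> y\<^sup>2 / K" if K: "0 < K" for K y
  proof (cases "\<bar>y\<bar> \<le> K")
    case True
    then show ?thesis using K by (auto simp: tr_def)
  next
    case False
    then have "\<bar>y - tr K y\<bar> \<le> \<bar>y\<bar>"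
      using K by (auto simp: tr_def)
    also have "\<dots> \<le> \<bar>y\<bar> * \<bar>y\<bar> / K"
      using False K mult_left_mono[of K "\<bar>y\<bar>" "\<bar>y\<bar>"] by (simp add: pos_le_divide_eq del: abs_mult_self_eq)
    finally show ?thesis
      by (simp add: power2_eq_square)
  qed
  have int_tr: "integrable M (\<lambda>\<omega>. tr K (Z \<omega>))" if "0 < K" "Z \<in> borel_measurable M" for K Z
    using that tr_bd[OF that(1)] by (intro integrable_const_bound[where B=K]) auto
  have E_err: "\<bar>expectation Z - expectation (\<lambda>\<omega>. tr K (Z \<omega>))\<bar> \<le> C / K"
    if K: "0 < K" and Z: "Z \<in> borel_measurable M" "integrable M Z" "integrable M (\<lambda>\<omega>. (Z \<omega>)\<^sup>2)"
      "expectation (\<lambda>\<omega>. (Z \<omega>)\<^sup>2) \<le> C" for K Z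
  proof -
    have "\<bar>expectation Z - expectation (\<lambda>\<omega>. tr K (Z \<omega>))\<bar> = \<bar>expectation (\<lambda>\<omega>. Z \<omega> - tr K (Z \<omega>))\<bar>"
      using Z int_tr[OF K Z(1)] by simp
    also have "\<dots> \<le> expectation (\<lambda>\<omega>. \<bar>Z \<omega> - tr K (Z \<omega>)\<bar>)"
      by (rule integral_abs_bound)
    also have "\<dots> \<le> expectation (\<lambda>\<omega>. (Z \<omega>)\<^sup>2 / K)"
      using Z int_tr[OF K Z(1)] tr_err[OF K] by (intro integral_mono) auto
    also have "\<dots> \<le> C / K"
      using Z K by (simp add: divide_right_mono)
    finally show ?thesis .
  qed
  have "\<bar>expectation Y\<bar> \<le> 2 * C / K" if K: "0 < K" for K
  proof -
    have "(\<lambda>n. expectation (\<lambda>\<omega>. tr K (T n \<omega>))) \<longlonglongrightarrow> expectation (\<lambda>\<omega>. tr K (Y \<omega>))"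
    proof (rule integral_dominated_convergence[where w="\<lambda>_. K"])
      show "AE \<omega> in M. (\<lambda>n. tr K (T n \<omega>)) \<longlonglongrightarrow> tr K (Y \<omega>)"
        using lim by eventually_elim (auto simp: tr_def intro!: tendsto_intros)
    qed (use tr_bd[OF K] in auto)
    moreover have "\<bar>expectation (\<lambda>\<omega>. tr K (T n \<omega>))\<bar> \<le> C / K" for n
      using E_err[OF K T intT T2 bound, of n] ET by simp
    ultimately have "\<bar>expectation (\<lambda>\<omega>. tr K (Y \<omega>))\<bar> \<le> C / K"
      by (intro LIMSEQ_le_const2[OF tendsto_rabs]) auto
    then show ?thesis
      using E_err[OF K Y intY Y2 EY2] by linarith
  qed
  then have "\<forall>\<^sub>F K in at_top. \<bar>expectation Y\<bar> \<le> 2 * C / K"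
    by (auto intro: eventually_mono[OF eventually_gt_at_top[of 0]])
  moreover have "((\<lambda>K. 2 * C / K) \<longlongrightarrow> 0) at_top"
    by real_asymp
  ultimately have "\<bar>expectation Y\<bar> \<le> 0"
    by (intro tendsto_lowerbound) auto
  then show "expectation Y = 0" by simp
qed

lemma (in prob_space) indep_of_subalgebra_expectation_mult:
  fixes Z \<xi> :: "'a \<Rightarrow> real"
  assumes sub: "subalgebra M \<G>"
    and Z: "Z \<in> borel_measurable \<G>" "integrable M Z"
    and \<xi>: "integrable M \<xi>"
    and indep: "indep_set (sets \<G>) {\<xi> -` A \<inter> space M | A. A \<in> sets borel}"
  shows "integrable M (\<lambda>\<omega>. Z \<omega> * \<xi> \<omega>)"
    "expectation (\<lambda>\<omega>. Z \<omega> * \<xi> \<omega>) = expectation Z * expectation \<xi>"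
proof -
  have sp: "space \<G> = space M" using sub by (simp add: subalgebra_def)
  have ZM: "Z \<in> borel_measurable M" using measurable_from_subalg[OF sub Z(1)] .
  have 1: "sigma_sets (space M) {Z -` A \<inter> space M |A. A \<in> sets borel} \<subseteq> sets \<G>"
  proof -
    have "{Z -` A \<inter> space M |A. A \<in> sets borel} \<subseteq> sets \<G>"
      using measurable_sets[OF Z(1)] sp by auto
    from sets.sigma_sets_subset[OF this] sp show ?thesis by simp
  qed
  have 2: "sigma_sets (space M) {\<xi> -` A \<inter> space M |A. A \<in> sets borel} = {\<xi> -` A \<inter> space M |A. A \<in> sets borel}"
    using sets_vimage_algebra[of "space M" \<xi> borel] sets_vimage_algebra2[of \<xi> "space M" borel]
    by (simp add: Pi_def)
  have "indep_set (sigma_sets (space M) {Z -` A \<inter> space M |A. A \<in> sets borel})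
      {\<xi> -` A \<inter> space M | A. A \<in> sets borel}"
    using indep 1 unfolding indep_sets2_eq by blast
  then have "indep_var borel Z borel \<xi>"
    unfolding indep_var_eq 2 using ZM \<xi> by auto
  from indep_var_integrable[OF this Z(2) \<xi>] indep_var_lebesgue_integral[OF this Z(2) \<xi>]
  show "integrable M (\<lambda>\<omega>. Z \<omega> * \<xi> \<omega>)"
    "expectation (\<lambda>\<omega>. Z \<omega> * \<xi> \<omega>) = expectation Z * expectation \<xi>" .
qed

text \<open>
  Discrete stochastic integrals. The cross terms in the square vanish because \<open>\<xi> k\<close> is centred and
  independent of everything that precedes it. The lemma is used for Brownian increments and, to
  control the quadratic variation, for their centred squares.
\<close>

lemma (in prob_space) martingale_transform_moments:
  fixes \<G> :: "nat \<Rightarrow> 'a measure" and G \<xi> :: "nat \<Rightarrow> 'a \<Rightarrow> real"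
  assumes sub: "\<And>k. subalgebra M (\<G> k)"
    and mono: "\<And>k. sets (\<G> k) \<subseteq> sets (\<G> (Suc k))"
    and G: "\<And>k. G k \<in> borel_measurable (\<G> k)" "\<And>k \<omega>. \<omega> \<in> space M \<Longrightarrow> \<bar>G k \<omega>\<bar> \<le> K"
    and \<xi>: "\<And>k. \<xi> k \<in> borel_measurable (\<G> (Suc k))" "\<And>k. integrable M (\<lambda>\<omega>. (\<xi> k \<omega>)\<^sup>2)"
      "\<And>k. expectation (\<xi> k) = 0" "\<And>k. expectation (\<lambda>\<omega>. (\<xi> k \<omega>)\<^sup>2) = v"
    and indep: "\<And>k. indep_set (sets (\<G> k)) {\<xi> k -` A \<inter> space M | A. A \<in> sets borel}"
  defines "S \<equiv> \<lambda>n \<omega>. \<Sum>k<n. G k \<omega> * \<xi> k \<omega>"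
  shows "S n \<in> borel_measurable (\<G> n) \<and> integrable M (\<lambda>\<omega>. (S n \<omega>)\<^sup>2) \<and> expectation (S n) = 0
    \<and> expectation (\<lambda>\<omega>. (S n \<omega>)\<^sup>2) \<le> K\<^sup>2 * real n * v"
proof (induction n)
  case 0
  then show ?case by (simp add: S_def)
next
  case (Suc n)
  have sp: "space (\<G> k) = space M" for k using sub by (simp add: subalgebra_def)
  have subSuc: "f \<in> borel_measurable (\<G> (Suc n))" if "f \<in> borel_measurable (\<G> n)" for f :: "'a \<Rightarrow> real"
    using that mono[of n] sp by (auto simp: measurable_def)
  note [measurable] = measurable_from_subalg[OF sub G(1)] measurable_from_subalg[OF sub \<xi>(1)]
  have SG: "S n \<in> borel_measurable (\<G> n)" and S2: "integrable M (\<lambda>\<omega>. (S n \<omega>)\<^sup>2)"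
    and ES: "expectation (S n) = 0" and ES2: "expectation (\<lambda>\<omega>. (S n \<omega>)\<^sup>2) \<le> K\<^sup>2 * real n * v"
    using Suc.IH by auto
  have SM[measurable]: "S n \<in> borel_measurable M"
    using measurable_from_subalg[OF sub SG] .
  have intS: "integrable M (S n)" using SM S2 by (rule square_integrable_imp_integrable)
  have int\<xi>: "integrable M (\<xi> n)"
    by (rule square_integrable_imp_integrable[OF _ \<xi>(2)]) measurable
  have intG: "integrable M (G n)"
    using G(2) by (intro integrable_const_bound[where B=K]) auto
  have K0: "0 \<le> K"
    using G(2) not_empty by force
  have intSG: "integrable M (\<lambda>\<omega>. S n \<omega> * G n \<omega>)"
  proof (rule Bochner_Integration.integrable_bound)
    show "integrable M (\<lambda>\<omega>. K * S n \<omega>)" using intS by simp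
    show "AE \<omega> in M. norm (S n \<omega> * G n \<omega>) \<le> norm (K * S n \<omega>)"
      using G(2)[of _ n] K0
      by (intro AE_I2) (auto simp: abs_mult mult.commute intro!: mult_right_mono)
  qed measurable
  have SGm: "(\<lambda>\<omega>. S n \<omega> * G n \<omega>) \<in> borel_measurable (\<G> n)"
    using SG G(1) by measurable
  note cross = indep_of_subalgebra_expectation_mult[OF sub SGm intSG int\<xi> indep]
  note lin = indep_of_subalgebra_expectation_mult[OF sub G(1) intG int\<xi> indep]
  have intG2: "integrable M (\<lambda>\<omega>. (G n \<omega> * \<xi> n \<omega>)\<^sup>2)"
    and EG2: "expectation (\<lambda>\<omega>. (G n \<omega> * \<xi> n \<omega>)\<^sup>2) \<le> K\<^sup>2 * v"
  proof -
    have le: "(G n \<omega> * \<xi> n \<omega>)\<^sup>2 \<le> K\<^sup>2 * (\<xi> n \<omega>)\<^sup>2" if "\<omega> \<in> space M" for \<omega>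
      using power_mono[OF G(2)[OF that], of n 2] by (simp add: power_mult_distrib mult_right_mono)
    show 1: "integrable M (\<lambda>\<omega>. (G n \<omega> * \<xi> n \<omega>)\<^sup>2)"
      by (rule Bochner_Integration.integrable_bound[where f="\<lambda>\<omega>. K\<^sup>2 * (\<xi> n \<omega>)\<^sup>2"])
        (use \<xi>(2) le in \<open>auto intro!: AE_I2\<close>)
    have "expectation (\<lambda>\<omega>. (G n \<omega> * \<xi> n \<omega>)\<^sup>2) \<le> expectation (\<lambda>\<omega>. K\<^sup>2 * (\<xi> n \<omega>)\<^sup>2)"
      using 1 \<xi>(2) le by (intro integral_mono) auto
    then show "expectation (\<lambda>\<omega>. (G n \<omega> * \<xi> n \<omega>)\<^sup>2) \<le> K\<^sup>2 * v"
      using \<xi>(4) by simp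
  qed
  have S_Suc: "S (Suc n) \<omega> = S n \<omega> + G n \<omega> * \<xi> n \<omega>" for \<omega>
    by (simp add: S_def)
  have sq: "(S (Suc n) \<omega>)\<^sup>2 = (S n \<omega>)\<^sup>2 + 2 * (S n \<omega> * G n \<omega> * \<xi> n \<omega>) + (G n \<omega> * \<xi> n \<omega>)\<^sup>2" for \<omega>
    unfolding S_Suc by (simp add: power2_eq_square algebra_simps)
  have "S (Suc n) \<in> borel_measurable (\<G> (Suc n))"
    unfolding S_Suc[abs_def] using subSuc[OF SG] subSuc[OF G(1)] \<xi>(1)[of n] by measurable
  moreover have "integrable M (\<lambda>\<omega>. (S (Suc n) \<omega>)\<^sup>2)"
    unfolding sq using S2 cross(1) intG2 by auto
  moreover have "expectation (S (Suc n)) = 0"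
    unfolding S_Suc[abs_def] using ES intS lin \<xi>(3) by simp
  moreover have "expectation (\<lambda>\<omega>. (S (Suc n) \<omega>)\<^sup>2) \<le> K\<^sup>2 * real (Suc n) * v"
  proof -
    have "expectation (\<lambda>\<omega>. (S (Suc n) \<omega>)\<^sup>2) = expectation (\<lambda>\<omega>. (S n \<omega>)\<^sup>2)
        + 2 * expectation (\<lambda>\<omega>. S n \<omega> * G n \<omega> * \<xi> n \<omega>) + expectation (\<lambda>\<omega>. (G n \<omega> * \<xi> n \<omega>)\<^sup>2)"
      unfolding sq using S2 cross(1) intG2 by simp
    then show ?thesis
      using cross(2) ES2 EG2 \<xi>(3)[of n] by (simp add: distrib_left distrib_right)
  qed
  ultimately show ?case by blast
qed

section \<open>Brownian increments along dyadic partitions\<close>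

definition dyadic :: "real \<Rightarrow> nat \<Rightarrow> nat \<Rightarrow> real" where
  "dyadic t m k = t * real k / 2 ^ m"

lemma dyadic_simps [simp]:
  "dyadic t m 0 = 0" "dyadic t m (2 ^ m) = t"
  "dyadic t m (Suc k) - dyadic t m k = t / 2 ^ m"
  by (simp_all add: dyadic_def field_simps)

lemma dyadic_less_Suc: "0 < t \<Longrightarrow> dyadic t m k < dyadic t m (Suc k)"
  by (simp add: dyadic_def divide_strict_right_mono)

lemma dyadic_nonneg: "0 \<le> t \<Longrightarrow> 0 \<le> dyadic t m k"
  by (simp add: dyadic_def)

lemma dyadic_le: "0 \<le> t \<Longrightarrow> k \<le> 2 ^ m \<Longrightarrow> dyadic t m k \<le> t"
proof -
  assume "0 \<le> t" "k \<le> 2 ^ m"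
  then have "t * real k \<le> t * real (2 ^ m)"
    by (intro mult_left_mono) (simp_all only: of_nat_le_iff)
  then show ?thesis by (simp add: dyadic_def field_simps)
qed

lemma dyadic_floor_tendsto: "(\<lambda>n. real_of_int \<lfloor>2 ^ n * s\<rfloor> / 2 ^ n) \<longlonglongrightarrow> (s :: real)"
proof (rule tendsto_sandwich[of "\<lambda>n. s - 1 / 2 ^ n" _ _ "\<lambda>n. s"])
  show "\<forall>\<^sub>F n in sequentially. s - 1 / 2 ^ n \<le> real_of_int \<lfloor>2 ^ n * s\<rfloor> / 2 ^ n"
  proof (intro always_eventually allI)
    fix n
    have "2 ^ n * s - 1 \<le> real_of_int \<lfloor>2 ^ n * s\<rfloor>" by linarith
    from divide_right_mono[OF this, of "2 ^ n"]
    show "s - 1 / 2 ^ n \<le> real_of_int \<lfloor>2 ^ n * s\<rfloor> / 2 ^ n"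
      by (simp add: diff_divide_distrib)
  qed
  show "\<forall>\<^sub>F n in sequentially. real_of_int \<lfloor>2 ^ n * s\<rfloor> / 2 ^ n \<le> s"
    by (intro always_eventually allI) (simp add: field_simps)
  show "(\<lambda>n. s - 1 / 2 ^ n) \<longlonglongrightarrow> s"
    using tendsto_diff[OF tendsto_const LIMSEQ_divide_realpow_zero[of 2 1]] by simp
qed simp

lemma (in prob_space) indep_set_subset: "indep_set \<A> \<B> \<Longrightarrow> \<C> \<subseteq> \<B> \<Longrightarrow> indep_set \<A> \<C>"
  unfolding indep_sets2_eq by blast

context brownian_motion
begin

abbreviation incr :: "real \<Rightarrow> nat \<Rightarrow> nat \<Rightarrow> 'a \<Rightarrow> real" where
  "incr t m k \<omega> \<equiv> B (dyadic t m (Suc k)) \<omega> - B (dyadic t m k) \<omega>"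

lemma B_measurable: "0 \<le> t \<Longrightarrow> B t \<in> borel_measurable M"
  using measurable_from_subalg[OF F_subalgebra B_adapted] .

lemma adapted_mono:
  fixes Z :: "'a \<Rightarrow> real"
  shows "s \<le> t \<Longrightarrow> Z \<in> borel_measurable (F s) \<Longrightarrow> Z \<in> borel_measurable (F t)"
  by (rule measurable_from_subalg[of "F t" "F s"]) (simp_all add: subalgebra_def space_F sets_F_mono)

lemma increment_moments:
  assumes st: "0 \<le> s" "s < t"
  defines "D \<equiv> \<lambda>\<omega>. B t \<omega> - B s \<omega>"
  shows "integrable M (\<lambda>\<omega>. (D \<omega>)\<^sup>2)" "expectation D = 0" "expectation (\<lambda>\<omega>. (D \<omega>)\<^sup>2) = t - s"
    "integrable M (\<lambda>\<omega>. ((D \<omega>)\<^sup>2 - (t - s))\<^sup>2)"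
    "expectation (\<lambda>\<omega>. (D \<omega>)\<^sup>2 - (t - s)) = 0"
    "expectation (\<lambda>\<omega>. ((D \<omega>)\<^sup>2 - (t - s))\<^sup>2) = 2 * (t - s)\<^sup>2"
proof -
  have dist: "distributed M lborel D (\<lambda>z. ennreal (normal_density 0 (sqrt (t - s)) z))"
    using B_increment[OF st] unfolding D_def .
  have pos: "0 < sqrt (t - s)" using st by simp
  have odd: "integrable lborel (\<lambda>z. normal_density 0 (sqrt (t - s)) z * z ^ 1)"
    "(\<integral>z. normal_density 0 (sqrt (t - s)) z * z ^ 1 \<partial>lborel) = 0"
    using normal_moment_odd[OF pos, of 0 0] by (auto simp: has_bochner_integral_iff)
  have even: "integrable lborel (\<lambda>z. normal_density 0 (sqrt (t - s)) z * z ^ (2 * k))"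
    "(\<integral>z. normal_density 0 (sqrt (t - s)) z * z ^ (2 * k) \<partial>lborel) = fact (2 * k) / ((2 / (t - s)) ^ k * fact k)" for k
    using normal_moment_even[OF pos, of 0 k] st by (auto simp: has_bochner_integral_iff)
  have int: "integrable M (\<lambda>\<omega>. D \<omega> ^ n) \<longleftrightarrow> integrable lborel (\<lambda>z. normal_density 0 (sqrt (t - s)) z * z ^ n)" for n
    using distributed_integrable[OF dist, of "\<lambda>z. z ^ n"] by simp
  have ex: "expectation (\<lambda>\<omega>. D \<omega> ^ n) = (\<integral>z. normal_density 0 (sqrt (t - s)) z * z ^ n \<partial>lborel)" for n
    using distributed_integral[OF dist, of "\<lambda>z. z ^ n"] by simp
  show i2: "integrable M (\<lambda>\<omega>. (D \<omega>)\<^sup>2)"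
    using int[of 2] even(1)[of 1] by simp
  show "expectation D = 0"
    using ex[of 1] odd by simp
  show e2: "expectation (\<lambda>\<omega>. (D \<omega>)\<^sup>2) = t - s"
    using ex[of 2] even(2)[of 1] by simp
  have i4: "integrable M (\<lambda>\<omega>. (D \<omega>) ^ 4)"
    using int[of 4] even(1)[of 2] by simp
  have e4: "expectation (\<lambda>\<omega>. (D \<omega>) ^ 4) = 3 * (t - s)\<^sup>2"
    using ex[of 4] even(2)[of 2] st by (simp add: fact_numeral power2_eq_square field_simps)
  have sq: "((D \<omega>)\<^sup>2 - (t - s))\<^sup>2 = D \<omega> ^ 4 - 2 * (t - s) * (D \<omega>)\<^sup>2 + (t - s)\<^sup>2" for \<omega>
    by (simp add: power2_diff flip: power_mult)
  show "integrable M (\<lambda>\<omega>. ((D \<omega>)\<^sup>2 - (t - s))\<^sup>2)"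
    unfolding sq using i2 i4 by auto
  show "expectation (\<lambda>\<omega>. (D \<omega>)\<^sup>2 - (t - s)) = 0"
    using i2 e2 by (simp add: prob_space)
  show "expectation (\<lambda>\<omega>. ((D \<omega>)\<^sup>2 - (t - s))\<^sup>2) = 2 * (t - s)\<^sup>2"
    unfolding sq using i2 e2 i4 e4 by (simp add: prob_space power2_eq_square)
qed

lemma increment_image_indep:
  fixes g :: "real \<Rightarrow> real"
  assumes "0 \<le> s" "s < t" and g: "g \<in> borel_measurable borel"
  shows "indep_set (sets (F s)) {(\<lambda>\<omega>. g (B t \<omega> - B s \<omega>)) -` A \<inter> space M | A. A \<in> sets borel}"
proof -
  have "{(\<lambda>\<omega>. g (B t \<omega> - B s \<omega>)) -` A \<inter> space M | A. A \<in> sets borel}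
      \<subseteq> {(\<lambda>\<omega>. B t \<omega> - B s \<omega>) -` A \<inter> space M | A. A \<in> sets borel}"
  proof safe
    fix A :: "real set" assume "A \<in> sets borel"
    then have "g -` A \<in> sets borel"
      using measurable_sets[OF g] by simp
    then show "\<exists>A'. (\<lambda>\<omega>. g (B t \<omega> - B s \<omega>)) -` A \<inter> space M = (\<lambda>\<omega>. B t \<omega> - B s \<omega>) -` A' \<inter> space M
        \<and> A' \<in> sets borel"
      by (intro exI[of _ "g -` A"]) auto
  qed
  then show ?thesis
    by (rule indep_set_subset[OF B_indep[OF assms(1,2)]])
qed

text \<open>
  The function \<open>g\<close> is the identity for stochastic sums and \<open>d \<mapsto> d\<^sup>2 - t / 2 ^ m\<close> for the quadratic variation.
\<close>

lemma dyadic_transform_moments: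
  fixes Z :: "real \<Rightarrow> 'a \<Rightarrow> real" and H :: "real \<Rightarrow> real" and m :: nat
  assumes t: "0 < t"
    and Z: "\<And>s. 0 \<le> s \<Longrightarrow> Z s \<in> borel_measurable (F s)"
    and H: "H \<in> borel_measurable borel" "\<And>y. \<bar>H y\<bar> \<le> K"
    and g: "g \<in> borel_measurable borel"
      "\<And>k. integrable M (\<lambda>\<omega>. (g (incr t m k \<omega>))\<^sup>2)"
      "\<And>k. expectation (\<lambda>\<omega>. g (incr t m k \<omega>)) = 0"
      "\<And>k. expectation (\<lambda>\<omega>. (g (incr t m k \<omega>))\<^sup>2) = v"
  defines "S \<equiv> \<lambda>\<omega>. \<Sum>k<2^m. H (Z (dyadic t m k) \<omega>) * g (incr t m k \<omega>)"
  shows "S \<in> borel_measurable M" "integrable M (\<lambda>\<omega>. (S \<omega>)\<^sup>2)" "expectation S = 0"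
    "expectation (\<lambda>\<omega>. (S \<omega>)\<^sup>2) \<le> K\<^sup>2 * 2 ^ m * v"
proof -
  let ?d = "dyadic t m"
  have d0: "0 \<le> ?d k" for k using t by (simp add: dyadic_nonneg)
  have dS: "?d k < ?d (Suc k)" for k using t by (rule dyadic_less_Suc)
  have "S \<in> borel_measurable (F (?d (2^m))) \<and> integrable M (\<lambda>\<omega>. (S \<omega>)\<^sup>2) \<and> expectation S = 0
    \<and> expectation (\<lambda>\<omega>. (S \<omega>)\<^sup>2) \<le> K\<^sup>2 * real (2 ^ m) * v"
    unfolding S_def
  proof (rule martingale_transform_moments[where \<G>="\<lambda>k. F (?d k)"])
    show "subalgebra M (F (?d k))" for k using F_subalgebra d0 .
    show "sets (F (?d k)) \<subseteq> sets (F (?d (Suc k)))" for k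
      using dS by (intro sets_F_mono less_imp_le)
    show "(\<lambda>\<omega>. H (Z (?d k) \<omega>)) \<in> borel_measurable (F (?d k))" for k
      using measurable_compose[OF Z[OF d0] H(1)] .
    show "(\<lambda>\<omega>. g (B (?d (Suc k)) \<omega> - B (?d k) \<omega>)) \<in> borel_measurable (F (?d (Suc k)))" for k
      using measurable_compose[OF borel_measurable_diff[OF B_adapted[OF d0]
        adapted_mono[OF less_imp_le[OF dS] B_adapted[OF d0]]] g(1)] .
    show "indep_set (sets (F (?d k))) {(\<lambda>\<omega>. g (B (?d (Suc k)) \<omega> - B (?d k) \<omega>)) -` A \<inter> space M | A. A \<in> sets borel}" for k
      using d0 dS g(1) by (rule increment_image_indep)
  qed (use H(2) g in auto)
  then show "S \<in> borel_measurable M" "integrable M (\<lambda>\<omega>. (S \<omega>)\<^sup>2)" "expectation S = 0"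
    "expectation (\<lambda>\<omega>. (S \<omega>)\<^sup>2) \<le> K\<^sup>2 * 2 ^ m * v"
    using measurable_from_subalg[OF F_subalgebra[OF less_imp_le[OF t]]] by auto
qed

lemma stochastic_sum_moments:
  fixes Z :: "real \<Rightarrow> 'a \<Rightarrow> real" and H :: "real \<Rightarrow> real" and m :: nat
  assumes t: "0 < t"
    and Z: "\<And>s. 0 \<le> s \<Longrightarrow> Z s \<in> borel_measurable (F s)"
    and H: "H \<in> borel_measurable borel" "\<And>y. \<bar>H y\<bar> \<le> K"
  defines "S \<equiv> \<lambda>\<omega>. \<Sum>k<2^m. H (Z (dyadic t m k) \<omega>) * (incr t m k \<omega>)"
  shows "S \<in> borel_measurable M" "integrable M (\<lambda>\<omega>. (S \<omega>)\<^sup>2)" "expectation S = 0"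
    "expectation (\<lambda>\<omega>. (S \<omega>)\<^sup>2) \<le> K\<^sup>2 * t"
proof -
  have d0: "0 \<le> dyadic t m k" for k using t by (simp add: dyadic_nonneg)
  have mom: "integrable M (\<lambda>\<omega>. (incr t m k \<omega>)\<^sup>2)"
    "expectation (\<lambda>\<omega>. incr t m k \<omega>) = 0"
    "expectation (\<lambda>\<omega>. (incr t m k \<omega>)\<^sup>2) = t / 2 ^ m" for k
    using increment_moments[OF d0 dyadic_less_Suc[OF t], of k] by simp_all
  note T = dyadic_transform_moments[where g="\<lambda>d. d" and v="t/2^m" and m=m and t=t and Z=Z and H=H and K=K,
      OF t Z H _ mom]
  show "S \<in> borel_measurable M" "integrable M (\<lambda>\<omega>. (S \<omega>)\<^sup>2)" "expectation S = 0"
    unfolding S_def by (rule T; simp)+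
  show "expectation (\<lambda>\<omega>. (S \<omega>)\<^sup>2) \<le> K\<^sup>2 * t"
    using T(4) unfolding S_def by simp
qed

text \<open>
  The second moments of these sums are of order \<open>1 / 2 ^ m\<close>, hence summable, and so the sums tend to zero
  almost surely and not merely along a subsequence.
\<close>

lemma quadratic_variation_AE:
  fixes Z :: "real \<Rightarrow> 'a \<Rightarrow> real" and H :: "real \<Rightarrow> real" and m :: nat
  assumes t: "0 < t"
    and Z: "\<And>s. 0 \<le> s \<Longrightarrow> Z s \<in> borel_measurable (F s)"
    and H: "H \<in> borel_measurable borel" "\<And>y. \<bar>H y\<bar> \<le> K"
  shows "AE \<omega> in M. (\<lambda>m. \<Sum>k<2^m. H (Z (dyadic t m k) \<omega>) *
      ((incr t m k \<omega>)\<^sup>2 - t / 2 ^ m)) \<longlonglongrightarrow> 0"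
proof -
  define Q where "Q m \<omega> = (\<Sum>k<2^m. H (Z (dyadic t m k) \<omega>) *
      ((incr t m k \<omega>)\<^sup>2 - t / 2 ^ m))" for m \<omega>
  have d0: "0 \<le> dyadic t m k" for m k using t by (simp add: dyadic_nonneg)
  define \<xi> where "\<xi> m k \<omega> = (incr t m k \<omega>)\<^sup>2 - t / 2 ^ m" for m k \<omega>
  have mom: "integrable M (\<lambda>\<omega>. (\<xi> m k \<omega>)\<^sup>2)" "expectation (\<xi> m k) = 0"
    "expectation (\<lambda>\<omega>. (\<xi> m k \<omega>)\<^sup>2) = 2 * (t / 2 ^ m)\<^sup>2" for m k
    using increment_moments(4,5,6)[OF d0 dyadic_less_Suc[OF t], of m k] unfolding \<xi>_def by simp_all
  note T = dyadic_transform_moments[where g="\<lambda>d. d\<^sup>2 - t / 2 ^ m" and v="2 * (t / 2 ^ m)\<^sup>2" and m=m and t=t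
      and Z=Z and H=H and K=K for m, OF t Z H _ mom[unfolded \<xi>_def]]
  have Q: "Q m \<in> borel_measurable M" "integrable M (\<lambda>\<omega>. (Q m \<omega>)\<^sup>2)"
    "expectation (\<lambda>\<omega>. (Q m \<omega>)\<^sup>2) \<le> K\<^sup>2 * 2 ^ m * (2 * (t / 2 ^ m)\<^sup>2)" for m
    unfolding Q_def by (rule T; simp)+
  have "(\<integral>\<^sup>+\<omega>. (\<Sum>m. ennreal ((Q m \<omega>)\<^sup>2)) \<partial>M) = (\<Sum>m. \<integral>\<^sup>+\<omega>. ennreal ((Q m \<omega>)\<^sup>2) \<partial>M)"
    using Q(1) by (intro nn_integral_suminf) simp
  also have "\<dots> \<le> (\<Sum>m. ennreal (2 * K\<^sup>2 * t\<^sup>2 * (1 / 2) ^ m))"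
  proof (intro suminf_le summableI allI)
    fix m
    have eq: "K\<^sup>2 * 2 ^ m * (2 * (t / 2 ^ m)\<^sup>2) = 2 * K\<^sup>2 * t\<^sup>2 * (1 / 2) ^ m"
      by (simp add: power2_eq_square field_simps)
    have "(\<integral>\<^sup>+\<omega>. ennreal ((Q m \<omega>)\<^sup>2) \<partial>M) = ennreal (expectation (\<lambda>\<omega>. (Q m \<omega>)\<^sup>2))"
      using Q(2) by (rule nn_integral_eq_integral) simp
    also have "\<dots> \<le> ennreal (2 * K\<^sup>2 * t\<^sup>2 * (1 / 2) ^ m)"
      by (rule ennreal_leI[OF Q(3)[of m, unfolded eq]])
    finally show "(\<integral>\<^sup>+\<omega>. ennreal ((Q m \<omega>)\<^sup>2) \<partial>M) \<le> ennreal (2 * K\<^sup>2 * t\<^sup>2 * (1 / 2) ^ m)" .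
  qed
  finally have le: "(\<integral>\<^sup>+\<omega>. (\<Sum>m. ennreal ((Q m \<omega>)\<^sup>2)) \<partial>M) \<le> (\<Sum>m. ennreal (2 * K\<^sup>2 * t\<^sup>2 * (1 / 2) ^ m))" .
  have "summable (\<lambda>m. 2 * K\<^sup>2 * t\<^sup>2 * (1 / 2) ^ m :: real)"
    by (intro summable_mult summable_geometric) simp
  then have "(\<Sum>m. ennreal (2 * K\<^sup>2 * t\<^sup>2 * (1 / 2) ^ m)) \<noteq> top"
    by (rule ennreal_suminf_neq_top) simp
  then have "(\<integral>\<^sup>+\<omega>. (\<Sum>m. ennreal ((Q m \<omega>)\<^sup>2)) \<partial>M) \<noteq> \<infinity>"
    using le by (metis infinity_ennreal_def top.extremum_uniqueI)
  then have "AE \<omega> in M. (\<Sum>m. ennreal ((Q m \<omega>)\<^sup>2)) \<noteq> \<infinity>"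
    using Q(1) by (intro nn_integral_PInf_AE borel_measurable_suminf_order) simp_all
  then have "AE \<omega> in M. (\<lambda>m. Q m \<omega>) \<longlonglongrightarrow> 0"
  proof eventually_elim
    case (elim \<omega>)
    then have "summable (\<lambda>m. (Q m \<omega>)\<^sup>2)"
      by (intro summable_suminf_not_top) simp_all
    then have "(\<lambda>m. sqrt ((Q m \<omega>)\<^sup>2)) \<longlonglongrightarrow> sqrt 0"
      by (intro tendsto_real_sqrt summable_LIMSEQ_zero)
    then show ?case
      by (simp add: tendsto_rabs_zero_iff)
  qed
  then show ?thesis by (simp add: Q_def)
qed

end

section \<open>A pathwise Ito formula with local time\<close>

text \<open>
  The form in which a bound by a modulus of continuity becomes convergence.
\<close>

lemma tendsto_of_eventually_le_mult:
  fixes T :: "nat \<Rightarrow> real"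
  assumes C: "0 \<le> C" and le: "\<And>\<eta>. 0 < \<eta> \<Longrightarrow> \<forall>\<^sub>F m in sequentially. \<bar>T m - l\<bar> \<le> C * \<eta>"
  shows "T \<longlonglongrightarrow> l"
proof (rule tendstoI)
  fix e :: real assume e: "0 < e"
  have "C * (e / (C + 1)) < e"
    using C e by (simp add: field_simps)
  with le[of "e / (C + 1)"] C e show "\<forall>\<^sub>F m in sequentially. dist (T m) l < e"
    by (auto simp: dist_real_def elim!: eventually_mono)
qed

lemma dyadic_oscillation:
  fixes u :: "real \<Rightarrow> real"
  assumes t: "0 < t" and u: "continuous_on UNIV u" and \<eta>: "0 < \<eta>"
  shows "\<forall>\<^sub>F m in sequentially. \<forall>k<2^m. \<forall>s\<in>{dyadic t m k..dyadic t m (Suc k)}. \<forall>r\<in>{dyadic t m k..dyadic t m (Suc k)}. \<bar>u s - u r\<bar> \<le> \<eta>"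
proof -
  have "uniformly_continuous_on {0..t} u"
    using u by (intro compact_uniformly_continuous continuous_on_subset[OF u]) auto
  then obtain d where d: "0 < d" "\<And>s r. s \<in> {0..t} \<Longrightarrow> r \<in> {0..t} \<Longrightarrow> dist r s < d \<Longrightarrow> dist (u r) (u s) < \<eta>"
    using \<eta> unfolding uniformly_continuous_on_def by metis
  have "(\<lambda>m. t / 2 ^ m) \<longlonglongrightarrow> 0"
    using LIMSEQ_divide_realpow_zero[of 2 t] by simp
  then have "\<forall>\<^sub>F m in sequentially. t / 2 ^ m < d"
    using d(1) by (rule order_tendstoD)
  then show ?thesis
  proof eventually_elim
    case (elim m)
    show ?case
    proof (intro allI impI ballI)
      fix k s r assume k: "k < (2::nat) ^ m" and s: "s \<in> {dyadic t m k..dyadic t m (Suc k)}"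
        and r: "r \<in> {dyadic t m k..dyadic t m (Suc k)}"
      have "0 \<le> dyadic t m k" "dyadic t m (Suc k) \<le> t"
        using t k by (auto intro!: dyadic_nonneg dyadic_le)
      moreover have "\<bar>s - r\<bar> < d"
        using s r elim dyadic_simps(3)[of t m k] unfolding atLeastAtMost_iff by linarith
      ultimately show "\<bar>u s - u r\<bar> \<le> \<eta>"
        using d(2)[of r s] s r by (simp add: dist_real_def)
    qed
  qed
qed

lemma dyadic_telescope:
  fixes u :: "real \<Rightarrow> 'b::ab_group_add"
  shows "(\<Sum>k<2^m. u (dyadic t m (Suc k)) - u (dyadic t m k)) = u t - u 0"
  by (simp only: sum_lessThan_telescope[of "\<lambda>k. u (dyadic t m k)"] dyadic_simps)

lemma set_integrable_Icc_bounded: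
  fixes h :: "real \<Rightarrow> real"
  assumes "h \<in> borel_measurable borel" "\<And>s. s \<in> {a..b} \<Longrightarrow> \<bar>h s\<bar> \<le> K"
  shows "set_integrable lborel {a..b} h"
  unfolding set_integrable_def
proof (rule Bochner_Integration.integrable_bound)
  show "integrable lborel (\<lambda>s. K * indicator {a..b} s)"
    by (cases "a \<le> b") auto
  show "AE s in lborel. norm (indicat_real {a..b} s *\<^sub>R h s) \<le> norm (K * indicator {a..b} s)"
    by (intro AE_I2) (auto simp: indicator_def intro: order_trans[OF assms(2) abs_ge_self])
qed (use assms(1) in measurable)

lemma primitive_increment:
  fixes h :: "real \<Rightarrow> real"
  assumes "h \<in> borel_measurable borel" "\<And>s. s \<in> {0..b} \<Longrightarrow> \<bar>h s\<bar> \<le> K" "0 \<le> a" "a \<le> b"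
  shows "(LINT s:{0..b}|lborel. h s) - (LINT s:{0..a}|lborel. h s) = (LINT s:{a<..b}|lborel. h s)"
    and "set_integrable lborel {a<..b} h"
proof -
  have int: "set_integrable lborel {0..b} h"
    using assms(1,2) by (rule set_integrable_Icc_bounded)
  show 1: "set_integrable lborel {a<..b} h"
    by (rule set_integrable_subset[OF int]) (use assms in auto)
  have "set_integrable lborel {0..a} h"
    by (rule set_integrable_subset[OF int]) (use assms in auto)
  moreover have "{0..b} = {0..a} \<union> {a<..b}" "{0..a} \<inter> {a<..b} = {}" using assms by auto
  ultimately show "(LINT s:{0..b}|lborel. h s) - (LINT s:{0..a}|lborel. h s) = (LINT s:{a<..b}|lborel. h s)"
    using 1 by (simp add: set_integral_Un)
qed

lemma set_integral_singleton:
  fixes h :: "real \<Rightarrow> real"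
  shows "(LINT s:{a}|lborel. h s) = 0"
  unfolding set_lebesgue_integral_def
  by (rule integral_eq_zero_AE) (use AE_lborel_singleton[of a] in eventually_elim, auto)

lemma set_integral_Ioc_bound:
  fixes h :: "real \<Rightarrow> real"
  assumes "a \<le> b" "set_integrable lborel {a<..b} h" "\<And>s. s \<in> {a<..b} \<Longrightarrow> \<bar>h s\<bar> \<le> K"
  shows "\<bar>LINT s:{a<..b}|lborel. h s\<bar> \<le> K * (b - a)"
proof -
  have "\<bar>LINT s:{a<..b}|lborel. h s\<bar> \<le> (LINT s:{a<..b}|lborel. \<bar>h s\<bar>)"
    using set_integral_norm_bound[OF assms(2)] by simp
  also have "\<dots> \<le> (LINT s:{a<..b}|lborel. K)"
  proof (rule set_integral_mono)
    show "set_integrable lborel {a<..b} (\<lambda>s. \<bar>h s\<bar>)"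
      using assms(2) by (rule set_integrable_abs)
    show "set_integrable lborel {a<..b} (\<lambda>s. K)"
      using assms(1) by (simp add: set_integrable_def)
  qed (use assms(3) in auto)
  also have "\<dots> = K * (b - a)"
    using assms(1) by (simp add: set_lebesgue_integral_def)
  finally show ?thesis .
qed

text \<open>
  Riemann-Stieltjes sums against the primitive of a bounded function, which need not be continuous:
  here \<open>h\<close> will be the drift along the path, which jumps whenever the path changes sign.
\<close>

lemma dyadic_sum_tendsto_integral:
  fixes u h :: "real \<Rightarrow> real"
  assumes t: "0 < t" and u: "continuous_on UNIV u" and h: "h \<in> borel_measurable borel" "\<And>s. \<bar>h s\<bar> \<le> K"
  shows "(\<lambda>m. \<Sum>k<2^m. u (dyadic t m k) *
      ((LINT s:{0..dyadic t m (Suc k)}|lborel. h s) - (LINT s:{0..dyadic t m k}|lborel. h s)))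
     \<longlonglongrightarrow> (LINT s:{0..t}|lborel. u s * h s)"
proof (rule tendsto_of_eventually_le_mult[where C="K * t"])
  have K: "0 \<le> K" using h(2)[of 0] by simp
  show "0 \<le> K * t" using K t by simp
  have [measurable]: "u \<in> borel_measurable borel"
    using u by (rule borel_measurable_continuous_onI)
  note [measurable] = h(1)
  obtain U where U: "\<And>s. s \<in> {0..t} \<Longrightarrow> \<bar>u s\<bar> \<le> U"
  proof -
    have "bounded (u ` {0..t})"
      by (intro compact_imp_bounded compact_continuous_image continuous_on_subset[OF u]) auto
    then obtain U where "\<forall>y\<in>u ` {0..t}. norm y \<le> U"
      unfolding bounded_iff by blast
    then show ?thesis using that[of U] by auto
  qed
  let ?I = "\<lambda>s. LINT r:{0..s}|lborel. h r" and ?J = "\<lambda>s. LINT r:{0..s}|lborel. u r * h r"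
  fix \<eta> :: real assume \<eta>: "0 < \<eta>"
  show "\<forall>\<^sub>F m in sequentially. \<bar>(\<Sum>k<2^m. u (dyadic t m k) * (?I (dyadic t m (Suc k)) - ?I (dyadic t m k))) - ?J t\<bar> \<le> K * t * \<eta>"
    using dyadic_oscillation[OF t u \<eta>]
  proof eventually_elim
    case (elim m)
    let ?d = "dyadic t m"
    have step: "\<bar>u (?d k) * (?I (?d (Suc k)) - ?I (?d k)) - (?J (?d (Suc k)) - ?J (?d k))\<bar> \<le> \<eta> * K * (t / 2 ^ m)"
      if k: "k < 2 ^ m" for k
    proof -
      have d: "0 \<le> ?d k" "?d k \<le> ?d (Suc k)" "?d (Suc k) \<le> t"
        using t k by (auto intro!: dyadic_nonneg dyadic_le less_imp_le[OF dyadic_less_Suc])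
      have uh: "\<bar>u s * h s\<bar> \<le> U * K" if "s \<in> {0..?d (Suc k)}" for s
        unfolding abs_mult using h(2)[of s] U[of s] that d by (intro mult_mono) auto
      note I = primitive_increment[OF h(1) h(2) d(1,2)]
      note J = primitive_increment[OF _ uh d(1,2)]
      have "u (?d k) * (?I (?d (Suc k)) - ?I (?d k)) - (?J (?d (Suc k)) - ?J (?d k))
          = (LINT s:{?d k<..?d (Suc k)}|lborel. u (?d k) * h s - u s * h s)"
        using I J by (subst set_integral_diff) auto
      also have "\<bar>\<dots>\<bar> \<le> \<eta> * K * (?d (Suc k) - ?d k)"
      proof (rule set_integral_Ioc_bound[OF d(2)])
        show "set_integrable lborel {?d k<..?d (Suc k)} (\<lambda>s. u (?d k) * h s - u s * h s)"
          using I J by (intro set_integral_diff) auto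
        fix s assume s: "s \<in> {?d k<..?d (Suc k)}"
        have "\<bar>u (?d k) - u s\<bar> \<le> \<eta>"
          using elim k s by auto
        then show "\<bar>u (?d k) * h s - u s * h s\<bar> \<le> \<eta> * K"
          using h(2)[of s] \<eta> unfolding left_diff_distrib[symmetric] abs_mult by (intro mult_mono) auto
      qed
      finally show ?thesis by simp
    qed
    have eq: "(\<Sum>k<2^m. u (?d k) * (?I (?d (Suc k)) - ?I (?d k))) - ?J t
        = (\<Sum>k<2^m. u (?d k) * (?I (?d (Suc k)) - ?I (?d k)) - (?J (?d (Suc k)) - ?J (?d k)))"
      unfolding sum_subtractf[of _ "\<lambda>k. ?J (?d (Suc k)) - ?J (?d k)"] dyadic_telescope[of ?J]
      by (simp add: set_integral_singleton)
    have const: "(\<Sum>k<(2::nat)^m. \<eta> * K * (t / 2 ^ m)) = K * t * \<eta>"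
      by simp
    show ?case
      unfolding eq const[symmetric] by (intro order_trans[OF sum_abs] sum_mono step) simp
  qed
qed

lemma Taylor2_between:
  fixes G G' G'' :: "real \<Rightarrow> real"
  assumes G: "\<And>y. (G has_real_derivative G' y) (at y)" "\<And>y. (G' has_real_derivative G'' y) (at y)"
  shows "\<exists>\<xi>\<in>closed_segment a b. G b - G a = G' a * (b - a) + G'' \<xi> / 2 * (b - a)\<^sup>2"
proof -
  define diff where "diff n = (if n = 0 then G else if n = 1 then G' else G'')" for n :: nat
  have D: "\<forall>m t. m < 2 \<and> min a b \<le> t \<and> t \<le> max a b \<longrightarrow> DERIV (diff m) t :> diff (Suc m) t"
    using G by (auto simp: diff_def less_2_cases_iff)
  consider "a < b" | "b < a" | "a = b" by linarith
  then show ?thesis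
  proof cases
    case 1
    with Taylor_up[of 2 diff G "min a b" "max a b" a] D obtain t where "a < t" "t < b"
      "G b = (\<Sum>m<2. diff m a / fact m * (b - a) ^ m) + diff 2 t / fact 2 * (b - a)\<^sup>2"
      by (auto simp: diff_def)
    then show ?thesis
      by (intro bexI[of _ t]) (auto simp: diff_def closed_segment_eq_real_ivl numeral_2_eq_2)
  next
    case 2
    with Taylor_down[of 2 diff G "min a b" "max a b" a] D obtain t where "b < t" "t < a"
      "G b = (\<Sum>m<2. diff m a / fact m * (b - a) ^ m) + diff 2 t / fact 2 * (b - a)\<^sup>2"
      by (auto simp: diff_def)
    then show ?thesis
      by (intro bexI[of _ t]) (auto simp: diff_def closed_segment_eq_real_ivl numeral_2_eq_2)
  qed auto
qed

lemma local_time_set_measurable: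
  fixes w :: "real \<Rightarrow> real"
  assumes "continuous_on UNIV w"
  shows "{s \<in> {0..t}. \<bar>w s - a\<bar> \<le> \<epsilon>} \<in> fmeasurable lborel"
proof -
  have "{s. \<bar>w s - a\<bar> \<le> \<epsilon>} = w -` {a - \<epsilon>..a + \<epsilon>}" by auto
  also have "closed \<dots>"
    using assms by (intro closed_vimage) auto
  finally have "{s. \<bar>w s - a\<bar> \<le> \<epsilon>} \<in> sets borel" by auto
  moreover have "{s \<in> {0..t}. \<bar>w s - a\<bar> \<le> \<epsilon>} = {0..t} \<inter> {s. \<bar>w s - a\<bar> \<le> \<epsilon>}" by auto
  moreover have "{0..t} \<in> fmeasurable lborel"
    by (intro fmeasurableI) (auto simp: emeasure_lborel_Icc_eq)
  ultimately show ?thesis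
    by (metis fmeasurable_Int_fmeasurable sets_lborel)
qed

lemma local_time_mono:
  assumes w: "continuous_on UNIV w" and "has_symmetric_local_time w a s l" "has_symmetric_local_time w a t l'" "s \<le> t"
  shows "l \<le> l'"
proof (rule tendsto_le[OF _ assms(3)[unfolded has_symmetric_local_time_def] assms(2)[unfolded has_symmetric_local_time_def]])
  show "\<forall>\<^sub>F \<epsilon> in at_right 0. measure lborel {r \<in> {0..s}. \<bar>w r - a\<bar> \<le> \<epsilon>} / (2 * \<epsilon>)
      \<le> measure lborel {r \<in> {0..t}. \<bar>w r - a\<bar> \<le> \<epsilon>} / (2 * \<epsilon>)"
    using eventually_at_right_less[of 0]
  proof eventually_elim
    case (elim \<epsilon>)
    then show ?case
      using \<open>s \<le> t\<close> by (intro divide_right_mono measure_mono_fmeasurable local_time_set_measurable w fmeasurableD) auto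
  qed
qed simp

text \<open>
  On a compact time interval a path that avoids the level keeps a positive distance from it, so the
  occupation times of small neighbourhoods do not change there.
\<close>

lemma local_time_const_off_level:
  assumes w: "continuous_on UNIV w" and l: "has_symmetric_local_time w a s l" "has_symmetric_local_time w a t l'"
    and st: "0 \<le> s" "s \<le> t" and off: "\<And>r. r \<in> {s..t} \<Longrightarrow> w r \<noteq> a"
  shows "l = l'"
proof -
  have "continuous_on {s..t} (\<lambda>r. \<bar>w r - a\<bar>)"
    by (intro continuous_intros continuous_on_subset[OF w]) auto
  then obtain r where r: "r \<in> {s..t}" "\<And>r'. r' \<in> {s..t} \<Longrightarrow> \<bar>w r - a\<bar> \<le> \<bar>w r' - a\<bar>"
    using continuous_attains_inf[of "{s..t}" "\<lambda>r. \<bar>w r - a\<bar>"] st by auto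
  have "0 < \<bar>w r - a\<bar>" using off[OF r(1)] by simp
  then have "\<forall>\<^sub>F \<epsilon> in at_right 0. \<epsilon> < \<bar>w r - a\<bar>"
    unfolding eventually_at_right_field by blast
  then have "\<forall>\<^sub>F \<epsilon> in at_right 0. measure lborel {r \<in> {0..s}. \<bar>w r - a\<bar> \<le> \<epsilon>} / (2 * \<epsilon>)
      = measure lborel {r \<in> {0..t}. \<bar>w r - a\<bar> \<le> \<epsilon>} / (2 * \<epsilon>)"
  proof eventually_elim
    case (elim \<epsilon>)
    have "{r \<in> {0..s}. \<bar>w r - a\<bar> \<le> \<epsilon>} = {r \<in> {0..t}. \<bar>w r - a\<bar> \<le> \<epsilon>}"
      using r(2) elim st by (smt (verit) Collect_cong atLeastAtMost_iff)
    then show ?case by simp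
  qed
  from Lim_transform_eventually[OF l(1)[unfolded has_symmetric_local_time_def] this] l(2)
  show ?thesis
    unfolding has_symmetric_local_time_def by (intro tendsto_unique[OF _ _ l(2)[unfolded has_symmetric_local_time_def]]) auto
qed

lemma local_time_at_zero: "has_symmetric_local_time w a 0 l \<Longrightarrow> l = 0"
proof -
  assume l: "has_symmetric_local_time w a 0 l"
  have "{s \<in> {0..0}. \<bar>w s - a\<bar> \<le> \<epsilon>} = (if \<bar>w 0 - a\<bar> \<le> \<epsilon> then {0} else {})" for \<epsilon>
    by auto
  then have "measure lborel {s \<in> {0..0}. \<bar>w s - a\<bar> \<le> \<epsilon>} = 0" for \<epsilon>
    by simp
  then show "l = 0"
    using l unfolding has_symmetric_local_time_def by (simp add: tendsto_const_iff)
qed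

text \<open>
  Foellmer's approach to the Ito formula, for a path whose finite variation part is
  \<open>A = \<beta> L + \<integral> drift\<close>. In the Taylor expansion of \<open>G (w t) - G (w 0)\<close> over a dyadic partition the sum of
  \<open>G' (w) dL\<close> tends to \<open>G' 0 * L t\<close>, because an interval on which \<open>L\<close> grows contains a zero of \<open>w\<close>.
  The squared increments of \<open>w\<close> may be replaced by those of \<open>b\<close>, because their difference is
  bounded by the variation of \<open>A\<close> times the oscillation of the paths. The hypotheses \<open>QV\<close> then
  turn the latter into time.
\<close>

theorem pathwise_Ito:
  fixes w b drift G G' G'' :: "real \<Rightarrow> real" and L :: "real \<Rightarrow> real"
  assumes t: "0 < t" and w: "continuous_on UNIV w" and b: "continuous_on UNIV b"
    and L: "\<And>s. 0 \<le> s \<Longrightarrow> has_symmetric_local_time w 0 s (L s)"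
    and drift: "drift \<in> borel_measurable borel" "\<And>y. \<bar>drift y\<bar> \<le> D"
    and eq: "\<And>s. 0 \<le> s \<Longrightarrow> w s = w 0 + (b s - b 0) + \<beta> * L s + (LINT r:{0..s}|lborel. drift (w r))"
    and G: "\<And>y. (G has_real_derivative G' y) (at y)" "\<And>y. (G' has_real_derivative G'' y) (at y)"
      "continuous_on UNIV G''" "\<And>y. \<bar>G'' y\<bar> \<le> K"
    and QV: "(\<lambda>m. \<Sum>k<2^m. ((b (dyadic t m (Suc k)) - b (dyadic t m k))\<^sup>2 - t / 2 ^ m)) \<longlonglongrightarrow> 0"
      "(\<lambda>m. \<Sum>k<2^m. G'' (w (dyadic t m k)) * ((b (dyadic t m (Suc k)) - b (dyadic t m k))\<^sup>2 - t / 2 ^ m)) \<longlonglongrightarrow> 0"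
  shows "(\<lambda>m. \<Sum>k<2^m. G' (w (dyadic t m k)) * (b (dyadic t m (Suc k)) - b (dyadic t m k)))
     \<longlonglongrightarrow> G (w t) - G (w 0) - G' 0 * (\<beta> * L t) - (LINT s:{0..t}|lborel. G' (w s) * drift (w s))
        - (LINT s:{0..t}|lborel. G'' (w s)) / 2"
proof -
  let ?d = "dyadic t"
  have d0: "0 \<le> ?d m k" for m k using t by (simp add: dyadic_nonneg)
  have dS: "?d m k < ?d m (Suc k)" for m k using t by (rule dyadic_less_Suc)
  have "continuous_on UNIV G'"
    using G(2) by (meson DERIV_isCont continuous_at_imp_continuous_on)
  then have G'w: "continuous_on UNIV (\<lambda>s. G' (w s))" and G''w: "continuous_on UNIV (\<lambda>s. G'' (w s))"
    using continuous_on_compose2[OF _ w] G(3) by auto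
  have wm: "w \<in> borel_measurable borel"
    using w by (rule borel_measurable_continuous_onI)
  have drift_w: "(\<lambda>s. drift (w s)) \<in> borel_measurable borel"
    using measurable_compose[OF wm drift(1)] .
  define I where "I s = (LINT r:{0..s}|lborel. drift (w r))" for s
  define A where "A s = \<beta> * L s + I s" for s
  let ?dw = "\<lambda>m k. w (?d m (Suc k)) - w (?d m k)"
  let ?db = "\<lambda>m k. b (?d m (Suc k)) - b (?d m k)"
  let ?dL = "\<lambda>m k. L (?d m (Suc k)) - L (?d m k)"
  let ?dI = "\<lambda>m k. I (?d m (Suc k)) - I (?d m k)"
  let ?dA = "\<lambda>m k. A (?d m (Suc k)) - A (?d m k)"
  have D: "0 \<le> D" and K: "0 \<le> K"
    using drift(2)[of 0] G(4)[of 0] by auto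
  have L0: "L 0 = 0" using local_time_at_zero[OF L] by simp
  have L_mono: "L r \<le> L s" if "0 \<le> r" "r \<le> s" for r s
    using local_time_mono[OF w L L] that by simp
  have I_inc: "\<bar>I (?d m (Suc k)) - I (?d m k)\<bar> \<le> D * (t / 2 ^ m)" for m k
  proof -
    note P = primitive_increment[OF drift_w drift(2) d0 less_imp_le[OF dS], of m k]
    show ?thesis
      unfolding I_def P(1) using set_integral_Ioc_bound[OF less_imp_le[OF dS] P(2) drift(2)] by simp
  qed
  define V where "V = \<bar>\<beta>\<bar> * L t + D * t"
  have A_var: "(\<Sum>k<2^m. \<bar>?dA m k\<bar>) \<le> V" for m
  proof -
    have "(\<Sum>k<2^m. \<bar>?dA m k\<bar>)
        \<le> (\<Sum>k<2^m. \<bar>\<beta>\<bar> * ?dL m k + D * (t / 2 ^ m))"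
    proof (rule sum_mono)
      fix k
      have "\<bar>\<beta> * L (?d m (Suc k)) - \<beta> * L (?d m k)\<bar> = \<bar>\<beta>\<bar> * ?dL m k"
        using L_mono[OF d0 less_imp_le[OF dS], of m k] by (simp add: abs_mult flip: right_diff_distrib)
      then show "\<bar>?dA m k\<bar> \<le> \<bar>\<beta>\<bar> * ?dL m k + D * (t / 2 ^ m)"
        using I_inc[of m k] unfolding A_def by linarith
    qed
    also have "\<dots> = V"
      unfolding sum.distrib sum_distrib_left[symmetric] dyadic_telescope[of L] V_def L0 by simp
    finally show ?thesis .
  qed
  have V: "0 \<le> V"
    using A_var[of 0] by (rule order_trans[rotated]) (simp add: sum_nonneg)
  have wA: "w s - w r = (b s - b r) + (A s - A r)" if "0 \<le> r" "0 \<le> s" for r s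
    using eq[OF that(1)] eq[OF that(2)] unfolding A_def I_def by simp
  have T1: "(\<lambda>m. \<Sum>k<2^m. G' (w (?d m k)) * (\<beta> * ?dL m k)) \<longlonglongrightarrow> G' 0 * (\<beta> * L t)"
  proof (rule tendsto_of_eventually_le_mult[where C="\<bar>\<beta>\<bar> * L t"])
    show "0 \<le> \<bar>\<beta>\<bar> * L t" using L_mono[of 0 t] L0 t by simp
    fix \<eta> :: real assume \<eta>: "0 < \<eta>"
    show "\<forall>\<^sub>F m in sequentially. \<bar>(\<Sum>k<2^m. G' (w (?d m k)) * (\<beta> * ?dL m k)) - G' 0 * (\<beta> * L t)\<bar>
        \<le> \<bar>\<beta>\<bar> * L t * \<eta>"
      using dyadic_oscillation[OF t G'w \<eta>]
    proof eventually_elim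
      case (elim m)
      have "(\<Sum>k<2^m. G' 0 * (\<beta> * ?dL m k)) = G' 0 * (\<beta> * L t)"
        unfolding sum_distrib_left[symmetric] dyadic_telescope[of L] L0 by simp
      then have "(\<Sum>k<2^m. G' (w (?d m k)) * (\<beta> * ?dL m k)) - G' 0 * (\<beta> * L t)
          = (\<Sum>k<2^m. (G' (w (?d m k)) - G' 0) * (\<beta> * ?dL m k))"
        by (simp only: left_diff_distrib[where c="\<beta> * _"] sum_subtractf)
      also have "\<bar>\<dots>\<bar> \<le> (\<Sum>k<2^m. \<eta> * (\<bar>\<beta>\<bar> * ?dL m k))"
      proof (intro order_trans[OF sum_abs] sum_mono)
        fix k assume k: "k \<in> {..<(2::nat)^m}"
        have dL: "0 \<le> L (?d m (Suc k)) - L (?d m k)"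
          using L_mono[OF d0 less_imp_le[OF dS], of m k] by simp
        show "\<bar>(G' (w (?d m k)) - G' 0) * (\<beta> * ?dL m k)\<bar> \<le> \<eta> * (\<bar>\<beta>\<bar> * ?dL m k)"
        proof (cases "\<exists>r\<in>{?d m k..?d m (Suc k)}. w r = 0")
          case True
          then obtain r where "r \<in> {?d m k..?d m (Suc k)}" "w r = 0" by blast
          then have "\<bar>G' (w (?d m k)) - G' 0\<bar> \<le> \<eta>"
            using elim[rule_format, of k "?d m k" r] k dS[of m k] by auto
          then show ?thesis
            using dL by (simp add: abs_mult mult_right_mono)
        next
          case False
          then have "L (?d m k) = L (?d m (Suc k))"
            using local_time_const_off_level[OF w L[OF d0] L[OF d0] d0 less_imp_le[OF dS]] by blast
          then show ?thesis by simp
        qed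
      qed
      also have "\<dots> = \<bar>\<beta>\<bar> * L t * \<eta>"
        unfolding sum_distrib_left[symmetric] dyadic_telescope[of L] L0 by simp
      finally show ?case .
    qed
  qed
  have T2: "(\<lambda>m. \<Sum>k<2^m. G' (w (?d m k)) * ?dI m k) \<longlonglongrightarrow> (LINT s:{0..t}|lborel. G' (w s) * drift (w s))"
    unfolding I_def by (rule dyadic_sum_tendsto_integral[OF t G'w drift_w drift(2)])
  have T3: "(\<lambda>m. \<Sum>k<2^m. G'' (w (?d m k)) * (t / 2 ^ m)) \<longlonglongrightarrow> (LINT s:{0..t}|lborel. G'' (w s))"
  proof -
    have "(LINT r:{0..s}|lborel. 1) = s" if "0 \<le> s" for s :: real
      using that by (simp add: set_lebesgue_integral_def)
    then show ?thesis
      using dyadic_sum_tendsto_integral[OF t G''w, of "\<lambda>_. 1" 1] d0 by simp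
  qed
  have sq_diff: "\<forall>\<^sub>F m in sequentially. (\<Sum>k<2^m. \<bar>(?dw m k)\<^sup>2 - (?db m k)\<^sup>2\<bar>) \<le> 2 * V * \<eta>"
    if \<eta>: "0 < \<eta>" for \<eta>
    using dyadic_oscillation[OF t w \<eta>] dyadic_oscillation[OF t b \<eta>]
  proof eventually_elim
    case (elim m)
    have "(\<Sum>k<2^m. \<bar>(?dw m k)\<^sup>2 - (?db m k)\<^sup>2\<bar>)
        \<le> (\<Sum>k<2^m. \<bar>?dA m k\<bar> * (2 * \<eta>))"
    proof (rule sum_mono)
      fix k assume k: "k \<in> {..<(2::nat)^m}"
      let ?x = "w (?d m (Suc k)) - w (?d m k)" and ?y = "b (?d m (Suc k)) - b (?d m k)"
      have "\<bar>?x\<bar> \<le> \<eta>" "\<bar>?y\<bar> \<le> \<eta>"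
        using elim(1)[rule_format, of k "?d m (Suc k)" "?d m k"] elim(2)[rule_format, of k "?d m (Suc k)" "?d m k"] k dS[of m k] by auto
      then have xy: "\<bar>?x + ?y\<bar> \<le> 2 * \<eta>" by linarith
      have "A (?d m (Suc k)) - A (?d m k) = ?x - ?y"
        using wA[OF d0 d0, of m k m "Suc k"] by simp
      then have "?x\<^sup>2 - ?y\<^sup>2 = ?dA m k * (?x + ?y)"
        by (simp only: power2_eq_square square_diff_square_factored mult.commute)
      then show "\<bar>?x\<^sup>2 - ?y\<^sup>2\<bar> \<le> \<bar>?dA m k\<bar> * (2 * \<eta>)"
        using xy by (simp add: abs_mult mult_left_mono)
    qed
    also have "\<dots> \<le> V * (2 * \<eta>)"
      unfolding sum_distrib_right[symmetric] using A_var[of m] \<eta> by (intro mult_right_mono) auto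
    finally show ?case by simp
  qed
  have T4: "(\<lambda>m. \<Sum>k<2^m. G'' (w (?d m k)) * ((?dw m k)\<^sup>2 - (?db m k)\<^sup>2)) \<longlonglongrightarrow> 0"
  proof (rule tendsto_of_eventually_le_mult[where C="K * (2 * V)"])
    fix \<eta> :: real assume \<eta>: "0 < \<eta>"
    show "\<forall>\<^sub>F m in sequentially. \<bar>(\<Sum>k<2^m. G'' (w (?d m k)) * ((?dw m k)\<^sup>2 - (?db m k)\<^sup>2)) - 0\<bar> \<le> K * (2 * V) * \<eta>"
      using sq_diff[OF \<eta>]
    proof eventually_elim
      case (elim m)
      have "\<bar>\<Sum>k<2^m. G'' (w (?d m k)) * ((?dw m k)\<^sup>2 - (?db m k)\<^sup>2)\<bar>
          \<le> (\<Sum>k<2^m. K * \<bar>(?dw m k)\<^sup>2 - (?db m k)\<^sup>2\<bar>)"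
        using G(4) by (intro order_trans[OF sum_abs] sum_mono) (auto simp: abs_mult intro!: mult_right_mono)
      also have "\<dots> \<le> K * (2 * V * \<eta>)"
        unfolding sum_distrib_left[symmetric] using elim K by (intro mult_left_mono)
      finally show ?case by (simp add: mult_ac)
    qed
  qed (use K V in simp)
  define err where "err m k = G (w (?d m (Suc k))) - G (w (?d m k)) - G' (w (?d m k)) * ?dw m k
      - G'' (w (?d m k)) / 2 * (?dw m k)\<^sup>2" for m k
  have T5: "(\<lambda>m. \<Sum>k<2^m. err m k) \<longlonglongrightarrow> 0"
  proof (rule tendsto_of_eventually_le_mult[where C="t + 2 * V + 1"])
    fix \<eta> :: real assume \<eta>: "0 < \<eta>"
    \<comment> \<open>The squared increments of \<open>w\<close> add up to about \<open>t\<close>; the margin \<open>2 V + 1\<close> absorbs the error terms.\<close>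
    have "\<forall>\<^sub>F m in sequentially. (\<Sum>k<2^m. ((?db m k)\<^sup>2 - t / 2 ^ m)) < 1"
      using QV(1) by (rule order_tendstoD) simp
    then show "\<forall>\<^sub>F m in sequentially. \<bar>(\<Sum>k<2^m. err m k) - 0\<bar> \<le> (t + 2 * V + 1) * \<eta>"
      using sq_diff[of 1, OF zero_less_one] dyadic_oscillation[OF t G''w \<eta>]
    proof eventually_elim
      case (elim m)
      have sum_w: "(\<Sum>k<2^m. (?dw m k)\<^sup>2) \<le> t + 2 * V + 1"
      proof -
        have "(\<Sum>k<2^m. (?dw m k)\<^sup>2)
          \<le> (\<Sum>k<2^m. (?db m k)\<^sup>2 - t / 2 ^ m + t / 2 ^ m +
               \<bar>(?dw m k)\<^sup>2 - (?db m k)\<^sup>2\<bar>)"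
          by (intro sum_mono) linarith
        also have "\<dots> \<le> 1 + t + 2 * V"
          unfolding sum.distrib using elim(1,2) by simp
        finally show ?thesis by simp
      qed
      have "\<bar>\<Sum>k<2^m. err m k\<bar> \<le> (\<Sum>k<2^m. \<eta> * (?dw m k)\<^sup>2)"
      proof (intro order_trans[OF sum_abs] sum_mono)
        fix k assume k: "k \<in> {..<(2::nat)^m}"
        obtain \<xi> where \<xi>: "\<xi> \<in> closed_segment (w (?d m k)) (w (?d m (Suc k)))"
          "err m k = (G'' \<xi> - G'' (w (?d m k))) / 2 * (?dw m k)\<^sup>2"
          using Taylor2_between[OF G(1,2), of "w (?d m k)" "w (?d m (Suc k))"] unfolding err_def
          by (auto simp: algebra_simps diff_divide_distrib)
        \<comment> \<open>The intermediate point of the Taylor formula is a value of the path on the same interval,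
          so the oscillation of \<open>G'' \<circ> w\<close> bounds the error, however wildly \<open>G''\<close> varies elsewhere.\<close>
        have "connected (w ` {?d m k..?d m (Suc k)})"
          by (intro connected_continuous_image continuous_on_subset[OF w]) auto
        then have "closed_segment (w (?d m k)) (w (?d m (Suc k))) \<subseteq> w ` {?d m k..?d m (Suc k)}"
          using dS[of m k] by (auto simp: is_interval_connected_1[symmetric] is_interval_convex_1 closed_segment_subset)
        then obtain s where s: "s \<in> {?d m k..?d m (Suc k)}" "\<xi> = w s"
          using \<xi>(1) by auto
        have "\<bar>G'' \<xi> - G'' (w (?d m k))\<bar> \<le> \<eta>"
          using elim(3)[rule_format, of k s "?d m k"] k s dS[of m k] by auto
        then have "\<bar>(G'' \<xi> - G'' (w (?d m k))) / 2\<bar> \<le> \<eta>"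
          by (rule order_trans[rotated]) simp
        then show "\<bar>err m k\<bar> \<le> \<eta> * (?dw m k)\<^sup>2"
          unfolding \<xi>(2) abs_mult by (intro mult_mono) auto
      qed
      also have "\<dots> \<le> \<eta> * (t + 2 * V + 1)"
        unfolding sum_distrib_left[symmetric] using \<eta> sum_w by (intro mult_left_mono) auto
      finally show ?case by (simp add: mult_ac)
    qed
  qed (use t V in simp)
  have decomp: "(\<Sum>k<2^m. G' (w (?d m k)) * ?db m k)
     = (G (w t) - G (w 0))
       - (\<Sum>k<2^m. G' (w (?d m k)) * (\<beta> * ?dL m k))
       - (\<Sum>k<2^m. G' (w (?d m k)) * ?dI m k)
       - ((\<Sum>k<2^m. G'' (w (?d m k)) * ((?db m k)\<^sup>2 - t / 2 ^ m))
          + (\<Sum>k<2^m. G'' (w (?d m k)) * (t / 2 ^ m))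
          + (\<Sum>k<2^m. G'' (w (?d m k)) * ((?dw m k)\<^sup>2 - (?db m k)\<^sup>2))) / 2
       - (\<Sum>k<2^m. err m k)" for m
  proof -
    have step: "G' (w (?d m k)) * ?db m k =
        (G (w (?d m (Suc k))) - G (w (?d m k)))
       - G' (w (?d m k)) * (\<beta> * ?dL m k)
       - G' (w (?d m k)) * ?dI m k
       - (G'' (w (?d m k)) * ((?db m k)\<^sup>2 - t / 2 ^ m)
          + G'' (w (?d m k)) * (t / 2 ^ m)
          + G'' (w (?d m k)) * ((?dw m k)\<^sup>2 - (?db m k)\<^sup>2)) / 2
       - err m k" for k
    proof -
      have b_eq: "b (?d m (Suc k)) - b (?d m k) = ?dw m k
          - \<beta> * ?dL m k - ?dI m k"
        using wA[OF d0 d0, of m k m "Suc k"] unfolding A_def by (simp add: algebra_simps)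
      have quad: "G'' (w (?d m k)) * ((?db m k)\<^sup>2 - t / 2 ^ m)
          + G'' (w (?d m k)) * (t / 2 ^ m)
          + G'' (w (?d m k)) * ((?dw m k)\<^sup>2 - (?db m k)\<^sup>2)
          = G'' (w (?d m k)) * (?dw m k)\<^sup>2"
        by (simp add: algebra_simps)
      show ?thesis
        unfolding quad unfolding err_def unfolding b_eq by (simp add: algebra_simps)
    qed
    show ?thesis
      unfolding dyadic_telescope[where u="\<lambda>s. G (w s)" and m=m and t=t, symmetric] step
      unfolding sum_subtractf sum.distrib sum_divide_distrib add_divide_distrib by (rule refl)
  qed
  note lim = tendsto_diff[OF tendsto_diff[OF tendsto_diff[OF tendsto_diff[OF tendsto_const T1] T2]
      tendsto_divide[OF tendsto_add[OF tendsto_add[OF QV(2) T3] T4] tendsto_const]] T5]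
  show ?thesis
    unfolding decomp using lim[of 2 "G (w t) - G (w 0)"] by simp
qed

section \<open>The Ito formula in expectation for smooth functions\<close>

locale skew_brownian_motion_at_zero = refracted_skew_brownian_motion M F B X \<beta> \<mu>p \<mu>m 0
  for M :: "'a measure" and F B X \<beta> \<mu>p \<mu>m +
  fixes x :: real
  assumes X_start: "AE \<omega> in M. X 0 \<omega> = x"
begin

definition drift :: "real \<Rightarrow> real" where
  "drift y = \<mu>p * indicator {0<..} y + \<mu>m * indicator {..<0} y"

definition occ :: "(real \<Rightarrow> real) \<Rightarrow> real \<Rightarrow> 'a \<Rightarrow> real" where
  "occ G t \<omega> = (LINT s:{0..t}|lborel. G (X s \<omega>))"

text \<open>
  Almost surely \<open>push t\<close> is \<open>\<beta>\<close> times the local time. It is defined from the other terms of the equation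
  because it is then measurable: the local time is a limit that exists only outside a null set,
  and \<open>M\<close> need not be complete.
\<close>

definition push :: "real \<Rightarrow> 'a \<Rightarrow> real" where
  "push t \<omega> = X t \<omega> - X 0 \<omega> - B t \<omega> - occ drift t \<omega>"

lemma drift_measurable [measurable]: "drift \<in> borel_measurable borel"
  unfolding drift_def by measurable

lemma drift_bound: "\<bar>drift y\<bar> \<le> \<bar>\<mu>p\<bar> + \<bar>\<mu>m\<bar>"
  by (auto simp: drift_def indicator_def)

lemma X_measurable: "0 \<le> t \<Longrightarrow> X t \<in> borel_measurable M"
  using measurable_from_subalg[OF F_subalgebra X_adapted] .

lemma X_path_continuous:
  assumes "\<omega> \<in> space M"
  shows "continuous_on UNIV (\<lambda>s. X (max 0 s) \<omega>)"
  by (rule continuous_on_compose2[OF X_continuous[OF assms]]) (auto intro!: continuous_intros)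

lemma X_path_measurable:
  "\<omega> \<in> space M \<Longrightarrow> (\<lambda>s. X (max 0 s) \<omega>) \<in> borel_measurable borel"
  by (rule borel_measurable_continuous_onI[OF X_path_continuous])

lemma expectation_start:
  fixes u :: "real \<Rightarrow> real"
  assumes [measurable]: "u \<in> borel_measurable borel"
  shows "expectation (\<lambda>\<omega>. u (X 0 \<omega>)) = u x"
proof -
  have [measurable]: "X 0 \<in> borel_measurable M" by (rule X_measurable) simp
  have "expectation (\<lambda>\<omega>. u (X 0 \<omega>)) = expectation (\<lambda>\<omega>. u x)"
    using X_start by (intro integral_cong_AE) auto
  then show ?thesis by (simp add: prob_space)
qed

lemma expectation_X_bound:
  fixes u :: "real \<Rightarrow> real"
  assumes [measurable]: "u \<in> borel_measurable borel" and u: "\<And>y. \<bar>u y\<bar> \<le> K"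
  shows "\<bar>expectation (\<lambda>\<omega>. u (X (max 0 t) \<omega>))\<bar> \<le> K"
proof -
  have [measurable]: "X (max 0 t) \<in> borel_measurable M" by (rule X_measurable) simp
  have "\<bar>expectation (\<lambda>\<omega>. u (X (max 0 t) \<omega>))\<bar> \<le> expectation (\<lambda>\<omega>. \<bar>u (X (max 0 t) \<omega>)\<bar>)"
    by (rule integral_abs_bound)
  also have "\<dots> \<le> expectation (\<lambda>_. K)"
    using u order_trans[OF abs_ge_zero u] by (intro integral_mono integrable_const_bound[where B=K]) auto
  finally show ?thesis by (simp add: prob_space)
qed

text \<open>
  The process is frozen before time \<open>0\<close>, so that its paths are continuous on the whole line and
  approximation at dyadic times applies.
\<close>

lemma X_jointly_measurable:
  "(\<lambda>(s, \<omega>). X (max 0 s) \<omega>) \<in> borel_measurable (lborel \<Otimes>\<^sub>M M)"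
proof (rule borel_measurable_LIMSEQ_real)
  let ?r = "\<lambda>n (s::real). max 0 (real_of_int \<lfloor>2 ^ n * s\<rfloor> / 2 ^ n)"
  show "(\<lambda>p. X (?r n (fst p)) (snd p)) \<in> borel_measurable (lborel \<Otimes>\<^sub>M M)" for n
  proof (rule measurable_compose_countable[where f="\<lambda>i (p :: real \<times> 'a). X (max 0 (real_of_int i / 2 ^ n)) (snd p)" and g="\<lambda>p :: real \<times> 'a. \<lfloor>(2::real) ^ n * fst p\<rfloor>"])
    show "(\<lambda>p. X (max 0 (real_of_int i / 2 ^ n)) (snd p)) \<in> borel_measurable (lborel \<Otimes>\<^sub>M M)" for i
      using X_measurable[of "max 0 (real_of_int i / 2 ^ n)"] by measurable
  qed measurable
  fix p :: "real \<times> 'a" assume "p \<in> space (lborel \<Otimes>\<^sub>M M)"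
  then have p: "snd p \<in> space M" by (auto simp: space_pair_measure)
  from X_path_continuous[OF p] dyadic_floor_tendsto[of "fst p"] have "(\<lambda>n. X (max 0 (real_of_int \<lfloor>2 ^ n * fst p\<rfloor> / 2 ^ n)) (snd p)) \<longlonglongrightarrow> X (max 0 (fst p)) (snd p)"
    by (rule continuous_on_tendsto_compose) auto
  then show "(\<lambda>n. X (?r n (fst p)) (snd p)) \<longlonglongrightarrow> (case p of (s, \<omega>) \<Rightarrow> X (max 0 s) \<omega>)"
    by (simp add: case_prod_beta)
qed

lemma occ_max: "occ G t \<omega> = (LINT s:{0..t}|lborel. G (X (max 0 s) \<omega>))"
  unfolding occ_def by (rule set_lebesgue_integral_cong) auto

lemma occ_measurable:
  assumes G [measurable]: "G \<in> borel_measurable borel"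
  shows "occ G t \<in> borel_measurable M"
proof -
  note [measurable] = X_jointly_measurable
  have "(\<lambda>\<omega>. \<integral>s. indicator {0..t} s *\<^sub>R G (X (max 0 s) \<omega>) \<partial>lborel) \<in> borel_measurable M"
    by (rule lborel.borel_measurable_lebesgue_integral) measurable
  then show ?thesis
    unfolding occ_max[abs_def] set_lebesgue_integral_def .
qed

lemma expectation_occ:
  assumes G [measurable]: "G \<in> borel_measurable borel" and K: "\<And>y. \<bar>G y\<bar> \<le> K"
  shows "integrable M (occ G t)" "expectation (occ G t) = (LINT s:{0..t}|lborel. expectation (\<lambda>\<omega>. G (X s \<omega>)))"
proof -
  note [measurable] = X_jointly_measurable
  have box: "emeasure (lborel \<Otimes>\<^sub>M M) ({0..t} \<times> space M) = emeasure lborel {0..t} * emeasure M (space M)"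
    by (rule emeasure_pair_measure_Times) auto
  interpret pair_sigma_finite "lborel :: real measure" M ..
  have K0: "0 \<le> K" using K[of 0] by simp
  have int: "integrable (lborel \<Otimes>\<^sub>M M) (\<lambda>(s, \<omega>). indicator {0..t} s *\<^sub>R G (X (max 0 s) \<omega>))"
  proof (rule Bochner_Integration.integrable_bound)
    show "integrable (lborel \<Otimes>\<^sub>M M) (\<lambda>p. K * indicator ({0..t} \<times> space M) p)"
    proof (intro integrable_mult_right integrable_real_indicator)
      show "emeasure (lborel \<Otimes>\<^sub>M M) ({0..t} \<times> space M) < \<infinity>"
        using box by (simp add: emeasure_space_1 emeasure_lborel_Icc_eq)
    qed simp
    show "AE p in lborel \<Otimes>\<^sub>M M. norm (case p of (s, \<omega>) \<Rightarrow> indicat_real {0..t} s *\<^sub>R G (X (max 0 s) \<omega>))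
        \<le> norm (K * indicat_real ({0..t} \<times> space M) p)"
      using K K0 by (intro AE_I2) (auto simp: space_pair_measure indicator_def)
  qed measurable
  show "integrable M (occ G t)"
    unfolding occ_max[abs_def] set_lebesgue_integral_def using integrable_snd[OF int] by simp
  have "expectation (occ G t) = (\<integral>\<omega>. (\<integral>s. indicator {0..t} s *\<^sub>R G (X (max 0 s) \<omega>) \<partial>lborel) \<partial>M)"
    unfolding occ_max[abs_def] set_lebesgue_integral_def ..
  also have "\<dots> = (\<integral>s. (\<integral>\<omega>. indicator {0..t} s *\<^sub>R G (X (max 0 s) \<omega>) \<partial>M) \<partial>lborel)"
    using Fubini_integral[OF int] by simp
  also have "\<dots> = (LINT s:{0..t}|lborel. expectation (\<lambda>\<omega>. G (X s \<omega>)))"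
    unfolding set_lebesgue_integral_def by (intro Bochner_Integration.integral_cong) (auto simp: indicator_def)
  finally show "expectation (occ G t) = (LINT s:{0..t}|lborel. expectation (\<lambda>\<omega>. G (X s \<omega>)))" .
qed

lemma push_is_local_time:
  "AE \<omega> in M. \<exists>L. \<forall>t\<ge>0. has_symmetric_local_time (\<lambda>s. X (max 0 s) \<omega>) 0 t (L t) \<and> push t \<omega> = \<beta> * L t"
  using X_equation AE_space
proof eventually_elim
  case (elim \<omega>)
  have cong: "has_symmetric_local_time (\<lambda>s. X (max 0 s) \<omega>) 0 t l = has_symmetric_local_time (\<lambda>s. X s \<omega>) 0 t l" for t l
    unfolding has_symmetric_local_time_def by (intro arg_cong[where f="\<lambda>f. (f \<longlongrightarrow> l) (at_right 0)"] ext
      arg_cong[where f="\<lambda>A. measure lborel A / _"]) (auto simp: max_def)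
  have occ_drift: "occ drift t \<omega> = \<mu>p * (LINT s:{0..t}|lborel. indicator {0<..} (X s \<omega>))
      + \<mu>m * (LINT s:{0..t}|lborel. indicator {..<0} (X s \<omega>))" for t
  proof -
    have m: "(\<lambda>s. X (max 0 s) \<omega>) \<in> borel_measurable borel"
      using elim(2) by (rule X_path_measurable)
    have "set_integrable lborel {0..t} (\<lambda>s. indicat_real A (X (max 0 s) \<omega>))" if "A \<in> sets borel" for A
      using m that by (intro set_integrable_Icc_bounded[where K=1]) (auto simp: indicator_def)
    then have i: "set_integrable lborel {0..t} (\<lambda>s. c * indicat_real A (X (max 0 s) \<omega>))" if "A \<in> sets borel" for A c
      using that by (intro set_integrable_mult_right) auto
    have "occ drift t \<omega> = \<mu>p * (LINT s:{0..t}|lborel. indicator {0<..} (X (max 0 s) \<omega>))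
      + \<mu>m * (LINT s:{0..t}|lborel. indicator {..<0} (X (max 0 s) \<omega>))"
      unfolding occ_max drift_def by (subst set_integral_add) (auto intro!: i)
    moreover have "(LINT s:{0..t}|lborel. indicat_real A (X (max 0 s) \<omega>)) = (LINT s:{0..t}|lborel. indicat_real A (X s \<omega>))" for A
      by (rule set_lebesgue_integral_cong) auto
    ultimately show ?thesis by simp
  qed
  from elim(1) have "\<forall>t. \<exists>l. 0 \<le> t \<longrightarrow> has_symmetric_local_time (\<lambda>s. X (max 0 s) \<omega>) 0 t l \<and> push t \<omega> = \<beta> * l"
    unfolding cong push_def occ_drift by fastforce
  then show ?case by metis
qed

text \<open>
  The variable \<open>Y\<close> is the almost sure limit of the stochastic sums with integrand \<open>G' (X)\<close>, whose second
  moments are bounded by \<open>K\<^sup>2 * t\<close>. They are controlled by the first derivative of \<open>G\<close> alone, which is what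
  permits smoothing a kink.
\<close>

lemma Ito_martingale:
  fixes G G' G'' :: "real \<Rightarrow> real"
  assumes t: "0 < t"
    and G: "\<And>y. (G has_real_derivative G' y) (at y)" "\<And>y. (G' has_real_derivative G'' y) (at y)"
      "continuous_on UNIV G''" "\<And>y. \<bar>G' y\<bar> \<le> K" "\<And>y. \<bar>G'' y\<bar> \<le> K2"
  defines "Y \<equiv> \<lambda>\<omega>. G (X t \<omega>) - G (X 0 \<omega>) - G' 0 * push t \<omega> - occ (\<lambda>y. G' y * drift y) t \<omega> - occ G'' t \<omega> / 2"
  shows "Y \<in> borel_measurable M" "integrable M (\<lambda>\<omega>. (Y \<omega>)\<^sup>2)" "expectation Y = 0" "expectation (\<lambda>\<omega>. (Y \<omega>)\<^sup>2) \<le> K\<^sup>2 * t"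
proof -
  have "continuous_on UNIV G" "continuous_on UNIV G'"
    using G(1,2) by (meson DERIV_isCont continuous_at_imp_continuous_on)+
  with G(3) have Gm[measurable]: "G \<in> borel_measurable borel" "G' \<in> borel_measurable borel" "G'' \<in> borel_measurable borel"
    by (auto intro: borel_measurable_continuous_onI)
  define S where "S m \<omega> = (\<Sum>k<2^m. G' (X (dyadic t m k) \<omega>) * (incr t m k \<omega>))" for m \<omega>
  have S: "S m \<in> borel_measurable M" "integrable M (\<lambda>\<omega>. (S m \<omega>)\<^sup>2)" "expectation (S m) = 0"
    "expectation (\<lambda>\<omega>. (S m \<omega>)\<^sup>2) \<le> K\<^sup>2 * t" for m
    unfolding S_def by (rule stochastic_sum_moments[where Z=X and H=G', OF t X_adapted Gm(2) G(4)]; simp)+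
  have QV1: "AE \<omega> in M. (\<lambda>m. \<Sum>k<2^m. 1 * ((incr t m k \<omega>)\<^sup>2 - t / 2 ^ m)) \<longlonglongrightarrow> 0"
    by (rule quadratic_variation_AE[where Z=X and H="\<lambda>_. 1" and K=1, OF t X_adapted]) auto
  have QV2: "AE \<omega> in M. (\<lambda>m. \<Sum>k<2^m. G'' (X (dyadic t m k) \<omega>) * ((incr t m k \<omega>)\<^sup>2 - t / 2 ^ m)) \<longlonglongrightarrow> 0"
    by (rule quadratic_variation_AE[where Z=X and H=G'', OF t X_adapted Gm(3) G(5)])
  have "AE \<omega> in M. (\<lambda>m. S m \<omega>) \<longlonglongrightarrow> Y \<omega>"
    using push_is_local_time QV1
      QV2 B_continuous B_zero AE_space
  proof eventually_elim
    case (elim \<omega>)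
    obtain L where L: "\<And>s. 0 \<le> s \<Longrightarrow> has_symmetric_local_time (\<lambda>s. X (max 0 s) \<omega>) 0 s (L s)"
      "\<And>s. 0 \<le> s \<Longrightarrow> push s \<omega> = \<beta> * L s"
      using elim(1) by blast
    have d0: "max 0 (dyadic t m k) = dyadic t m k" for m k
      using dyadic_nonneg[of t m k] t by simp
    have Bc: "continuous_on UNIV (\<lambda>s. B (max 0 s) \<omega>)"
      by (rule continuous_on_compose2[OF elim(4)]) (auto intro!: continuous_intros)
    have "(\<lambda>m. \<Sum>k<2^m. G' (X (max 0 (dyadic t m k)) \<omega>) * (B (max 0 (dyadic t m (Suc k))) \<omega> - B (max 0 (dyadic t m k)) \<omega>))
     \<longlonglongrightarrow> G (X (max 0 t) \<omega>) - G (X (max 0 0) \<omega>) - G' 0 * (\<beta> * L t)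
        - (LINT s:{0..t}|lborel. G' (X (max 0 s) \<omega>) * drift (X (max 0 s) \<omega>))
        - (LINT s:{0..t}|lborel. G'' (X (max 0 s) \<omega>)) / 2"
    proof (rule pathwise_Ito[OF t X_path_continuous[OF elim(6)] Bc L(1) drift_measurable drift_bound _ G(1,2,3,5)])
      show "X (max 0 s) \<omega> = X (max 0 0) \<omega> + (B (max 0 s) \<omega> - B (max 0 0) \<omega>) + \<beta> * L s + (LINT r:{0..s}|lborel. drift (X (max 0 r) \<omega>))"
        if "0 \<le> s" for s
        using L(2)[OF that] that elim(5) unfolding push_def occ_max by simp
    qed (use elim(2,3) in \<open>simp_all add: d0\<close>)
    then show ?case
      using t L(2)[of t] unfolding S_def Y_def occ_max d0 by simp
  qed
  moreover show Ym: "Y \<in> borel_measurable M"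
  proof -
    have [measurable]: "X t \<in> borel_measurable M" "X 0 \<in> borel_measurable M" "B t \<in> borel_measurable M"
      using t by (auto intro: X_measurable B_measurable)
    have [measurable]: "occ drift t \<in> borel_measurable M" "occ G'' t \<in> borel_measurable M"
      "occ (\<lambda>y. G' y * drift y) t \<in> borel_measurable M"
      by (auto intro!: occ_measurable)
    show ?thesis
      unfolding Y_def push_def by measurable
  qed
  ultimately show "integrable M (\<lambda>\<omega>. (Y \<omega>)\<^sup>2)" "expectation Y = 0" "expectation (\<lambda>\<omega>. (Y \<omega>)\<^sup>2) \<le> K\<^sup>2 * t"
    using expectation_zero_of_AE_limit[OF S(1,2,3,4) Ym] by auto
qed

end

section \<open>Local time as a limit of smooth kernels\<close>

lemma sqrt_square_add_pos [simp]: "0 < e \<Longrightarrow> 0 < sqrt (y\<^sup>2 + e\<^sup>2)" for y e :: real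
  by (simp add: add_nonneg_pos)

lemma DERIV_sqrt_square_add:
  fixes y e :: real
  assumes "0 < e"
  shows "((\<lambda>y. sqrt (y\<^sup>2 + e\<^sup>2)) has_real_derivative y / sqrt (y\<^sup>2 + e\<^sup>2)) (at y)"
proof -
  have "0 < y\<^sup>2 + e\<^sup>2" using assms by (simp add: add_nonneg_pos)
  then show ?thesis
    by (auto intro!: derivative_eq_intros simp: field_simps)
qed

text \<open>
  Layer cake formula: the kernel \<open>e\<^sup>2 / (2 (y\<^sup>2 + e\<^sup>2) ^ (3 / 2))\<close> is a mixture of indicators of the intervals
  \<open>|y| \<le> e v\<close>, and Tonelli's theorem expresses its time integral through occupation times.
\<close>

lemma local_time_kernel_integral:
  fixes w :: "real \<Rightarrow> real"
  assumes w: "continuous_on UNIV w" and e: "0 < e"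
  shows "(LINT s:{0..t}|lborel. e\<^sup>2 / (2 * sqrt ((w s)\<^sup>2 + e\<^sup>2) ^ 3))
    = (LINT v|lborel. 3 * v / (2 * e * sqrt (v\<^sup>2 + 1\<^sup>2) ^ 5) * measure lborel {s \<in> {0..t}. \<bar>w s - 0\<bar> \<le> e * v})"
proof -
  let ?m = "\<lambda>u. measure lborel {s \<in> {0..t}. \<bar>w s - 0\<bar> \<le> u}"
  let ?k = "\<lambda>v::real. 3 * v / (2 * e * sqrt (v\<^sup>2 + 1\<^sup>2) ^ 5)"
  have [measurable]: "w \<in> borel_measurable borel"
    using w by (rule borel_measurable_continuous_onI)
  define \<Phi> where "\<Phi> s v = ennreal (?k v) * indicator {s. s \<in> {0..t} \<and> \<bar>w s - 0\<bar> \<le> e * v} s" for s v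
  have \<Phi>m: "(\<lambda>(s, v). \<Phi> s v) \<in> borel_measurable (lborel \<Otimes>\<^sub>M lborel)"
    unfolding \<Phi>_def by (measurable; simp)
  have inner_v: "(\<integral>\<^sup>+v. \<Phi> s v \<partial>lborel) = ennreal (indicator {0..t} s * (e\<^sup>2 / (2 * sqrt ((w s)\<^sup>2 + e\<^sup>2) ^ 3)))" for s
  proof (cases "s \<in> {0..t}")
    case True
    let ?F = "\<lambda>v. - (1 / (2 * e * sqrt (v\<^sup>2 + 1\<^sup>2) ^ 3))"
    have "(\<integral>\<^sup>+v. \<Phi> s v \<partial>lborel) = (\<integral>\<^sup>+v. ennreal (?k v) * indicator {\<bar>w s\<bar> / e..} v \<partial>lborel)"
      using True e by (intro nn_integral_cong) (auto simp: \<Phi>_def indicator_def field_simps)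
    also have "\<dots> = ennreal (0 - ?F (\<bar>w s\<bar> / e))"
    proof (rule nn_integral_FTC_atLeast)
      fix v :: real assume "\<bar>w s\<bar> / e \<le> v"
      then have v: "0 \<le> v" using e by (meson abs_ge_zero divide_nonneg_pos order_trans)
      show "0 \<le> ?k v" using v e by simp
      have r: "sqrt (v\<^sup>2 + 1\<^sup>2) > 0" by (rule sqrt_square_add_pos) simp
      have D: "((\<lambda>v. - (1 / (2 * e)) * inverse (sqrt (v\<^sup>2 + 1\<^sup>2) ^ 3)) has_real_derivative
          - (1 / (2 * e)) * - (of_nat 3 * (v / sqrt (v\<^sup>2 + 1\<^sup>2) * sqrt (v\<^sup>2 + 1\<^sup>2) ^ (3 - Suc 0))
            * inverse ((sqrt (v\<^sup>2 + 1\<^sup>2) ^ 3) ^ Suc (Suc 0)))) (at v)"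
        using r by (intro DERIV_cmult DERIV_inverse_fun DERIV_power DERIV_sqrt_square_add) auto
      have E: "- (1 / (2 * e)) * - (of_nat 3 * (v / R * R ^ (3 - Suc 0)) * inverse ((R ^ 3) ^ Suc (Suc 0)))
          = 3 * v / (2 * e * R ^ 5)" if "0 < R" for R
        using that e by (simp add: divide_simps) (simp add: eval_nat_numeral)
      have "?F = (\<lambda>v. - (1 / (2 * e)) * inverse (sqrt (v\<^sup>2 + 1\<^sup>2) ^ 3))"
        by (simp add: inverse_eq_divide)
      with D show "DERIV ?F v :> ?k v"
        unfolding E[OF r] by simp
    next
      show "(?F \<longlongrightarrow> 0) at_top"
        using e by real_asymp
    qed measurable
    also have "0 - ?F (\<bar>w s\<bar> / e) = e\<^sup>2 / (2 * sqrt ((w s)\<^sup>2 + e\<^sup>2) ^ 3)"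
    proof -
      have "(\<bar>w s\<bar> / e)\<^sup>2 + 1\<^sup>2 = ((w s)\<^sup>2 + e\<^sup>2) / e\<^sup>2"
        using e by (simp add: field_simps)
      then have "sqrt ((\<bar>w s\<bar> / e)\<^sup>2 + 1\<^sup>2) = sqrt ((w s)\<^sup>2 + e\<^sup>2) / e"
        using e by (simp add: real_sqrt_divide)
      then show ?thesis
        using e sqrt_square_add_pos[OF e, of "w s"] by (simp only:) (simp add: power_divide power2_eq_square power3_eq_cube)
    qed
    finally show ?thesis using True by simp
  qed (auto simp: \<Phi>_def)
  have inner_s: "(\<integral>\<^sup>+s. \<Phi> s v \<partial>lborel) = ennreal (?k v * ?m (e * v))" for v
  proof (cases "0 \<le> v")
    case True
    have fm: "{s \<in> {0..t}. \<bar>w s - 0\<bar> \<le> e * v} \<in> fmeasurable lborel"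
      using w by (rule local_time_set_measurable)
    have "(\<integral>\<^sup>+s. \<Phi> s v \<partial>lborel) = ennreal (?k v) * emeasure lborel {s \<in> {0..t}. \<bar>w s - 0\<bar> \<le> e * v}"
      unfolding \<Phi>_def using fmeasurableD[OF fm] by (subst nn_integral_cmult_indicator) auto
    then show ?thesis
      unfolding emeasure_eq_measure2[OF fm] by (simp only: ennreal_mult''[OF measure_nonneg])
  next
    case False
    then have "e * v < 0" using e by (simp add: mult_pos_neg)
    then have empty: "{s \<in> {0..t}. \<bar>w s - 0\<bar> \<le> e * v} = {}" by auto
    show ?thesis unfolding \<Phi>_def empty by simp
  qed
  have mono: "mono ?m"
    by (intro monoI measure_mono_fmeasurable local_time_set_measurable fmeasurableD w) auto
  note [measurable] = borel_measurable_mono[OF mono]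
  have "(LINT s:{0..t}|lborel. e\<^sup>2 / (2 * sqrt ((w s)\<^sup>2 + e\<^sup>2) ^ 3))
      = enn2real (\<integral>\<^sup>+s. ennreal (indicator {0..t} s * (e\<^sup>2 / (2 * sqrt ((w s)\<^sup>2 + e\<^sup>2) ^ 3))) \<partial>lborel)"
    unfolding set_lebesgue_integral_def real_scaleR_def by (rule integral_eq_nn_integral) auto
  also have "\<dots> = enn2real (\<integral>\<^sup>+s. (\<integral>\<^sup>+v. \<Phi> s v \<partial>lborel) \<partial>lborel)"
    unfolding inner_v ..
  also have "\<dots> = enn2real (\<integral>\<^sup>+v. (\<integral>\<^sup>+s. \<Phi> s v \<partial>lborel) \<partial>lborel)"
    unfolding lborel_pair.Fubini'[OF \<Phi>m] ..
  also have "\<dots> = (LINT v|lborel. ?k v * ?m (e * v))"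
    unfolding inner_s
  proof (rule integral_eq_nn_integral[symmetric])
    have "0 \<le> ?k v * ?m (e * v)" for v
    proof (cases "0 \<le> v")
      case False
      then have "e * v < 0" using e by (simp add: mult_pos_neg)
      then have empty: "{s \<in> {0..t}. \<bar>w s - 0\<bar> \<le> e * v} = {}" by auto
      show ?thesis unfolding empty by simp
    qed (use e in auto)
    then show "AE v in lborel. 0 \<le> ?k v * ?m (e * v)"
      by simp
  qed measurable
  finally show ?thesis .
qed

text \<open>
  The total mass of the mixture in the layer cake formula, after normalising the intervals by their
  length; an antiderivative is \<open>v ^ 3 / (v\<^sup>2 + 1) ^ (3 / 2)\<close>.
\<close>

lemma kernel_weight_integral:
  "integrable lborel (\<lambda>v::real. indicator {0..} v * (3 * v\<^sup>2 / sqrt (v\<^sup>2 + 1\<^sup>2) ^ 5))"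
  "(LINT v|lborel. indicator {0..} v * (3 * v\<^sup>2 / sqrt (v\<^sup>2 + 1\<^sup>2) ^ 5)) = (1::real)"
proof -
  have nn: "(\<integral>\<^sup>+v. ennreal (3 * v\<^sup>2 / sqrt (v\<^sup>2 + 1\<^sup>2) ^ 5) * indicator {0..} v \<partial>lborel) = ennreal (1 - 0 ^ 3 / sqrt (0\<^sup>2 + 1\<^sup>2) ^ 3)"
  proof (rule nn_integral_FTC_atLeast[where F="\<lambda>v. v ^ 3 / sqrt (v\<^sup>2 + 1\<^sup>2) ^ 3"])
    fix v :: real assume "0 \<le> v"
    define r where "r = sqrt (v\<^sup>2 + 1\<^sup>2)"
    have r: "r > 0" unfolding r_def by (rule sqrt_square_add_pos) simp
    have rr: "r\<^sup>2 = v\<^sup>2 + 1" unfolding r_def by (simp add: add_nonneg_nonneg)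
    have "((\<lambda>v. v ^ 3 / sqrt (v\<^sup>2 + 1\<^sup>2) ^ 3) has_real_derivative
        (of_nat 3 * (1 * v ^ (3 - Suc 0)) * sqrt (v\<^sup>2 + 1\<^sup>2) ^ 3
          - v ^ 3 * (of_nat 3 * (v / sqrt (v\<^sup>2 + 1\<^sup>2) * sqrt (v\<^sup>2 + 1\<^sup>2) ^ (3 - Suc 0))))
        / (sqrt (v\<^sup>2 + 1\<^sup>2) ^ 3 * sqrt (v\<^sup>2 + 1\<^sup>2) ^ 3)) (at v)"
      using r unfolding r_def by (intro DERIV_divide DERIV_power DERIV_ident DERIV_sqrt_square_add) auto
    also have "(of_nat 3 * (1 * v ^ (3 - Suc 0)) * sqrt (v\<^sup>2 + 1\<^sup>2) ^ 3
          - v ^ 3 * (of_nat 3 * (v / sqrt (v\<^sup>2 + 1\<^sup>2) * sqrt (v\<^sup>2 + 1\<^sup>2) ^ (3 - Suc 0))))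
        / (sqrt (v\<^sup>2 + 1\<^sup>2) ^ 3 * sqrt (v\<^sup>2 + 1\<^sup>2) ^ 3) = 3 * v\<^sup>2 * (r\<^sup>2 - v\<^sup>2) / r ^ 5"
      unfolding r_def[symmetric] using r by (simp add: divide_simps) (simp add: eval_nat_numeral algebra_simps)
    also have "\<dots> = 3 * v\<^sup>2 / r ^ 5" using rr by simp
    finally show "((\<lambda>v. v ^ 3 / sqrt (v\<^sup>2 + 1\<^sup>2) ^ 3) has_real_derivative 3 * v\<^sup>2 / sqrt (v\<^sup>2 + 1\<^sup>2) ^ 5) (at v)"
      unfolding r_def .
  next
    show "((\<lambda>v::real. v ^ 3 / sqrt (v\<^sup>2 + 1\<^sup>2) ^ 3) \<longlongrightarrow> 1) at_top"
      by real_asymp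
  qed auto
  have eq: "ennreal (3 * v\<^sup>2 / sqrt (v\<^sup>2 + 1\<^sup>2) ^ 5) * indicator {0..} v = ennreal (indicator {0..} v * (3 * v\<^sup>2 / sqrt (v\<^sup>2 + 1\<^sup>2) ^ 5))" for v :: real
    by (auto simp: indicator_def)
  have "has_bochner_integral lborel (\<lambda>v::real. indicator {0..} v * (3 * v\<^sup>2 / sqrt (v\<^sup>2 + 1\<^sup>2) ^ 5)) (1 - 0 ^ 3 / sqrt (0\<^sup>2 + 1\<^sup>2) ^ 3)"
    by (rule has_bochner_integral_nn_integral[OF _ _ _ nn[unfolded eq]]) auto
  then show "integrable lborel (\<lambda>v::real. indicator {0..} v * (3 * v\<^sup>2 / sqrt (v\<^sup>2 + 1\<^sup>2) ^ 5))"
    "(LINT v|lborel. indicator {0..} v * (3 * v\<^sup>2 / sqrt (v\<^sup>2 + 1\<^sup>2) ^ 5)) = (1::real)"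
    by (auto simp: has_bochner_integral_iff)
qed

text \<open>
  The kernel is half the second derivative of \<open>sqrt (y\<^sup>2 + e\<^sup>2)\<close>. Its time integral is an average of the ratios
  \<open>m u / (2 * u)\<close> at \<open>u = e v\<close> with fixed weights of mass one. The ratios tend to \<open>l\<close> as \<open>u\<close> tends to
  zero and are bounded in \<open>u\<close>, so dominated convergence applies.
\<close>

lemma local_time_kernel_limit:
  fixes w :: "real \<Rightarrow> real"
  assumes w: "continuous_on UNIV w" and l: "has_symmetric_local_time w 0 t l"
    and e: "\<And>n. 0 < e n" "e \<longlonglongrightarrow> 0"
  shows "(\<lambda>n. LINT s:{0..t}|lborel. (e n)\<^sup>2 / (2 * sqrt ((w s)\<^sup>2 + (e n)\<^sup>2) ^ 3)) \<longlonglongrightarrow> l"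
proof -
  define m where "m u = measure lborel {s \<in> {0..t}. \<bar>w s - 0\<bar> \<le> u}" for u
  define W where "W v = indicator {0..} v * (3 * v\<^sup>2 / sqrt (v\<^sup>2 + 1\<^sup>2) ^ 5)" for v :: real
  have W: "integrable lborel W" "(LINT v|lborel. W v) = 1"
    using kernel_weight_integral unfolding W_def by auto
  have W0: "0 \<le> W v" for v by (auto simp: W_def indicator_def)
  have lim: "((\<lambda>u. m u / (2 * u)) \<longlongrightarrow> l) (at_right 0)"
    using l unfolding has_symmetric_local_time_def m_def .
  have mono: "mono m"
    unfolding m_def by (intro monoI measure_mono_fmeasurable local_time_set_measurable fmeasurableD w) auto
  note [measurable] = borel_measurable_mono[OF mono]
  have m_le: "0 \<le> m u" "m u \<le> \<bar>t\<bar>" for u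
  proof -
    show "0 \<le> m u" by (simp add: m_def)
    have "m u \<le> measure lborel {0..t}"
      unfolding m_def by (intro measure_mono_fmeasurable fmeasurableD local_time_set_measurable w)
        (auto intro!: fmeasurableI simp: emeasure_lborel_Icc_eq)
    then show "m u \<le> \<bar>t\<bar>" by (simp add: measure_def emeasure_lborel_Icc_eq split: if_splits)
  qed
  obtain C where C: "\<And>u. 0 < u \<Longrightarrow> m u / (2 * u) \<le> C"
  proof -
    have "\<forall>\<^sub>F u in at_right 0. m u / (2 * u) < l + 1"
      using lim by (rule order_tendstoD) simp
    then obtain \<delta> where \<delta>: "0 < \<delta>" "\<And>u. 0 < u \<Longrightarrow> u < \<delta> \<Longrightarrow> m u / (2 * u) < l + 1"
      unfolding eventually_at_right_field by blast
    have "m u / (2 * u) \<le> max (l + 1) (\<bar>t\<bar> / (2 * \<delta>))" if u: "0 < u" for u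
    proof (cases "u < \<delta>")
      case True
      then show ?thesis using \<delta>(2)[OF u] by simp
    next
      case False
      have "m u / (2 * u) \<le> \<bar>t\<bar> / (2 * \<delta>)"
        using m_le[of u] False \<delta>(1) by (intro frac_le) auto
      then show ?thesis by simp
    qed
    then show ?thesis using that by blast
  qed
  have rew: "(LINT s:{0..t}|lborel. (e n)\<^sup>2 / (2 * sqrt ((w s)\<^sup>2 + (e n)\<^sup>2) ^ 3)) = (LINT v|lborel. W v * (m (e n * v) / (2 * (e n * v))))" for n
    unfolding local_time_kernel_integral[OF w e(1)] m_def[symmetric]
  proof (rule Bochner_Integration.integral_cong[OF refl])
    fix v :: real
    consider "v < 0" | "v = 0" | "0 < v" by linarith
    then show "3 * v / (2 * e n * sqrt (v\<^sup>2 + 1\<^sup>2) ^ 5) * m (e n * v) = W v * (m (e n * v) / (2 * (e n * v)))"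
    proof cases
      case 1
      then have "e n * v < 0" using e(1)[of n] by (simp add: mult_pos_neg)
      then have "{s \<in> {0..t}. \<bar>w s - 0\<bar> \<le> e n * v} = {}" by auto
      then have "m (e n * v) = 0" unfolding m_def by (simp only: measure_empty)
      then show ?thesis by simp
    next
      case 3
      then show ?thesis using e(1)[of n] by (simp add: W_def field_simps power2_eq_square)
    qed (simp add: W_def)
  qed
  have "(\<lambda>n. LINT v|lborel. W v * (m (e n * v) / (2 * (e n * v)))) \<longlonglongrightarrow> (LINT v|lborel. W v * l)"
  proof (rule integral_dominated_convergence[where w="\<lambda>v. C * W v"])
    show "AE v in lborel. (\<lambda>n. W v * (m (e n * v) / (2 * (e n * v)))) \<longlonglongrightarrow> W v * l"
    proof (intro AE_I2)
      fix v :: real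
      show "(\<lambda>n. W v * (m (e n * v) / (2 * (e n * v)))) \<longlonglongrightarrow> W v * l"
      proof (cases "0 < v")
        case True
        have "filterlim (\<lambda>n. e n * v) (at_right 0) sequentially"
          using e True by (intro tendsto_imp_filterlim_at_right tendsto_mult_left_zero) auto
        from tendsto_mult[OF tendsto_const filterlim_compose[OF lim this]] show ?thesis .
      next
        case False
        then have "W v = 0" by (auto simp: W_def indicator_def)
        then show ?thesis by simp
      qed
    qed
    show "AE v in lborel. norm (W v * (m (e n * v) / (2 * (e n * v)))) \<le> C * W v" for n
    proof (intro AE_I2)
      fix v :: real
      show "norm (W v * (m (e n * v) / (2 * (e n * v)))) \<le> C * W v"
      proof (cases "0 < v")
        case True
        then have "0 < e n * v" using e(1) by simp
        then have R: "0 \<le> m (e n * v) / (2 * (e n * v))" "m (e n * v) / (2 * (e n * v)) \<le> C"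
          using C m_le by auto
        show ?thesis
          unfolding real_norm_def abs_of_nonneg[OF mult_nonneg_nonneg[OF W0 R(1)]] mult.commute[of C]
          using R(2) W0 by (rule mult_left_mono)
      next
        case False
        then have "W v = 0" by (auto simp: W_def indicator_def)
        then show ?thesis by simp
      qed
    qed
    show "integrable lborel (\<lambda>v. C * W v)" using W by simp
  qed (use W in \<open>auto simp: W_def\<close>)
  then show ?thesis
    using W by (simp add: rew)
qed

text \<open>
  The path spends no time at the level itself, since otherwise the occupation density would be infinite.
\<close>

lemma local_time_level_null:
  fixes w :: "real \<Rightarrow> real"
  assumes w: "continuous_on UNIV w" and l: "has_symmetric_local_time w a t l"
  shows "AE s in lborel. s \<in> {0..t} \<longrightarrow> w s \<noteq> a"
proof -
  have fm: "{s \<in> {0..t}. \<bar>w s - a\<bar> \<le> u} \<in> fmeasurable lborel" for u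
    using w by (rule local_time_set_measurable)
  have "((\<lambda>u. measure lborel {s \<in> {0..t}. \<bar>w s - a\<bar> \<le> u} / (2 * u) * (2 * u)) \<longlongrightarrow> l * (2 * 0)) (at_right 0)"
    using l unfolding has_symmetric_local_time_def by (intro tendsto_intros)
  moreover have "\<forall>\<^sub>F u in at_right 0. measure lborel {s \<in> {0..t}. \<bar>w s - a\<bar> \<le> 0} \<le> measure lborel {s \<in> {0..t}. \<bar>w s - a\<bar> \<le> u} / (2 * u) * (2 * u)"
    using eventually_at_right_less[of 0]
  proof eventually_elim
    case (elim u)
    then have "measure lborel {s \<in> {0..t}. \<bar>w s - a\<bar> \<le> 0} \<le> measure lborel {s \<in> {0..t}. \<bar>w s - a\<bar> \<le> u}"
      by (intro measure_mono_fmeasurable fm fmeasurableD[OF fm]) auto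
    then show ?case using elim by simp
  qed
  ultimately have "measure lborel {s \<in> {0..t}. \<bar>w s - a\<bar> \<le> 0} \<le> l * (2 * 0)"
    by (rule tendsto_lowerbound) simp
  then have "emeasure lborel {s \<in> {0..t}. \<bar>w s - a\<bar> \<le> 0} = 0"
    using fm[of 0] by (simp add: emeasure_eq_measure2 measure_le_0_iff)
  then have "{s \<in> {0..t}. \<bar>w s - a\<bar> \<le> 0} \<in> null_sets lborel"
    using fmeasurableD[OF fm[of 0]] by auto
  from AE_not_in[OF this] show ?thesis
    by eventually_elim auto
qed

section \<open>Functions with a kink at the skew level\<close>

text \<open>
  Estimates for the smoothing of \<open>|y|\<close> and its first two derivatives. Only the last of them deteriorates
  as \<open>e\<close> tends to zero.
\<close>

lemma sqrt_square_add_bounds: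
  fixes y e :: real
  assumes e: "0 < e"
  defines "r \<equiv> sqrt (y\<^sup>2 + e\<^sup>2)"
  shows "\<bar>y\<bar> \<le> r" "e \<le> r" "r \<le> \<bar>y\<bar> + e" "\<bar>y / r - sgn y\<bar> \<le> 1" "\<bar>y * (y / r) - \<bar>y\<bar>\<bar> \<le> e"
    "\<bar>y * (e\<^sup>2 / r ^ 3)\<bar> \<le> 1" "\<bar>y / r\<bar> \<le> 1" "0 < r" "e\<^sup>2 / r ^ 3 \<le> 1 / e"
proof -
  show yr: "\<bar>y\<bar> \<le> r" unfolding r_def by (rule real_le_rsqrt) simp
  show er: "e \<le> r" unfolding r_def by (rule real_le_rsqrt) simp
  show r0: "0 < r" using e er by simp
  show rye: "r \<le> \<bar>y\<bar> + e"
    unfolding r_def using e by (intro real_le_lsqrt) (auto simp: power2_sum)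
  show y1: "\<bar>y / r\<bar> \<le> 1" using yr r0 by simp
  show "\<bar>y / r - sgn y\<bar> \<le> 1"
    using yr r0 by (cases "0::real" y rule: linorder_cases) (auto simp: sgn_if abs_le_iff field_simps)
  have "\<bar>y * (y / r) - \<bar>y\<bar>\<bar> = \<bar>y / r\<bar> * (r - \<bar>y\<bar>)"
  proof -
    have "y * (y / r) - \<bar>y\<bar> = - (\<bar>y\<bar> / r * (r - \<bar>y\<bar>))"
      using r0 by (simp add: field_simps)
    then show ?thesis using yr r0 by (simp add: abs_mult)
  qed
  also have "\<dots> \<le> 1 * e"
    using y1 rye yr e by (intro mult_mono) auto
  finally show "\<bar>y * (y / r) - \<bar>y\<bar>\<bar> \<le> e" by simp
  have e2: "e\<^sup>2 \<le> r\<^sup>2" using er e by (simp add: power_mono)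
  have "\<bar>y\<bar> * e\<^sup>2 \<le> r * r\<^sup>2" using yr e2 r0 by (intro mult_mono) auto
  then show "\<bar>y * (e\<^sup>2 / r ^ 3)\<bar> \<le> 1"
    using r0 by (simp add: abs_mult power3_eq_cube power2_eq_square)
  have "e * e\<^sup>2 \<le> r * r\<^sup>2" using er e2 r0 by (intro mult_mono) auto
  then show "e\<^sup>2 / r ^ 3 \<le> 1 / e"
    using r0 e by (simp add: field_simps power3_eq_cube power2_eq_square)
qed

lemma sqrt_square_add_limits:
  fixes y :: real
  assumes e: "\<And>n. 0 < e n" "e \<longlonglongrightarrow> 0"
  shows "(\<lambda>n. sqrt (y\<^sup>2 + (e n)\<^sup>2)) \<longlonglongrightarrow> \<bar>y\<bar>"
    "(\<lambda>n. y / sqrt (y\<^sup>2 + (e n)\<^sup>2)) \<longlonglongrightarrow> sgn y"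
    "(\<lambda>n. y * ((e n)\<^sup>2 / sqrt (y\<^sup>2 + (e n)\<^sup>2) ^ 3)) \<longlonglongrightarrow> 0"
proof -
  have "(\<lambda>n. sqrt (y\<^sup>2 + (e n)\<^sup>2)) \<longlonglongrightarrow> sqrt (y\<^sup>2 + 0\<^sup>2)"
    using e(2) by (intro tendsto_intros)
  then show 1: "(\<lambda>n. sqrt (y\<^sup>2 + (e n)\<^sup>2)) \<longlonglongrightarrow> \<bar>y\<bar>" by simp
  show "(\<lambda>n. y / sqrt (y\<^sup>2 + (e n)\<^sup>2)) \<longlonglongrightarrow> sgn y"
  proof (cases "y = 0")
    case False
    then have "(\<lambda>n. y / sqrt (y\<^sup>2 + (e n)\<^sup>2)) \<longlonglongrightarrow> y / \<bar>y\<bar>"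
      using 1 by (intro tendsto_intros) auto
    then show ?thesis by (simp add: real_sgn_eq)
  qed simp
  show "(\<lambda>n. y * ((e n)\<^sup>2 / sqrt (y\<^sup>2 + (e n)\<^sup>2) ^ 3)) \<longlonglongrightarrow> 0"
  proof (cases "y = 0")
    case False
    then have "(\<lambda>n. y * ((e n)\<^sup>2 / sqrt (y\<^sup>2 + (e n)\<^sup>2) ^ 3)) \<longlonglongrightarrow> y * (0\<^sup>2 / \<bar>y\<bar> ^ 3)"
      using 1 e(2) by (intro tendsto_intros) auto
    then show ?thesis by simp
  qed simp
qed

lemma DERIV_ratio_sqrt:
  fixes y e :: real
  assumes e: "0 < e"
  shows "((\<lambda>y. y / sqrt (y\<^sup>2 + e\<^sup>2)) has_real_derivative e\<^sup>2 / sqrt (y\<^sup>2 + e\<^sup>2) ^ 3) (at y)"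
proof -
  define r where "r = sqrt (y\<^sup>2 + e\<^sup>2)"
  have r: "0 < r" unfolding r_def using e by (rule sqrt_square_add_pos)
  have rr: "r\<^sup>2 = y\<^sup>2 + e\<^sup>2" unfolding r_def by (simp add: add_nonneg_nonneg)
  have "((\<lambda>y. y / sqrt (y\<^sup>2 + e\<^sup>2)) has_real_derivative (1 * sqrt (y\<^sup>2 + e\<^sup>2) - y * (y / sqrt (y\<^sup>2 + e\<^sup>2)))
      / (sqrt (y\<^sup>2 + e\<^sup>2) * sqrt (y\<^sup>2 + e\<^sup>2))) (at y)"
    using r e unfolding r_def by (intro DERIV_divide DERIV_ident DERIV_sqrt_square_add) auto
  also have "(1 * sqrt (y\<^sup>2 + e\<^sup>2) - y * (y / sqrt (y\<^sup>2 + e\<^sup>2))) / (sqrt (y\<^sup>2 + e\<^sup>2) * sqrt (y\<^sup>2 + e\<^sup>2)) = (r\<^sup>2 - y\<^sup>2) / r ^ 3"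
    unfolding r_def[symmetric] using r by (simp add: field_simps power3_eq_cube power2_eq_square)
  also have "\<dots> = e\<^sup>2 / r ^ 3" using rr by simp
  finally show ?thesis unfolding r_def .
qed

context skew_brownian_motion_at_zero
begin

lemma occ_tendsto:
  assumes \<omega>: "\<omega> \<in> space M"
    and G: "\<And>n. G n \<in> borel_measurable borel" "H \<in> borel_measurable borel"
    and K: "\<And>n y. \<bar>G n y\<bar> \<le> K" and lim: "\<And>y. (\<lambda>n. G n y) \<longlonglongrightarrow> H y"
  shows "(\<lambda>n. occ (G n) t \<omega>) \<longlonglongrightarrow> occ H t \<omega>"
proof -
  have [measurable]: "(\<lambda>s. X (max 0 s) \<omega>) \<in> borel_measurable borel"
    using \<omega> by (rule X_path_measurable)
  note [measurable] = G
  show ?thesis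
    unfolding occ_max set_lebesgue_integral_def
  proof (rule integral_dominated_convergence[where w="\<lambda>s. K * indicator {0..t} s"])
    show "integrable lborel (\<lambda>s. K * indicator {0..t} s)"
      by (cases "0 \<le> t") auto
    show "AE s in lborel. norm (indicat_real {0..t} s *\<^sub>R G n (X (max 0 s) \<omega>)) \<le> K * indicat_real {0..t} s" for n
      using K by (intro AE_I2) (auto simp: indicator_def)
  qed (use lim in \<open>auto intro!: tendsto_intros\<close>)
qed

lemma occ_add_cmult:
  assumes \<omega>: "\<omega> \<in> space M"
    and G: "G \<in> borel_measurable borel" "H \<in> borel_measurable borel" "\<And>y. \<bar>G y\<bar> \<le> K" "\<And>y. \<bar>H y\<bar> \<le> K'"
  shows "occ (\<lambda>y. G y + c * H y) t \<omega> = occ G t \<omega> + c * occ H t \<omega>"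
proof -
  have [measurable]: "(\<lambda>s. X (max 0 s) \<omega>) \<in> borel_measurable borel"
    using \<omega> by (rule X_path_measurable)
  note [measurable] = G(1,2)
  have "set_integrable lborel {0..t} (\<lambda>s. G (X (max 0 s) \<omega>))" "set_integrable lborel {0..t} (\<lambda>s. H (X (max 0 s) \<omega>))"
    by (rule set_integrable_Icc_bounded; use G(3,4) in \<open>measurable; simp\<close>)+
  then show ?thesis
    unfolding occ_max by (subst set_integral_add) auto
qed

text \<open>
  A function that is smooth on both sides of \<open>0\<close> and whose first two derivatives jump there can be written as
  \<open>h y + (c + d * y / 2) * |y|\<close> with \<open>h\<close> twice continuously differentiable: \<open>c\<close> and \<open>d\<close> are half the
  jumps. Replacing \<open>|y|\<close> by \<open>sqrt (y\<^sup>2 + e\<^sup>2)\<close> makes it smooth with a first derivative bounded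
  uniformly in \<open>e\<close>. As \<open>e\<close> tends to zero, half the second derivative produces \<open>c * L\<close> and the push
  produces \<open>\<beta> * h' 0 * L\<close>; the hypothesis \<open>flux\<close> makes them cancel.
\<close>

lemma kink_Ito_expectation:
  fixes h h' h'' :: "real \<Rightarrow> real" and c d K :: real
  assumes t: "0 < t"
    and h: "\<And>y. (h has_real_derivative h' y) (at y)" "\<And>y. (h' has_real_derivative h'' y) (at y)" "continuous_on UNIV h''"
  defines "f \<equiv> \<lambda>y. h y + (c + d * y / 2) * \<bar>y\<bar>"
    and "f' \<equiv> \<lambda>y. h' y + sgn y * (c + d * y)"
    and "f'' \<equiv> \<lambda>y. h'' y + d * sgn y"
  assumes K: "\<And>y. \<bar>f y\<bar> \<le> K" "\<And>y. \<bar>f' y\<bar> \<le> K" "\<And>y. \<bar>f'' y\<bar> \<le> K"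
    and flux: "\<beta> * h' 0 + c = 0"
  shows "expectation (\<lambda>\<omega>. f (X t \<omega>)) = f x + expectation (\<lambda>\<omega>. occ (\<lambda>y. f'' y / 2 + f' y * drift y) t \<omega>)"
proof -
  let ?Lf = "\<lambda>y. f'' y / 2 + f' y * drift y"
  define e where "e n = 1 / real (Suc n)" for n
  have e0: "0 < e n" and e1: "e n \<le> 1" for n by (simp_all add: e_def)
  have e_lim: "e \<longlonglongrightarrow> 0" unfolding e_def by (rule LIMSEQ_Suc[OF lim_1_over_n])
  define R where "R n y = sqrt (y\<^sup>2 + (e n)\<^sup>2)" for n y
  have bds: "\<bar>y\<bar> \<le> R n y" "e n \<le> R n y" "R n y \<le> \<bar>y\<bar> + e n" "\<bar>y / R n y - sgn y\<bar> \<le> 1"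
    "\<bar>y * (y / R n y) - \<bar>y\<bar>\<bar> \<le> e n" "\<bar>y * ((e n)\<^sup>2 / R n y ^ 3)\<bar> \<le> 1" "\<bar>y / R n y\<bar> \<le> 1"
    "0 < R n y" "(e n)\<^sup>2 / R n y ^ 3 \<le> 1 / e n" for n y
    unfolding R_def by (rule sqrt_square_add_bounds[OF e0])+
  define G where "G n y = h y + (c + d * y / 2) * R n y" for n y
  define G' where "G' n y = h' y + (d / 2 * R n y + (c + d * y / 2) * (y / R n y))" for n y
  \<comment> \<open>The second derivative consists of a part \<open>A\<close> that is bounded uniformly in \<open>n\<close> and of a multiple
    of the approximate delta function \<open>k\<close>.\<close>
  define A where "A n y = h'' y + d * (y / R n y) + d / 2 * (y * ((e n)\<^sup>2 / R n y ^ 3))" for n y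
  define k where "k n y = (e n)\<^sup>2 / (2 * R n y ^ 3)" for n y
  define G'' where "G'' n y = A n y + 2 * c * k n y" for n y
  have DR: "(R n has_real_derivative y / R n y) (at y)" for n y
    unfolding R_def using e0 by (rule DERIV_sqrt_square_add)
  have DR2: "((\<lambda>y. y / R n y) has_real_derivative (e n)\<^sup>2 / R n y ^ 3) (at y)" for n y
    unfolding R_def using e0 by (rule DERIV_ratio_sqrt)
  have Dl: "((\<lambda>y. c + d * y / 2) has_real_derivative d / 2) (at y)" for y
    by (auto intro!: derivative_eq_intros)
  have R0: "R n y \<noteq> 0" for n y using bds(8)[of n y] by simp
  have DG: "(G n has_real_derivative G' n y) (at y)" for n y
    unfolding G_def[abs_def] G'_def
    by (rule DERIV_add[OF h(1) DERIV_cong[OF DERIV_mult[OF Dl DR]]]) simp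
  have DG': "(G' n has_real_derivative G'' n y) (at y)" for n y
    unfolding G'_def[abs_def] G''_def A_def k_def
    by (rule DERIV_cong[OF DERIV_add[OF h(2) DERIV_add[OF DERIV_cmult[OF DR] DERIV_mult[OF Dl DR2]]]])
      (simp add: field_simps R0)
  have contR: "continuous_on UNIV (R n)" for n
    unfolding R_def by (intro continuous_intros)
  have contA: "continuous_on UNIV (A n)" and contk: "continuous_on UNIV (k n)" for n
    unfolding A_def k_def using h(3) contR R0 by (auto intro!: continuous_intros)
  then have contG'': "continuous_on UNIV (G'' n)" for n
    unfolding G''_def by (intro continuous_intros)
  have conth: "continuous_on UNIV h" "continuous_on UNIV h'"
    using h(1,2) by (meson DERIV_isCont continuous_at_imp_continuous_on)+
  have [measurable]: "h \<in> borel_measurable borel" "h' \<in> borel_measurable borel" "h'' \<in> borel_measurable borel"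
    using conth h(3) by (auto intro: borel_measurable_continuous_onI)
  have [measurable]: "f \<in> borel_measurable borel" "f' \<in> borel_measurable borel" "f'' \<in> borel_measurable borel"
    unfolding f_def f'_def f''_def by measurable
  have Am[measurable]: "A n \<in> borel_measurable borel" and km[measurable]: "k n \<in> borel_measurable borel" for n
    using contA contk by (auto intro: borel_measurable_continuous_onI)
  have G'm[measurable]: "G' n \<in> borel_measurable borel" for n
    using DG' by (intro borel_measurable_continuous_onI) (meson DERIV_isCont continuous_at_imp_continuous_on)
  define KK where "KK = K + \<bar>c\<bar> + \<bar>d\<bar>"
  have G'_bd: "\<bar>G' n y\<bar> \<le> KK" for n y
  proof -
    have "G' n y - f' y = d / 2 * (R n y - \<bar>y\<bar>) + c * (y / R n y - sgn y) + d / 2 * (y * (y / R n y) - \<bar>y\<bar>)"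
      unfolding G'_def f'_def by (simp add: algebra_simps sgn_if)
    also have "\<bar>\<dots>\<bar> \<le> \<bar>d / 2 * (R n y - \<bar>y\<bar>)\<bar> + \<bar>c * (y / R n y - sgn y)\<bar> + \<bar>d / 2 * (y * (y / R n y) - \<bar>y\<bar>)\<bar>"
      by linarith
    also have "\<dots> \<le> \<bar>d / 2\<bar> * 1 + \<bar>c\<bar> * 1 + \<bar>d / 2\<bar> * 1"
      unfolding abs_mult using bds(1)[of y n] bds(3)[of n y] bds(4,5)[of y n] e1[of n] by (intro add_mono mult_left_mono) auto
    finally show ?thesis
      using K(2)[of y] unfolding KK_def by linarith
  qed
  have A_bd: "\<bar>A n y\<bar> \<le> K + 3 * \<bar>d\<bar>" for n y
  proof -
    have "\<bar>d * (y / R n y)\<bar> \<le> \<bar>d\<bar> * 1"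
      unfolding abs_mult[of d] by (rule mult_left_mono[OF bds(7)]) simp
    moreover have "\<bar>d / 2 * (y * ((e n)\<^sup>2 / R n y ^ 3))\<bar> \<le> \<bar>d / 2\<bar> * 1"
      unfolding abs_mult[of "d / 2"] by (rule mult_left_mono[OF bds(6)]) simp
    moreover have "\<bar>h'' y\<bar> \<le> K + \<bar>d\<bar>"
      using K(3)[of y] unfolding f''_def by (auto simp: sgn_if split: if_splits)
    ultimately show ?thesis
      unfolding A_def by linarith
  qed
  have k_bd: "\<bar>k n y\<bar> \<le> 1 / e n" for n y
  proof -
    define z where "z = (e n)\<^sup>2 / R n y ^ 3"
    have "k n y = z / 2" "0 \<le> z" "z \<le> 1 / e n"
      using bds(9)[of n y] bds(8)[of n y] by (simp_all add: k_def z_def)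
    then show ?thesis by linarith
  qed
  have G''_bd: "\<bar>G'' n y\<bar> \<le> K + 3 * \<bar>d\<bar> + \<bar>2 * c\<bar> * (1 / e n)" for n y
  proof -
    have "\<bar>2 * c * k n y\<bar> \<le> \<bar>2 * c\<bar> * (1 / e n)"
      unfolding abs_mult[of "2 * c"] by (rule mult_left_mono[OF k_bd]) simp
    then show ?thesis using A_bd[of n y] unfolding G''_def by linarith
  qed
  define Y where "Y n \<omega> = G n (X t \<omega>) - G n (X 0 \<omega>) - G' n 0 * push t \<omega> - occ (\<lambda>y. G' n y * drift y) t \<omega> - occ (G'' n) t \<omega> / 2" for n \<omega>
  note Y = Ito_martingale[OF t DG DG' contG'' G'_bd G''_bd, folded Y_def]
  define Z where "Z \<omega> = f (X t \<omega>) - f (X 0 \<omega>) - occ ?Lf t \<omega>" for \<omega>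
  have Lf_m: "?Lf \<in> borel_measurable borel" by measurable
  have f'_drift_bd: "\<bar>f' y * drift y\<bar> \<le> K * (\<bar>\<mu>p\<bar> + \<bar>\<mu>m\<bar>)" for y
    unfolding abs_mult using K(2)[of y] drift_bound[of y] by (intro mult_mono) auto
  have Lf_bd: "\<bar>f'' y / 2 + f' y * drift y\<bar> \<le> K + K * (\<bar>\<mu>p\<bar> + \<bar>\<mu>m\<bar>)" for y
  proof -
    have "\<bar>f'' y / 2\<bar> \<le> K" using K(3)[of y] by simp
    with f'_drift_bd[of y] show ?thesis by linarith
  qed
  have [measurable]: "X t \<in> borel_measurable M" "X 0 \<in> borel_measurable M"
    using t by (auto intro: X_measurable)
  have [measurable]: "occ ?Lf t \<in> borel_measurable M"
    by (rule occ_measurable[OF Lf_m])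
  have Zm: "Z \<in> borel_measurable M"
    unfolding Z_def by measurable
  have "AE \<omega> in M. (\<lambda>n. Y n \<omega>) \<longlonglongrightarrow> Z \<omega>"
    using push_is_local_time AE_space
  proof eventually_elim
    case (elim \<omega>)
    obtain L where L: "has_symmetric_local_time (\<lambda>s. X (max 0 s) \<omega>) 0 t L" "push t \<omega> = \<beta> * L"
      using elim(1) less_imp_le[OF t] by blast
    note lims = sqrt_square_add_limits[OF e0 e_lim, folded R_def]
    have l1: "(\<lambda>n. G n y) \<longlonglongrightarrow> f y" for y
      unfolding G_def f_def by (intro tendsto_intros lims)
    have l2: "(\<lambda>n. G' n y) \<longlonglongrightarrow> f' y" for y
    proof -
      have "(\<lambda>n. G' n y) \<longlonglongrightarrow> h' y + (d / 2 * \<bar>y\<bar> + (c + d * y / 2) * sgn y)"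
        unfolding G'_def by (intro tendsto_intros lims)
      also have "h' y + (d / 2 * \<bar>y\<bar> + (c + d * y / 2) * sgn y) = f' y"
        unfolding f'_def by (simp add: sgn_if algebra_simps)
      finally show ?thesis .
    qed
    have l3: "(\<lambda>n. A n y) \<longlonglongrightarrow> f'' y" for y
    proof -
      have "(\<lambda>n. A n y) \<longlonglongrightarrow> h'' y + d * sgn y + d / 2 * 0"
        unfolding A_def by (intro tendsto_intros lims)
      then show ?thesis by (simp add: f''_def)
    qed
    have o2: "(\<lambda>n. occ (\<lambda>y. G' n y * drift y) t \<omega>) \<longlonglongrightarrow> occ (\<lambda>y. f' y * drift y) t \<omega>"
    proof (rule occ_tendsto[OF elim(2)])
      show "\<bar>G' n y * drift y\<bar> \<le> KK * (\<bar>\<mu>p\<bar> + \<bar>\<mu>m\<bar>)" for n y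
        unfolding abs_mult using G'_bd[of n y] drift_bound[of y] by (intro mult_mono) auto
    qed (auto intro!: tendsto_intros l2)
    have o3: "(\<lambda>n. occ (A n) t \<omega>) \<longlonglongrightarrow> occ f'' t \<omega>"
      by (rule occ_tendsto[OF elim(2) Am _ A_bd l3]) simp
    have o4: "(\<lambda>n. occ (k n) t \<omega>) \<longlonglongrightarrow> L"
      unfolding occ_max k_def R_def
      by (rule local_time_kernel_limit[OF X_path_continuous[OF elim(2)] L(1) e0 e_lim])
    have "occ (G'' n) t \<omega> = occ (A n) t \<omega> + 2 * c * occ (k n) t \<omega>" for n
      unfolding G''_def[abs_def] by (rule occ_add_cmult[OF elim(2) Am km A_bd k_bd])
    then have "(\<lambda>n. Y n \<omega>) \<longlonglongrightarrow> f (X t \<omega>) - f (X 0 \<omega>) - f' 0 * push t \<omega> - occ (\<lambda>y. f' y * drift y) t \<omega>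
        - (occ f'' t \<omega> + 2 * c * L) / 2"
      unfolding Y_def by (simp only:) (intro tendsto_intros l1 l2 o2 o3 o4, simp)
    also have "f (X t \<omega>) - f (X 0 \<omega>) - f' 0 * push t \<omega> - occ (\<lambda>y. f' y * drift y) t \<omega>
        - (occ f'' t \<omega> + 2 * c * L) / 2
      = f (X t \<omega>) - f (X 0 \<omega>) - (occ (\<lambda>y. f' y * drift y) t \<omega> + 1 / 2 * occ f'' t \<omega>) - (\<beta> * h' 0 + c) * L"
      unfolding L(2) f'_def by (simp add: field_simps)
    also have "occ (\<lambda>y. f' y * drift y) t \<omega> + 1 / 2 * occ f'' t \<omega> = occ ?Lf t \<omega>"
      using occ_add_cmult[where c="1 / 2" and t=t, OF elim(2) _ _ f'_drift_bd K(3)]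
      by (simp add: add.commute)
    finally show ?case
      unfolding Z_def flux by simp
  qed
  from expectation_zero_of_AE_limit(4)[OF Y(1,2,3,4) Zm this]
  have EZ: "expectation Z = 0" .
  have int: "integrable M (\<lambda>\<omega>. f (X s \<omega>))" if "s \<in> {0, t}" for s
    using that K(1) by (intro integrable_const_bound[where B=K]) auto
  have "expectation Z = expectation (\<lambda>\<omega>. f (X t \<omega>)) - expectation (\<lambda>\<omega>. f (X 0 \<omega>))
      - expectation (\<lambda>\<omega>. occ ?Lf t \<omega>)"
    unfolding Z_def using int expectation_occ(1)[OF Lf_m Lf_bd] by simp
  moreover have "expectation (\<lambda>\<omega>. f (X 0 \<omega>)) = f x"
    by (rule expectation_start) measurable
  ultimately show ?thesis using EZ by simp
qed

end

section \<open>The resolvent equation\<close>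

lemma DERIV_glue_at_zero:
  fixes p m p' m' :: "real \<Rightarrow> real"
  assumes p: "\<And>y. (p has_real_derivative p' y) (at y)" and m: "\<And>y. (m has_real_derivative m' y) (at y)"
    and eq: "p 0 = m 0" "p' 0 = m' 0"
  shows "((\<lambda>y. if 0 \<le> y then p y else m y) has_real_derivative (if 0 \<le> y then p' y else m' y)) (at y)"
proof -
  have pv: "(p has_vector_derivative p' y) (at y within S)" and mv: "(m has_vector_derivative m' y) (at y within S)" for S
    using p[of y, unfolded has_real_derivative_iff_has_vector_derivative]
      m[of y, unfolded has_real_derivative_iff_has_vector_derivative]
    by (auto intro: has_vector_derivative_at_within)
  have "((\<lambda>y. if y \<in> {0..} then p y else m y) has_vector_derivative (if y \<in> {0..} then p' y else m' y)) (at y within UNIV)"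
  proof (rule has_vector_derivative_If_within_closures[where x=y and S="{0..}" and T="{..<0}" and f=p and g=m and f'=p' and g'=m', OF _ _ pv mv])
    show "y \<in> {0..} \<union> {..<0}" "UNIV = {0..} \<union> {..<0::real}" by auto
    assume "y \<in> closure {0..}" "y \<in> closure {..<0}"
    then have "y = 0" by simp
    with eq show "p y = m y" "p' y = m' y" by simp_all
  qed
  then show ?thesis
    by (simp only: has_real_derivative_iff_has_vector_derivative atLeast_iff)
qed

lemma continuous_glue_at_zero:
  fixes p m :: "real \<Rightarrow> real"
  assumes "continuous_on UNIV p" "continuous_on UNIV m" "p 0 = m 0"
  shows "continuous_on UNIV (\<lambda>y. if 0 \<le> y then p y else m y)"
proof -
  have "continuous_on ({0..} \<union> {..0}) (\<lambda>y. if 0 \<le> y then p y else m y)"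
    using assms by (intro continuous_on_cases) (auto intro: continuous_on_subset dest: antisym)
  moreover have "{0..} \<union> {..0} = (UNIV :: real set)" by auto
  ultimately show ?thesis by simp
qed

context skew_brownian_motion_at_zero
begin

lemma expectation_path_continuous:
  fixes g :: "real \<Rightarrow> real"
  assumes g: "continuous_on UNIV g" "\<And>y. \<bar>g y\<bar> \<le> K"
  shows "continuous_on UNIV (\<lambda>t. expectation (\<lambda>\<omega>. g (X (max 0 t) \<omega>)))"
  unfolding continuous_on_sequentially
proof (intro allI ballI impI, elim conjE)
  fix u :: "nat \<Rightarrow> real" and t assume u: "u \<longlonglongrightarrow> t"
  have [measurable]: "g \<in> borel_measurable borel" using g(1) by (rule borel_measurable_continuous_onI)
  have [measurable]: "X (max 0 s) \<in> borel_measurable M" for s by (rule X_measurable) simp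
  show "((\<lambda>t. expectation (\<lambda>\<omega>. g (X (max 0 t) \<omega>))) \<circ> u) \<longlonglongrightarrow> expectation (\<lambda>\<omega>. g (X (max 0 t) \<omega>))"
    unfolding comp_def
  proof (rule integral_dominated_convergence[where w="\<lambda>_. K"])
    show "AE \<omega> in M. (\<lambda>n. g (X (max 0 (u n)) \<omega>)) \<longlonglongrightarrow> g (X (max 0 t) \<omega>)"
    proof (rule AE_I2)
      fix \<omega> assume \<omega>: "\<omega> \<in> space M"
      have "continuous_on UNIV (\<lambda>s. g (X (max 0 s) \<omega>))"
        by (rule continuous_on_compose2[OF g(1) X_path_continuous[OF \<omega>]]) simp
      from continuous_on_tendsto_compose[OF this u] show "(\<lambda>n. g (X (max 0 (u n)) \<omega>)) \<longlonglongrightarrow> g (X (max 0 t) \<omega>)"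
        by simp
    qed
  qed (use g(2) in auto)
qed

text \<open>
  The function \<open>f\<close> is given by its two smooth branches. Since \<open>h\<close> carries the mean of the one-sided derivatives
  at \<open>0\<close>, the transmission condition becomes the cancellation \<open>\<beta> * h' 0 + c = 0\<close>. At \<open>0\<close> itself
  the differential equation may fail, but the path spends no time there.
\<close>

lemma resolvent_evolution:
  fixes p p' p'' m m' m'' g :: "real \<Rightarrow> real" and q K t :: real
  assumes t: "0 < t"
    and p: "\<And>y. (p has_real_derivative p' y) (at y)" "\<And>y. (p' has_real_derivative p'' y) (at y)" "continuous_on UNIV p''"
    and m: "\<And>y. (m has_real_derivative m' y) (at y)" "\<And>y. (m' has_real_derivative m'' y) (at y)" "continuous_on UNIV m''"
    and p_bd: "\<And>y. 0 \<le> y \<Longrightarrow> \<bar>p y\<bar> \<le> K \<and> \<bar>p' y\<bar> \<le> K \<and> \<bar>p'' y\<bar> \<le> K"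
    and m_bd: "\<And>y. y \<le> 0 \<Longrightarrow> \<bar>m y\<bar> \<le> K \<and> \<bar>m' y\<bar> \<le> K \<and> \<bar>m'' y\<bar> \<le> K"
    and glue: "p 0 = m 0" "(1 + \<beta>) * p' 0 = (1 - \<beta>) * m' 0"
    and g: "g \<in> borel_measurable borel" "\<And>y. \<bar>g y\<bar> \<le> K"
    and ode: "\<And>y. 0 < y \<Longrightarrow> p'' y / 2 + \<mu>p * p' y = q * (p y - g y)" "\<And>y. y < 0 \<Longrightarrow> m'' y / 2 + \<mu>m * m' y = q * (m y - g y)"
  defines "f \<equiv> \<lambda>y. if 0 \<le> y then p y else m y"
  shows "expectation (\<lambda>\<omega>. f (X t \<omega>)) = f x + (LINT s:{0..t}|lborel. q * (expectation (\<lambda>\<omega>. f (X s \<omega>)) - expectation (\<lambda>\<omega>. g (X s \<omega>))))"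
proof -
  define c where "c = (p' 0 - m' 0) / 2"
  define d where "d = (p'' 0 - m'' 0) / 2"
  define h where "h y = (if 0 \<le> y then p y - (c * y + d * y\<^sup>2 / 2) else m y + (c * y + d * y\<^sup>2 / 2))" for y
  define h' where "h' y = (if 0 \<le> y then p' y - (c + d * y) else m' y + (c + d * y))" for y
  define h'' where "h'' y = (if 0 \<le> y then p'' y - d else m'' y + d)" for y
  have poly: "((\<lambda>y. c * y + d * y\<^sup>2 / 2) has_real_derivative c + d * y) (at y)" for y
    by (auto intro!: derivative_eq_intros)
  have lin: "((\<lambda>y. c + d * y) has_real_derivative d) (at y)" for y
    by (auto intro!: derivative_eq_intros)
  have h1: "(h has_real_derivative h' y) (at y)" for y
    unfolding h_def[abs_def] h'_def
  proof (rule DERIV_glue_at_zero[OF DERIV_diff[OF p(1) poly] DERIV_add[OF m(1) poly]])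
    show "p' 0 - (c + d * 0) = m' 0 + (c + d * 0)" by (simp add: c_def field_simps)
  qed (use glue in simp)
  have h2: "(h' has_real_derivative h'' y) (at y)" for y
    unfolding h'_def[abs_def] h''_def
  proof (rule DERIV_glue_at_zero[OF DERIV_diff[OF p(2) lin] DERIV_add[OF m(2) lin]])
    show "p' 0 - (c + d * 0) = m' 0 + (c + d * 0)" by (simp add: c_def field_simps)
    show "p'' 0 - d = m'' 0 + d" by (simp add: d_def field_simps)
  qed
  have h3: "continuous_on UNIV h''"
    unfolding h''_def[abs_def]
  proof (rule continuous_glue_at_zero)
    show "continuous_on UNIV (\<lambda>y. p'' y - d)" "continuous_on UNIV (\<lambda>y. m'' y + d)"
      using p(3) m(3) by (auto intro!: continuous_intros)
    show "p'' 0 - d = m'' 0 + d" by (simp add: d_def field_simps)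
  qed
  have f_eq: "h y + (c + d * y / 2) * \<bar>y\<bar> = f y" for y
    by (simp add: h_def f_def power2_eq_square algebra_simps)
  let ?f' = "\<lambda>y. h' y + sgn y * (c + d * y)" and ?f'' = "\<lambda>y. h'' y + d * sgn y"
  let ?Lf = "\<lambda>y. ?f'' y / 2 + ?f' y * drift y" and ?qfg = "\<lambda>y. q * (f y - g y)"
  \<comment> \<open>At \<open>0\<close> the convention \<open>sgn 0 = 0\<close> makes both functions the means of the one-sided values.\<close>
  have f'_eq: "0 < y \<Longrightarrow> ?f' y = p' y" "y < 0 \<Longrightarrow> ?f' y = m' y" "?f' 0 = (p' 0 + m' 0) / 2" for y
    by (auto simp: h'_def c_def field_simps)
  have f''_eq: "0 < y \<Longrightarrow> ?f'' y = p'' y" "y < 0 \<Longrightarrow> ?f'' y = m'' y" "?f'' 0 = (p'' 0 + m'' 0) / 2" for y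
    by (auto simp: h''_def d_def field_simps)
  have f_bd: "\<bar>f y\<bar> \<le> K" for y
    using p_bd[of y] m_bd[of y] by (auto simp: f_def)
  have f'_bd: "\<bar>?f' y\<bar> \<le> K" for y
    using p_bd[of y] m_bd[of y] f'_eq(1,2)[of y] f'_eq(3) by (cases "0::real" y rule: linorder_cases) (auto simp: abs_le_iff)
  have f''_bd: "\<bar>?f'' y\<bar> \<le> K" for y
    using p_bd[of y] m_bd[of y] f''_eq(1,2)[of y] f''_eq(3) by (cases "0::real" y rule: linorder_cases) (auto simp: abs_le_iff)
  have flux: "\<beta> * h' 0 + c = 0"
    using glue(2) by (simp add: h'_def c_def field_simps)
  have "continuous_on UNIV p" "continuous_on UNIV m"
    using p(1) m(1) by (meson DERIV_isCont continuous_at_imp_continuous_on)+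
  then have f_cont: "continuous_on UNIV f"
    unfolding f_def using glue(1) by (rule continuous_glue_at_zero)
  then have fm[measurable]: "f \<in> borel_measurable borel"
    by (rule borel_measurable_continuous_onI)
  note [measurable] = g(1)
  have ex: "expectation (\<lambda>\<omega>. f (X t \<omega>)) = f x + expectation (\<lambda>\<omega>. occ ?Lf t \<omega>)"
    using kink_Ito_expectation[where K=K and c=c and d=d and t=t, OF t h1 h2 h3 _ f'_bd f''_bd flux] f_bd
    unfolding f_eq by blast
  have [measurable]: "h' \<in> borel_measurable borel" "h'' \<in> borel_measurable borel"
    using h2 h3 by (auto intro!: borel_measurable_continuous_onI) (meson DERIV_isCont continuous_at_imp_continuous_on)
  have occ_eq: "AE \<omega> in M. occ ?Lf t \<omega> = occ ?qfg t \<omega>"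
    using push_is_local_time AE_space
  proof eventually_elim
    case (elim \<omega>)
    obtain L where L: "has_symmetric_local_time (\<lambda>s. X (max 0 s) \<omega>) 0 t L"
      using elim(1) less_imp_le[OF t] by blast
    have pt: "?f'' y / 2 + ?f' y * drift y = q * (f y - g y)" if "y \<noteq> 0" for y
      using that f'_eq(1,2)[of y] f''_eq(1,2)[of y] ode[of y] by (cases "0::real" y rule: linorder_cases) (auto simp: f_def drift_def mult.commute)
    have [measurable]: "(\<lambda>s. X (max 0 s) \<omega>) \<in> borel_measurable borel"
      using elim(2) by (rule X_path_measurable)
    show ?case
      unfolding occ_max set_lebesgue_integral_def
    proof (rule integral_cong_AE)
      show "AE s in lborel. indicat_real {0..t} s *\<^sub>R (?f'' (X (max 0 s) \<omega>) / 2 + ?f' (X (max 0 s) \<omega>) * drift (X (max 0 s) \<omega>))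
          = indicat_real {0..t} s *\<^sub>R (q * (f (X (max 0 s) \<omega>) - g (X (max 0 s) \<omega>)))"
        using local_time_level_null[OF X_path_continuous[OF elim(2)] L]
      proof eventually_elim
        case (elim s)
        then show ?case
          using pt[of "X (max 0 s) \<omega>"] by (cases "s \<in> {0..t}") auto
      qed
    qed measurable
  qed
  have [measurable]: "X s \<in> borel_measurable M" if "0 \<le> s" for s using that by (rule X_measurable)
  have fg: "?qfg \<in> borel_measurable borel" by measurable
  have fg_bd: "\<bar>q * (f y - g y)\<bar> \<le> \<bar>q\<bar> * (2 * K)" for y
    unfolding abs_mult using f_bd[of y] g(2)[of y] by (intro mult_left_mono) (auto simp: abs_le_iff)
  have "expectation (\<lambda>\<omega>. occ ?Lf t \<omega>) = expectation (occ ?qfg t)"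
    using occ_eq by (intro integral_cong_AE occ_measurable) measurable
  also have "\<dots> = (LINT s:{0..t}|lborel. expectation (\<lambda>\<omega>. q * (f (X s \<omega>) - g (X s \<omega>))))"
    by (rule expectation_occ(2)[OF fg fg_bd])
  also have "\<dots> = (LINT s:{0..t}|lborel. q * (expectation (\<lambda>\<omega>. f (X s \<omega>)) - expectation (\<lambda>\<omega>. g (X s \<omega>))))"
  proof (rule set_lebesgue_integral_cong)
    show "\<forall>s. s \<in> {0..t} \<longrightarrow> expectation (\<lambda>\<omega>. q * (f (X s \<omega>) - g (X s \<omega>))) = q * (expectation (\<lambda>\<omega>. f (X s \<omega>)) - expectation (\<lambda>\<omega>. g (X s \<omega>)))"
    proof (intro allI impI)
      fix s assume "s \<in> {0..t}"
      then have [measurable]: "X s \<in> borel_measurable M" by (intro X_measurable) simp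
      have "integrable M (\<lambda>\<omega>. f (X s \<omega>))" "integrable M (\<lambda>\<omega>. g (X s \<omega>))"
        using f_bd g(2) by (auto intro!: integrable_const_bound[where B=K])
      then show "expectation (\<lambda>\<omega>. q * (f (X s \<omega>) - g (X s \<omega>))) = q * (expectation (\<lambda>\<omega>. f (X s \<omega>)) - expectation (\<lambda>\<omega>. g (X s \<omega>)))"
        by simp
    qed
  qed simp
  finally show ?thesis unfolding ex by (rule arg_cong)
qed

text \<open>
  With \<open>H t = E f(X_t)\<close> and \<open>k t = E g(X_t)\<close> the evolution equation is \<open>H' = q * (H - k)\<close>, so
  \<open>- q * exp (- q * t) * k t\<close> is the derivative of \<open>exp (- q * t) * H t\<close>. This function runs from \<open>f x\<close> to \<open>0\<close>.
\<close>

lemma resolvent_potential: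
  fixes p p' p'' m m' m'' g :: "real \<Rightarrow> real" and q K :: real
  assumes q: "0 < q"
    and p: "\<And>y. (p has_real_derivative p' y) (at y)" "\<And>y. (p' has_real_derivative p'' y) (at y)" "continuous_on UNIV p''"
    and m: "\<And>y. (m has_real_derivative m' y) (at y)" "\<And>y. (m' has_real_derivative m'' y) (at y)" "continuous_on UNIV m''"
    and p_bd: "\<And>y. 0 \<le> y \<Longrightarrow> \<bar>p y\<bar> \<le> K \<and> \<bar>p' y\<bar> \<le> K \<and> \<bar>p'' y\<bar> \<le> K"
    and m_bd: "\<And>y. y \<le> 0 \<Longrightarrow> \<bar>m y\<bar> \<le> K \<and> \<bar>m' y\<bar> \<le> K \<and> \<bar>m'' y\<bar> \<le> K"
    and glue: "p 0 = m 0" "(1 + \<beta>) * p' 0 = (1 - \<beta>) * m' 0"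
    and g: "continuous_on UNIV g" "\<And>y. \<bar>g y\<bar> \<le> K"
    and ode: "\<And>y. 0 < y \<Longrightarrow> p'' y / 2 + \<mu>p * p' y = q * (p y - g y)" "\<And>y. y < 0 \<Longrightarrow> m'' y / 2 + \<mu>m * m' y = q * (m y - g y)"
  defines "f \<equiv> \<lambda>y. if 0 \<le> y then p y else m y"
  shows "(\<integral>t. exponential_density q t * expectation (\<lambda>\<omega>. g (X (max 0 t) \<omega>)) \<partial>lborel) = f x"
proof -
  have gm[measurable]: "g \<in> borel_measurable borel"
    using g(1) by (rule borel_measurable_continuous_onI)
  have "continuous_on UNIV p" "continuous_on UNIV m"
    using p(1) m(1) by (meson DERIV_isCont continuous_at_imp_continuous_on)+
  then have f_cont: "continuous_on UNIV f"
    unfolding f_def using glue(1) by (rule continuous_glue_at_zero)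
  have f_bd: "\<bar>f y\<bar> \<le> K" for y
    using p_bd[of y] m_bd[of y] by (auto simp: f_def)
  have [measurable]: "f \<in> borel_measurable borel"
    using f_cont by (rule borel_measurable_continuous_onI)
  have [measurable]: "X (max 0 s) \<in> borel_measurable M" for s by (rule X_measurable) simp
  define H where "H t = expectation (\<lambda>\<omega>. f (X (max 0 t) \<omega>))" for t
  define k where "k t = expectation (\<lambda>\<omega>. g (X (max 0 t) \<omega>))" for t
  have Hc: "continuous_on UNIV H" and kc: "continuous_on UNIV k"
    unfolding H_def k_def using expectation_path_continuous[OF f_cont f_bd] expectation_path_continuous[OF g] by auto
  have H_bd: "\<bar>H t\<bar> \<le> K" and k_bd: "\<bar>k t\<bar> \<le> K" for t
    unfolding H_def k_def by (rule expectation_X_bound; use f_bd g(2) in simp)+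
  have H0: "H 0 = f x"
    unfolding H_def by (simp add: expectation_start)
  have Hc': "continuous_on S (\<lambda>s. q * (H s - k s))" for S
    using continuous_on_subset[OF Hc] continuous_on_subset[OF kc] by (intro continuous_intros) auto
  have Hint: "H t = f x + integral {0..t} (\<lambda>s. q * (H s - k s))" if "0 \<le> t" for t
  proof (cases "t = 0")
    case False
    with that have t: "0 < t" by simp
    have "H t = f x + (LINT s:{0..t}|lborel. q * (expectation (\<lambda>\<omega>. f (X s \<omega>)) - expectation (\<lambda>\<omega>. g (X s \<omega>))))"
      using resolvent_evolution[OF t p m p_bd m_bd glue gm g(2) ode] t unfolding H_def f_def by simp
    also have "(LINT s:{0..t}|lborel. q * (expectation (\<lambda>\<omega>. f (X s \<omega>)) - expectation (\<lambda>\<omega>. g (X s \<omega>)))) = (LINT s:{0..t}|lborel. q * (H s - k s))"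
      by (rule set_lebesgue_integral_cong) (auto simp: H_def k_def)
    also have "\<dots> = integral {0..t} (\<lambda>s. q * (H s - k s))"
      by (intro set_borel_integral_eq_integral borel_integrable_atLeastAtMost'[unfolded set_integrable_def[symmetric]] Hc')
    finally show ?thesis .
  qed (simp add: H0)
  have DH: "(H has_real_derivative q * (H t - k t)) (at t within {0..T})" if t: "t \<in> {0..T}" for t T
  proof -
    have "((\<lambda>t. f x + integral {0..t} (\<lambda>s. q * (H s - k s))) has_real_derivative 0 + q * (H t - k t)) (at t within {0..T})"
      by (intro DERIV_add DERIV_const integral_has_real_derivative Hc' t)
    then show ?thesis
      using has_field_derivative_transform_within[of "\<lambda>t. f x + integral {0..t} (\<lambda>s. q * (H s - k s))" _ t "{0..T}" 1 H] t Hint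
      by auto
  qed
  have part: "integral {0..T} (\<lambda>t. q * exp (- q * t) * k t) = f x - exp (- q * T) * H T" if T: "0 \<le> T" for T
  proof -
    have "((\<lambda>t. - (q * exp (- q * t) * k t)) has_integral (exp (- q * T) * H T - exp (- q * 0) * H 0)) {0..T}"
    proof (rule fundamental_theorem_of_calculus[OF T])
      fix t assume t: "t \<in> {0..T}"
      have "((\<lambda>t. exp (- q * t) * H t) has_real_derivative - (q * exp (- q * t) * k t)) (at t within {0..T})"
        by (auto intro!: derivative_eq_intros DH[OF t] simp: algebra_simps)
      then show "((\<lambda>t. exp (- q * t) * H t) has_vector_derivative - (q * exp (- q * t) * k t)) (at t within {0..T})"
        by (simp add: has_real_derivative_iff_has_vector_derivative)
    qed
    from integral_unique[OF this] show ?thesis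
      by (simp add: H0)
  qed
  have [measurable]: "k \<in> borel_measurable borel" using kc by (rule borel_measurable_continuous_onI)
  let ?I = "\<lambda>n. \<integral>t. indicator {0..real n} t * (exponential_density q t * k t) \<partial>lborel"
  have "?I \<longlonglongrightarrow> (\<integral>t. exponential_density q t * k t \<partial>lborel)"
  proof (rule integral_dominated_convergence[where w="\<lambda>t. K * exponential_density q t"])
    show "integrable lborel (\<lambda>t. K * exponential_density q t)"
    proof -
      interpret E: prob_space "density lborel (exponential_density q)"
        using q by (rule prob_space_exponential_density)
      have "(\<integral>\<^sup>+t. ennreal (exponential_density q t) \<partial>lborel) = 1"
        using E.emeasure_space_1 by (simp add: emeasure_density)
      then have "integrable lborel (exponential_density q)"
        using exponential_density_nonneg[OF q] by (intro integrableI_nonneg) auto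
      then show ?thesis by simp
    qed
    show "AE t in lborel. (\<lambda>n. indicator {0..real n} t * (exponential_density q t * k t)) \<longlonglongrightarrow> exponential_density q t * k t"
    proof (rule AE_I2)
      fix t :: real
      obtain N where "t \<le> real N" using real_arch_simple by blast
      then have "\<forall>\<^sub>F n in sequentially. indicator {0..real n} t * (exponential_density q t * k t) = exponential_density q t * k t"
        by (intro eventually_sequentiallyI[of N]) (auto simp: indicator_def exponential_density_def)
      then show "(\<lambda>n. indicator {0..real n} t * (exponential_density q t * k t)) \<longlonglongrightarrow> exponential_density q t * k t"
        by (rule tendsto_eventually)
    qed
    show "AE t in lborel. norm (indicator {0..real n} t * (exponential_density q t * k t)) \<le> K * exponential_density q t" for n
    proof (rule AE_I2)
      fix t :: real
      have "\<bar>exponential_density q t * k t\<bar> \<le> exponential_density q t * K"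
        unfolding abs_mult using exponential_density_nonneg[OF q, of t] k_bd[of t] by (simp add: mult_left_mono)
      moreover have "0 \<le> K * exponential_density q t"
        using exponential_density_nonneg[OF q, of t] k_bd[of t] by simp
      ultimately show "norm (indicator {0..real n} t * (exponential_density q t * k t)) \<le> K * exponential_density q t"
        by (simp add: indicator_def mult.commute)
    qed
  qed measurable
  moreover have "?I n = f x - exp (- q * real n) * H (real n)" for n
  proof -
    have "?I n = (LINT t:{0..real n}|lborel. q * exp (- q * t) * k t)"
      unfolding set_lebesgue_integral_def by (intro Bochner_Integration.integral_cong) (auto simp: indicator_def exponential_density_def mult.commute)
    also have "\<dots> = integral {0..real n} (\<lambda>t. q * exp (- q * t) * k t)"
      by (intro set_borel_integral_eq_integral borel_integrable_atLeastAtMost'[unfolded set_integrable_def[symmetric]]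
          continuous_intros continuous_on_subset[OF kc]) auto
    also have "\<dots> = f x - exp (- q * real n) * H (real n)"
      by (rule part) simp
    finally show ?thesis .
  qed
  moreover have "(\<lambda>n. f x - exp (- q * real n) * H (real n)) \<longlonglongrightarrow> f x - 0"
  proof (intro tendsto_diff tendsto_const)
    have "(\<lambda>n. exp (- q * real n) * K) \<longlonglongrightarrow> 0"
      using q by real_asymp
    moreover have "\<forall>\<^sub>F n in sequentially. norm (exp (- q * real n) * H (real n)) \<le> exp (- q * real n) * K"
      using H_bd by (intro always_eventually allI) (simp add: abs_mult)
    ultimately show "(\<lambda>n. exp (- q * real n) * H (real n)) \<longlonglongrightarrow> 0"
      by (rule Lim_null_comparison[rotated])
  qed
  ultimately show ?thesis
    unfolding k_def[symmetric] by (simp add: LIMSEQ_unique)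
qed

end

section \<open>Evaluation at an independent time\<close>

context skew_brownian_motion_at_zero
begin

text \<open>
  The evaluation map \<open>(t, w) \<mapsto> w t\<close> is not measurable for the product \<open>\<sigma>\<close>-algebra on paths, so Fubini's
  theorem does not apply directly. The time is therefore rounded down to a dyadic grid. At a single
  grid point independence factorises the expectation; summation over the grid and continuity
  of the paths give the claim.
\<close>

lemma expectation_at_independent_time:
  fixes e :: "'a \<Rightarrow> real" and g :: "real \<Rightarrow> real"
  assumes e[measurable]: "e \<in> borel_measurable M" and e0: "\<And>\<omega>. \<omega> \<in> space M \<Longrightarrow> 0 \<le> e \<omega>"
    and indep: "indep_set {e -` A \<inter> space M | A. A \<in> sets borel}
      {(\<lambda>\<omega>. \<lambda>t\<in>{0..}. X t \<omega>) -` A \<inter> space M | A. A \<in> sets (PiM {0..} (\<lambda>_. borel))}"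
    and g: "continuous_on UNIV g" "\<And>y. \<bar>g y\<bar> \<le> K"
  shows "(\<lambda>\<omega>. X (e \<omega>) \<omega>) \<in> borel_measurable M"
    "expectation (\<lambda>\<omega>. g (X (e \<omega>) \<omega>)) = expectation (\<lambda>\<omega>. (\<integral>\<omega>'. g (X (max 0 (e \<omega>)) \<omega>') \<partial>M))"
proof -
  have [measurable]: "g \<in> borel_measurable borel" using g(1) by (rule borel_measurable_continuous_onI)
  define k where "k t = expectation (\<lambda>\<omega>. g (X (max 0 t) \<omega>))" for t
  have kc: "continuous_on UNIV k" unfolding k_def using g by (rule expectation_path_continuous)
  then have [measurable]: "k \<in> borel_measurable borel" by (rule borel_measurable_continuous_onI)
  have Xm[measurable]: "X (real j / 2 ^ n) \<in> borel_measurable M" for j n by (rule X_measurable) simp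
  have k_grid: "k (real j / 2 ^ n) = expectation (\<lambda>\<omega>. g (X (real j / 2 ^ n) \<omega>))" for j n
    unfolding k_def by (simp add: max_def)
  have k_bd: "\<bar>k t\<bar> \<le> K" for t
    unfolding k_def by (rule expectation_X_bound; use g(2) in simp)
  define N where "N n \<omega> = nat \<lfloor>2 ^ n * e \<omega>\<rfloor>" for n \<omega>
  have Nm[measurable]: "N n \<in> M \<rightarrow>\<^sub>M count_space UNIV" for n
    unfolding N_def by measurable
  have XNm[measurable]: "(\<lambda>\<omega>. X (real (N n \<omega>) / 2 ^ n) \<omega>) \<in> borel_measurable M" for n
    by (rule measurable_compose_countable[where f="\<lambda>j \<omega>. X (real j / 2 ^ n) \<omega>" and g="N n"]) measurable
  have grid_lim: "(\<lambda>n. real (N n \<omega>) / 2 ^ n) \<longlonglongrightarrow> e \<omega>" if \<omega>: "\<omega> \<in> space M" for \<omega>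
  proof -
    have "real (N n \<omega>) = real_of_int \<lfloor>2 ^ n * e \<omega>\<rfloor>" for n
      unfolding N_def using e0[OF \<omega>] by simp
    then show ?thesis
      using dyadic_floor_tendsto[of "e \<omega>"] by simp
  qed
  have X_lim: "(\<lambda>n. X (real (N n \<omega>) / 2 ^ n) \<omega>) \<longlonglongrightarrow> X (e \<omega>) \<omega>" if \<omega>: "\<omega> \<in> space M" for \<omega>
    by (rule continuous_on_tendsto_compose[OF X_continuous[OF \<omega>] grid_lim[OF \<omega>]]) (use e0[OF \<omega>] in auto)
  show Xe[measurable]: "(\<lambda>\<omega>. X (e \<omega>) \<omega>) \<in> borel_measurable M"
    by (rule borel_measurable_LIMSEQ_real[OF X_lim XNm])
  have factor: "expectation (\<lambda>\<omega>. indicator {j} (N n \<omega>) * g (X (real j / 2 ^ n) \<omega>)) = expectation (\<lambda>\<omega>. indicator {j} (N n \<omega>) * k (real j / 2 ^ n))" for j n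
  proof -
    let ?\<G> = "vimage_algebra (space M) e borel"
    let ?s = "real j / 2 ^ n"
    have sets_G: "sets ?\<G> = {e -` A \<inter> space M | A. A \<in> sets borel}"
      by (rule sets_vimage_algebra2) simp
    have sub: "subalgebra M ?\<G>"
      unfolding subalgebra_def sets_G using measurable_sets[OF e] by auto
    have eG: "e \<in> borel_measurable ?\<G>"
      by (rule measurable_vimage_algebra1) simp
    have Z: "(\<lambda>\<omega>. indicat_real {j} (N n \<omega>)) \<in> borel_measurable ?\<G>"
      unfolding N_def using eG by measurable
    have ZM: "integrable M (\<lambda>\<omega>. indicat_real {j} (N n \<omega>))"
      by (rule integrable_const_bound[where B=1]) (auto simp: indicator_def)
    have gi: "integrable M (\<lambda>\<omega>. g (X ?s \<omega>))"
      using g(2) by (intro integrable_const_bound[where B=K]) auto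
    have "{(\<lambda>\<omega>. g (X ?s \<omega>)) -` A \<inter> space M | A. A \<in> sets borel}
        \<subseteq> {(\<lambda>\<omega>. \<lambda>t\<in>{0..}. X t \<omega>) -` A \<inter> space M | A. A \<in> sets (PiM {0..} (\<lambda>_. borel))}"
    proof safe
      fix A :: "real set" assume A: "A \<in> sets borel"
      let ?P = "PiM {0::real..} (\<lambda>_. borel :: real measure)"
      have "(\<lambda>w. g (w ?s)) \<in> borel_measurable ?P" by measurable
      from measurable_sets[OF this A]
      have "(\<lambda>w. g (w ?s)) -` A \<inter> space ?P \<in> sets ?P" .
      moreover have "(\<lambda>\<omega>. g (X ?s \<omega>)) -` A \<inter> space M
          = (\<lambda>\<omega>. \<lambda>t\<in>{0..}. X t \<omega>) -` ((\<lambda>w. g (w ?s)) -` A \<inter> space ?P) \<inter> space M"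
        by (auto simp: space_PiM)
      ultimately show "\<exists>A'. (\<lambda>\<omega>. g (X ?s \<omega>)) -` A \<inter> space M
          = (\<lambda>\<omega>. \<lambda>t\<in>{0..}. X t \<omega>) -` A' \<inter> space M \<and> A' \<in> sets ?P"
        by blast
    qed
    from indep_set_subset[OF indep this] have ind: "indep_set (sets ?\<G>) {(\<lambda>\<omega>. g (X ?s \<omega>)) -` A \<inter> space M | A. A \<in> sets borel}"
      unfolding sets_G .
    show ?thesis
      using indep_of_subalgebra_expectation_mult(2)[OF sub Z ZM gi ind] by (simp add: k_grid)
  qed
  have grid: "expectation (\<lambda>\<omega>. g (X (real (N n \<omega>) / 2 ^ n) \<omega>)) = expectation (\<lambda>\<omega>. k (real (N n \<omega>) / 2 ^ n))" for n
  proof -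
    have lim: "(\<lambda>m. expectation (\<lambda>\<omega>. \<Sum>j<m. indicator {j} (N n \<omega>) * u j \<omega>)) \<longlonglongrightarrow> expectation (\<lambda>\<omega>. u (N n \<omega>) \<omega>)"
      if u: "\<And>j. u j \<in> borel_measurable M" "\<And>j \<omega>. \<bar>u j \<omega>\<bar> \<le> K" for u :: "nat \<Rightarrow> 'a \<Rightarrow> real"
    proof -
      note [measurable] = u(1)
      have sum_eq: "(\<Sum>j<m. indicator {j} (N n \<omega>) * u j \<omega>) = (if N n \<omega> < m then u (N n \<omega>) \<omega> else 0)" for m \<omega>
        by (simp add: indicator_def if_distrib[of "\<lambda>z. z * _"] sum.delta' cong: if_cong)
      have [measurable]: "(\<lambda>\<omega>. u (N n \<omega>) \<omega>) \<in> borel_measurable M"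
        by (rule measurable_compose_countable[where f=u and g="N n"]) measurable
      show ?thesis
        unfolding sum_eq
      proof (rule integral_dominated_convergence[where w="\<lambda>_. K"])
        show "AE \<omega> in M. (\<lambda>m. if N n \<omega> < m then u (N n \<omega>) \<omega> else 0) \<longlonglongrightarrow> u (N n \<omega>) \<omega>"
        proof (rule AE_I2)
          fix \<omega>
          have "\<forall>\<^sub>F m in sequentially. (if N n \<omega> < m then u (N n \<omega>) \<omega> else 0) = u (N n \<omega>) \<omega>"
            using eventually_gt_at_top[of "N n \<omega>"] by eventually_elim simp
          then show "(\<lambda>m. if N n \<omega> < m then u (N n \<omega>) \<omega> else 0) \<longlonglongrightarrow> u (N n \<omega>) \<omega>"
            by (rule tendsto_eventually)
        qed
        show "AE \<omega> in M. norm (if N n \<omega> < m then u (N n \<omega>) \<omega> else 0) \<le> K" for m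
          using u(2) order_trans[OF abs_ge_zero u(2)] by (intro AE_I2) auto
      qed measurable
    qed
    have i1: "integrable M (\<lambda>\<omega>. indicator {j} (N n \<omega>) * g (X (real j / 2 ^ n) \<omega>))" for j
      using g(2) order_trans[OF abs_ge_zero g(2)] by (intro integrable_const_bound[where B=K]) (auto simp: indicator_def)
    have i2: "integrable M (\<lambda>\<omega>. indicator {j} (N n \<omega>) * k (real j / 2 ^ n))" for j
      using k_bd order_trans[OF abs_ge_zero k_bd] by (intro integrable_const_bound[where B=K]) (auto simp: indicator_def)
    have sums: "expectation (\<lambda>\<omega>. \<Sum>j<m. indicator {j} (N n \<omega>) * g (X (real j / 2 ^ n) \<omega>))
        = expectation (\<lambda>\<omega>. \<Sum>j<m. indicator {j} (N n \<omega>) * k (real j / 2 ^ n))" for m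
      by (simp only: Bochner_Integration.integral_sum[OF i1] Bochner_Integration.integral_sum[OF i2] factor)
    have l1: "(\<lambda>m. expectation (\<lambda>\<omega>. \<Sum>j<m. indicator {j} (N n \<omega>) * g (X (real j / 2 ^ n) \<omega>))) \<longlonglongrightarrow> expectation (\<lambda>\<omega>. g (X (real (N n \<omega>) / 2 ^ n) \<omega>))"
      by (rule lim) (use g(2) in auto)
    have l2: "(\<lambda>m. expectation (\<lambda>\<omega>. \<Sum>j<m. indicator {j} (N n \<omega>) * k (real j / 2 ^ n))) \<longlonglongrightarrow> expectation (\<lambda>\<omega>. k (real (N n \<omega>) / 2 ^ n))"
      by (rule lim) (use k_bd in auto)
    show ?thesis
      by (rule LIMSEQ_unique[OF l1[unfolded sums] l2])
  qed
  have "(\<lambda>n. expectation (\<lambda>\<omega>. g (X (real (N n \<omega>) / 2 ^ n) \<omega>))) \<longlonglongrightarrow> expectation (\<lambda>\<omega>. g (X (e \<omega>) \<omega>))"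
  proof (rule integral_dominated_convergence[where w="\<lambda>_. K"])
    show "AE \<omega> in M. (\<lambda>n. g (X (real (N n \<omega>) / 2 ^ n) \<omega>)) \<longlonglongrightarrow> g (X (e \<omega>) \<omega>)"
      by (intro AE_I2 continuous_on_tendsto_compose[OF g(1) X_lim]) auto
  qed (use g(2) in auto)
  moreover have "(\<lambda>n. expectation (\<lambda>\<omega>. k (real (N n \<omega>) / 2 ^ n))) \<longlonglongrightarrow> expectation (\<lambda>\<omega>. k (e \<omega>))"
  proof (rule integral_dominated_convergence[where w="\<lambda>_. K"])
    show "AE \<omega> in M. (\<lambda>n. k (real (N n \<omega>) / 2 ^ n)) \<longlonglongrightarrow> k (e \<omega>)"
      by (intro AE_I2 continuous_on_tendsto_compose[OF kc grid_lim]) auto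
  qed (use k_bd in auto)
  ultimately have "expectation (\<lambda>\<omega>. g (X (e \<omega>) \<omega>)) = expectation (\<lambda>\<omega>. k (e \<omega>))"
    unfolding grid by (rule LIMSEQ_unique)
  then show "expectation (\<lambda>\<omega>. g (X (e \<omega>) \<omega>)) = expectation (\<lambda>\<omega>. (\<integral>\<omega>'. g (X (max 0 (e \<omega>)) \<omega>') \<partial>M))"
    unfolding k_def .
qed

end

section \<open>Exponential solutions of the resolvent equation\<close>

text \<open>
  The solutions \<open>exp (- r y)\<close> of \<open>f'' / 2 + \<mu> f' = q f\<close> are those with \<open>r = root_lo \<mu> q\<close>, which grows to
  the right, and \<open>r = root_hi \<mu> q\<close>, which grows to the left.
\<close>

definition root_lo :: "real \<Rightarrow> real \<Rightarrow> real" where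
  "root_lo \<mu> q = \<mu> - sqrt (\<mu>\<^sup>2 + 2 * q)"

definition root_hi :: "real \<Rightarrow> real \<Rightarrow> real" where
  "root_hi \<mu> q = \<mu> + sqrt (\<mu>\<^sup>2 + 2 * q)"

lemma roots:
  assumes "0 < q"
  shows "root_lo \<mu> q < 0" "0 < root_hi \<mu> q" "root_lo \<mu> q * root_hi \<mu> q = - 2 * q" "root_lo \<mu> q + root_hi \<mu> q = 2 * \<mu>"
    "root_hi \<mu> q - root_lo \<mu> q = 2 * sqrt (\<mu>\<^sup>2 + 2 * q)"
proof -
  have "sqrt (\<mu>\<^sup>2) < sqrt (\<mu>\<^sup>2 + 2 * q)" using assms by (intro real_sqrt_less_mono) simp
  then have "\<bar>\<mu>\<bar> < sqrt (\<mu>\<^sup>2 + 2 * q)" by simp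
  then show "root_lo \<mu> q < 0" "0 < root_hi \<mu> q" unfolding root_lo_def root_hi_def by linarith+
  show "root_lo \<mu> q * root_hi \<mu> q = - 2 * q"
    using assms unfolding root_lo_def root_hi_def
    by (simp add: algebra_simps flip: power2_eq_square)
  show "root_lo \<mu> q + root_hi \<mu> q = 2 * \<mu>" "root_hi \<mu> q - root_lo \<mu> q = 2 * sqrt (\<mu>\<^sup>2 + 2 * q)"
    unfolding root_lo_def root_hi_def by simp_all
qed

text \<open>
  The factor \<open>c\<close> for which \<open>c * exp (\<i> \<theta> y)\<close> solves \<open>f'' / 2 + \<mu> f' = q (f - exp (\<i> \<theta> y))\<close>. It is the
  characteristic function at \<open>\<theta>\<close> of Brownian motion with drift \<open>\<mu>\<close>, started at \<open>0\<close> and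
  stopped at the exponential time.
\<close>

definition free_symbol :: "real \<Rightarrow> real \<Rightarrow> real \<Rightarrow> complex" where
  "free_symbol \<mu> q \<theta> = - 2 * q / ((root_lo \<mu> q + \<i> * \<theta>) * (root_hi \<mu> q + \<i> * \<theta>))"

text \<open>
  The value at \<open>0\<close> of the solution on the whole line, that is, the characteristic function when the
  process starts at \<open>0\<close>. Continuity and the transmission condition determine it
  (\<open>zero_symbol_flux\<close>).
\<close>

definition zero_symbol :: "real \<Rightarrow> real \<Rightarrow> real \<Rightarrow> real \<Rightarrow> real \<Rightarrow> complex" where
  "zero_symbol \<beta> \<mu>p \<mu>m q \<theta> = 2 * q / D_const \<beta> \<mu>p \<mu>m q *
     ((1 - \<beta>) / (root_hi \<mu>m q + \<i> * \<theta>) - (1 + \<beta>) / (root_lo \<mu>p q + \<i> * \<theta>))"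

lemma root_plus_imaginary_nonzero:
  fixes \<theta> :: real
  assumes "0 < q"
  shows "complex_of_real (root_lo \<mu> q) + \<i> * \<theta> \<noteq> 0" "complex_of_real (root_hi \<mu> q) + \<i> * \<theta> \<noteq> 0"
  using roots(1,2)[OF assms, of \<mu>] by (auto simp: complex_eq_iff)

lemma D_const_roots: "D_const \<beta> \<mu>p \<mu>m q = (1 + \<beta>) * root_hi \<mu>p q - (1 - \<beta>) * root_lo \<mu>m q"
  by (simp add: D_const_def root_hi_def root_lo_def algebra_simps)

lemma D_const_pos:
  assumes "- 1 < \<beta>" "\<beta> < 1" "0 < q"
  shows "0 < D_const \<beta> \<mu>p \<mu>m q"
  unfolding D_const_roots using assms roots(1)[of q \<mu>m] roots(2)[of q \<mu>p]
  by (smt (verit) mult_pos_pos mult_pos_neg)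

lemma free_symbol_ode:
  assumes "0 < q"
  shows "free_symbol \<mu> q \<theta> * ((\<i> * \<theta>)\<^sup>2 / 2 + \<mu> * (\<i> * \<theta>) - q) = - q"
proof -
  let ?a = "complex_of_real (root_lo \<mu> q)" and ?b = "complex_of_real (root_hi \<mu> q)"
  have sum: "?a + ?b = 2 * \<mu>" and prod: "?a * ?b = - 2 * q"
    using roots(3,4)[OF assms, of \<mu>] by (simp_all flip: of_real_add of_real_mult)
  have eq: "z\<^sup>2 / 2 + \<mu> * z - q = (?a + z) * (?b + z) / 2" for z :: complex
  proof -
    have expand: "(?a + z) * (?b + z) = ?a * ?b + (?a + ?b) * z + z\<^sup>2"
      by (simp add: algebra_simps power2_eq_square)
    show ?thesis
      unfolding expand sum prod by (simp add: field_simps)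
  qed
  show ?thesis
    unfolding eq free_symbol_def using root_plus_imaginary_nonzero[OF assms, of \<mu> \<theta>] by simp
qed

lemma zero_symbol_flux:
  assumes "- 1 < \<beta>" "\<beta> < 1" "0 < q"
  shows "(1 + \<beta>) * (free_symbol \<mu>p q \<theta> * (\<i> * \<theta>) + (zero_symbol \<beta> \<mu>p \<mu>m q \<theta> - free_symbol \<mu>p q \<theta>) * - root_hi \<mu>p q)
    = (1 - \<beta>) * (free_symbol \<mu>m q \<theta> * (\<i> * \<theta>) + (zero_symbol \<beta> \<mu>p \<mu>m q \<theta> - free_symbol \<mu>m q \<theta>) * - root_lo \<mu>m q)"
proof -
  let ?ap = "complex_of_real (root_lo \<mu>p q)" and ?bp = "complex_of_real (root_hi \<mu>p q)"
  let ?am = "complex_of_real (root_lo \<mu>m q)" and ?bm = "complex_of_real (root_hi \<mu>m q)"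
  let ?D = "complex_of_real (D_const \<beta> \<mu>p \<mu>m q)" and ?F = "zero_symbol \<beta> \<mu>p \<mu>m q \<theta>"
  have nz: "?ap + \<i> * \<theta> \<noteq> 0" "?bp + \<i> * \<theta> \<noteq> 0" "?am + \<i> * \<theta> \<noteq> 0" "?bm + \<i> * \<theta> \<noteq> 0"
    using root_plus_imaginary_nonzero[OF assms(3)] by auto
  have D: "?D = (1 + \<beta>) * ?bp - (1 - \<beta>) * ?am"
    by (simp add: D_const_roots)
  have D0: "?D \<noteq> 0" using D_const_pos[OF assms, of \<mu>p \<mu>m] by simp
  have cp: "free_symbol \<mu>p q \<theta> * (\<i> * \<theta> + ?bp) = - 2 * q / (?ap + \<i> * \<theta>)"
    unfolding free_symbol_def add.commute[of "\<i> * complex_of_real \<theta>"] using nz by simp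
  have cm: "free_symbol \<mu>m q \<theta> * (\<i> * \<theta> + ?am) = - 2 * q / (?bm + \<i> * \<theta>)"
    unfolding free_symbol_def add.commute[of "\<i> * complex_of_real \<theta>"] using nz by simp
  have F: "?D * ?F = 2 * q * ((1 - \<beta>) / (?bm + \<i> * \<theta>) - (1 + \<beta>) / (?ap + \<i> * \<theta>))"
    using D0 unfolding zero_symbol_def by simp
  have "(1 + \<beta>) * (free_symbol \<mu>p q \<theta> * (\<i> * \<theta>) + (?F - free_symbol \<mu>p q \<theta>) * - ?bp)
      - (1 - \<beta>) * (free_symbol \<mu>m q \<theta> * (\<i> * \<theta>) + (?F - free_symbol \<mu>m q \<theta>) * - ?am)
    = (1 + \<beta>) * (free_symbol \<mu>p q \<theta> * (\<i> * \<theta> + ?bp)) - (1 - \<beta>) * (free_symbol \<mu>m q \<theta> * (\<i> * \<theta> + ?am)) - ?D * ?F"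
    unfolding D by (simp add: algebra_simps)
  also have "\<dots> = 0"
    unfolding cp cm F by (simp add: algebra_simps)
  finally show ?thesis by simp
qed

text \<open>
  Differentiation only raises the exponent \<open>k\<close>. This gives the branches of the solution, their
  derivatives and the bounds on them in a single form.
\<close>

lemma Re_exp_sum_derivative:
  fixes A z C v :: complex
  defines "u \<equiv> \<lambda>k y. Re (A * z ^ k * exp (z * of_real y) + C * v ^ k * exp (v * of_real y))"
  shows "(u k has_real_derivative u (Suc k) y) (at y)"
    and "continuous_on UNIV (u k)"
proof -
  have D: "((\<lambda>y. a * w ^ k * exp (w * complex_of_real y)) has_vector_derivative a * w ^ Suc k * exp (w * of_real y)) (at y)" for a w y
  proof -
    have "((\<lambda>y. a * w ^ k * exp (w * y)) has_field_derivative a * w ^ Suc k * exp (w * of_real y)) (at (of_real y))"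
      by (auto intro!: derivative_eq_intros simp: algebra_simps)
    from has_vector_derivative_real_field[OF this] show ?thesis .
  qed
  have "(u k has_real_derivative u (Suc k) y) (at y)" for y
    unfolding u_def has_real_derivative_iff_has_vector_derivative
    using has_vector_derivative_add[OF D[of A z y] D[of C v y]] unfolding has_vector_derivative_complex_iff
    by (simp add: has_real_derivative_iff_has_vector_derivative)
  then show "(u k has_real_derivative u (Suc k) y) (at y)" "continuous_on UNIV (u k)"
    by (auto intro: DERIV_isCont continuous_at_imp_continuous_on)
qed

lemma Re_exp_sum_bound:
  fixes A z C v :: complex
  assumes "Re z * y \<le> 0" "Re v * y \<le> 0"
  shows "\<bar>Re (A * z ^ k * exp (z * of_real y) + C * v ^ k * exp (v * of_real y))\<bar> \<le> cmod A * cmod z ^ k + cmod C * cmod v ^ k"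
proof -
  have "\<bar>Re (A * z ^ k * exp (z * of_real y) + C * v ^ k * exp (v * of_real y))\<bar>
      \<le> cmod (A * z ^ k * exp (z * of_real y)) + cmod (C * v ^ k * exp (v * of_real y))"
    using abs_Re_le_cmod norm_triangle_ineq order_trans by blast
  also have "\<dots> \<le> cmod A * cmod z ^ k * 1 + cmod C * cmod v ^ k * 1"
    unfolding norm_mult norm_power using assms by (intro add_mono mult_left_mono) auto
  finally show ?thesis by simp
qed

context skew_brownian_motion_at_zero
begin

text \<open>
  The resolvent of \<open>exp (\<i> \<theta> y)\<close> at the starting point: on each half line the particular solution plus
  the multiple of the bounded homogeneous solution that gives the value \<open>zero_symbol\<close> at \<open>0\<close>.
\<close>

definition potential_symbol :: "real \<Rightarrow> real \<Rightarrow> complex" where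
  "potential_symbol q \<theta> =
    (if 0 \<le> x then free_symbol \<mu>p q \<theta> * exp (\<i> * \<theta> * x) + (zero_symbol \<beta> \<mu>p \<mu>m q \<theta> - free_symbol \<mu>p q \<theta>) * exp (- root_hi \<mu>p q * x)
     else free_symbol \<mu>m q \<theta> * exp (\<i> * \<theta> * x) + (zero_symbol \<beta> \<mu>p \<mu>m q \<theta> - free_symbol \<mu>m q \<theta>) * exp (- root_lo \<mu>m q * x))"

text \<open>
  The factor \<open>w\<close> makes real and imaginary parts instances of the same statement, so that
  the real Ito formula suffices.
\<close>

lemma potential_of_exponential:
  fixes w :: complex
  assumes q: "0 < q"
  shows "(\<integral>t. exponential_density q t * expectation (\<lambda>\<omega>. Re (w * exp (\<i> * \<theta> * X (max 0 t) \<omega>))) \<partial>lborel) = Re (w * potential_symbol q \<theta>)"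
proof -
  let ?cp = "free_symbol \<mu>p q \<theta>" and ?cm = "free_symbol \<mu>m q \<theta>" and ?F = "zero_symbol \<beta> \<mu>p \<mu>m q \<theta>"
  let ?bp = "root_hi \<mu>p q" and ?am = "root_lo \<mu>m q"
  let ?z = "\<i> * complex_of_real \<theta>" and ?vp = "complex_of_real (- ?bp)" and ?vm = "complex_of_real (- ?am)"
  define P where "P k y = Re (w * ?cp * ?z ^ k * exp (?z * of_real y) + w * (?F - ?cp) * ?vp ^ k * exp (?vp * of_real y))" for k y
  define Q where "Q k y = Re (w * ?cm * ?z ^ k * exp (?z * of_real y) + w * (?F - ?cm) * ?vm ^ k * exp (?vm * of_real y))" for k y
  define g where "g y = Re (w * exp (\<i> * \<theta> * of_real y))" for y
  define KP where "KP k = cmod (w * ?cp) * cmod ?z ^ k + cmod (w * (?F - ?cp)) * cmod ?vp ^ k" for k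
  define KQ where "KQ k = cmod (w * ?cm) * cmod ?z ^ k + cmod (w * (?F - ?cm)) * cmod ?vm ^ k" for k
  define K where "K = KP 0 + KP 1 + KP 2 + KQ 0 + KQ 1 + KQ 2 + cmod w"
  have KPQ: "0 \<le> KP k" "0 \<le> KQ k" for k by (simp_all add: KP_def KQ_def)
  have bp: "0 < ?bp" and am: "?am < 0" using roots[OF q] by auto
  have P_bd: "\<bar>P k y\<bar> \<le> KP k" if "0 \<le> y" for k y
    unfolding P_def KP_def by (rule Re_exp_sum_bound) (use that bp in auto)
  have Q_bd: "\<bar>Q k y\<bar> \<le> KQ k" if "y \<le> 0" for k y
    unfolding Q_def KQ_def by (rule Re_exp_sum_bound) (use that am in \<open>auto intro: mult_nonpos_nonpos\<close>)
  have quad: "(complex_of_real r)\<^sup>2 / 2 - \<mu> * r - q = 0" if "r = root_lo \<mu> q \<or> r = root_hi \<mu> q" for r \<mu>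
  proof -
    have "r\<^sup>2 / 2 - \<mu> * r - q = 0"
      using that roots(3,4)[OF q, of \<mu>] by (auto simp: power2_eq_square) (algebra+)
    then have "complex_of_real (r\<^sup>2 / 2 - \<mu> * r - q) = 0" by simp
    then show ?thesis by simp
  qed
  have ode: "Re (w * c * ?z ^ 2 * e1 + w * d * (- complex_of_real r) ^ 2 * e2) / 2 + \<mu> * Re (w * c * ?z ^ 1 * e1 + w * d * (- complex_of_real r) ^ 1 * e2)
      = q * (Re (w * c * ?z ^ 0 * e1 + w * d * (- complex_of_real r) ^ 0 * e2) - Re (w * e1))"
    if c: "c * (?z\<^sup>2 / 2 + \<mu> * ?z - q) = - q" and r: "r = root_lo \<mu> q \<or> r = root_hi \<mu> q" for c d e1 e2 :: complex and r \<mu> :: real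
  proof -
    have alg: "(w * c * z ^ 2 * e1 + w * d * v ^ 2 * e2) / 2 + n * (w * c * z ^ 1 * e1 + w * d * v ^ 1 * e2)
        - Q * ((w * c * z ^ 0 * e1 + w * d * v ^ 0 * e2) - w * e1)
      = w * e1 * (c * (z\<^sup>2 / 2 + n * z - Q)) + w * e1 * Q + w * d * e2 * (v\<^sup>2 / 2 + n * v - Q)" for z v n Q :: complex
      by (simp add: field_simps)
    have "(w * c * ?z ^ 2 * e1 + w * d * (- complex_of_real r) ^ 2 * e2) / 2
        + \<mu> * (w * c * ?z ^ 1 * e1 + w * d * (- complex_of_real r) ^ 1 * e2)
        - q * ((w * c * ?z ^ 0 * e1 + w * d * (- complex_of_real r) ^ 0 * e2) - w * e1)
      = w * e1 * (c * (?z\<^sup>2 / 2 + \<mu> * ?z - q)) + w * e1 * q + w * d * e2 * ((- complex_of_real r)\<^sup>2 / 2 + \<mu> * (- complex_of_real r) - q)"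
      by (rule alg)
    also have "\<dots> = 0" unfolding c using quad[OF r] by simp
    finally have zero: "(w * c * ?z ^ 2 * e1 + w * d * (- complex_of_real r) ^ 2 * e2) / 2
        + \<mu> * (w * c * ?z ^ 1 * e1 + w * d * (- complex_of_real r) ^ 1 * e2)
        - q * ((w * c * ?z ^ 0 * e1 + w * d * (- complex_of_real r) ^ 0 * e2) - w * e1) = 0" .
    have Re_lin: "Re (A2 / 2 + \<mu> * A1 - q * (A0 - W)) = Re A2 / 2 + \<mu> * Re A1 - q * (Re A0 - Re W)" for A2 A1 A0 W :: complex
      by simp
    show ?thesis
      using arg_cong[OF zero, of Re] unfolding Re_lin by (simp only: zero_complex.sel)
  qed
  have "(\<integral>t. exponential_density q t * expectation (\<lambda>\<omega>. g (X (max 0 t) \<omega>)) \<partial>lborel) = (if 0 \<le> x then P 0 x else Q 0 x)"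
  proof (rule resolvent_potential[where p="P 0" and p'="P 1" and p''="P 2" and m="Q 0" and m'="Q 1" and m''="Q 2" and K=K, OF q])
    show "(P 0 has_real_derivative P 1 y) (at y)" "(P 1 has_real_derivative P 2 y) (at y)" "continuous_on UNIV (P 2)"
      "(Q 0 has_real_derivative Q 1 y) (at y)" "(Q 1 has_real_derivative Q 2 y) (at y)" "continuous_on UNIV (Q 2)" for y
      unfolding P_def[abs_def] Q_def[abs_def] using Re_exp_sum_derivative[where k=0] Re_exp_sum_derivative[where k=1] Re_exp_sum_derivative(2)[where k=2]
      by (simp_all only: One_nat_def numeral_2_eq_2)
    show "\<bar>P 0 y\<bar> \<le> K \<and> \<bar>P 1 y\<bar> \<le> K \<and> \<bar>P 2 y\<bar> \<le> K" if "0 \<le> y" for y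
      using P_bd[OF that, of 0] P_bd[OF that, of 1] P_bd[OF that, of 2] KPQ[of 0] KPQ[of 1] KPQ[of 2] norm_ge_zero[of w]
      unfolding K_def by linarith
    show "\<bar>Q 0 y\<bar> \<le> K \<and> \<bar>Q 1 y\<bar> \<le> K \<and> \<bar>Q 2 y\<bar> \<le> K" if "y \<le> 0" for y
      using Q_bd[OF that, of 0] Q_bd[OF that, of 1] Q_bd[OF that, of 2] KPQ[of 0] KPQ[of 1] KPQ[of 2] norm_ge_zero[of w]
      unfolding K_def by linarith
    show "P 0 0 = Q 0 0"
      by (simp add: P_def Q_def algebra_simps)
    have Re_scale: "Re (complex_of_real r * z) = r * Re z" for r z by simp
    have "complex_of_real (1 + \<beta>) * (w * ?cp * ?z ^ 1 + w * (?F - ?cp) * ?vp ^ 1) = complex_of_real (1 - \<beta>) * (w * ?cm * ?z ^ 1 + w * (?F - ?cm) * ?vm ^ 1)"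
      using arg_cong[OF zero_symbol_flux[OF \<beta>_bounds q, of \<mu>p \<theta> \<mu>m], of "\<lambda>c. w * c"] by (simp add: algebra_simps)
    from arg_cong[OF this, of Re] show "(1 + \<beta>) * P 1 0 = (1 - \<beta>) * Q 1 0"
      unfolding P_def Q_def Re_scale by simp
    show "continuous_on UNIV g"
      unfolding g_def by (intro continuous_intros)
    show "\<bar>g y\<bar> \<le> K" for y
    proof -
      have "\<bar>g y\<bar> \<le> cmod w"
        unfolding g_def using abs_Re_le_cmod[of "w * exp (\<i> * \<theta> * of_real y)"] by (simp add: norm_mult)
      then show ?thesis using KPQ[of 0] KPQ[of 1] KPQ[of 2] unfolding K_def by linarith
    qed
    show "P 2 y / 2 + \<mu>p * P 1 y = q * (P 0 y - g y)" for y
      unfolding P_def g_def of_real_minus by (rule ode) (simp_all add: free_symbol_ode[OF q])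
    show "Q 2 y / 2 + \<mu>m * Q 1 y = q * (Q 0 y - g y)" for y
      unfolding Q_def g_def of_real_minus by (rule ode) (simp_all add: free_symbol_ode[OF q])
  qed
  also have "\<dots> = Re (w * potential_symbol q \<theta>)"
    by (simp add: P_def Q_def potential_symbol_def algebra_simps flip: exp_of_real)
  finally show ?thesis unfolding g_def .
qed

end

section \<open>The density and its Fourier transform\<close>

lemma has_bochner_integral_exp_upper:
  fixes z :: complex and a :: real
  assumes z: "Re z < 0"
  shows "has_bochner_integral lborel (\<lambda>y. indicator {a<..} y *\<^sub>R exp (z * of_real y)) (- exp (z * of_real a) / z)"
proof -
  have z0: "z \<noteq> 0" using z by auto
  have "(\<integral>\<^sup>+y. ennreal (exp (Re z * y)) * indicator {a..} y \<partial>lborel) = ennreal (0 - exp (Re z * a) / Re z)"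
  proof (rule nn_integral_FTC_atLeast)
    show "DERIV (\<lambda>y. exp (Re z * y) / Re z) y :> exp (Re z * y)" for y
      using z by (auto intro!: derivative_eq_intros)
    show "((\<lambda>y. exp (Re z * y) / Re z) \<longlongrightarrow> 0) at_top"
      using z by real_asymp
  qed auto
  then have fin: "(\<integral>\<^sup>+y. ennreal (exp (Re z * y)) * indicator {a..} y \<partial>lborel) < \<infinity>" by simp
  have int: "integrable lborel (\<lambda>y. indicat_real {a<..} y *\<^sub>R exp (z * of_real y))"
  proof (rule integrableI_bounded)
    have "(\<integral>\<^sup>+y. ennreal (norm (indicat_real {a<..} y *\<^sub>R exp (z * of_real y))) \<partial>lborel)
        \<le> (\<integral>\<^sup>+y. ennreal (exp (Re z * y)) * indicator {a..} y \<partial>lborel)"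
      by (intro nn_integral_mono) (auto simp: indicator_def)
    with fin show "(\<integral>\<^sup>+y. ennreal (norm (indicat_real {a<..} y *\<^sub>R exp (z * of_real y))) \<partial>lborel) < \<infinity>"
      by (rule le_less_trans[rotated])
  qed measurable
  have "(LBINT y=ereal a..\<infinity>. exp (z * of_real y)) = 0 - exp (z * of_real a) / z"
  proof (rule interval_integral_FTC_integrable)
    show "((\<lambda>y. exp (z * of_real y) / z) has_vector_derivative exp (z * of_real y)) (at y)" for y
    proof -
      have "((\<lambda>y. exp (z * y) / z) has_field_derivative exp (z * of_real y)) (at (of_real y))"
        using z0 by (auto intro!: derivative_eq_intros)
      from has_vector_derivative_real_field[OF this] show ?thesis .
    qed
    show "isCont (\<lambda>y. exp (z * complex_of_real y)) y" for y
      by (intro continuous_intros)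
    show "set_integrable lborel (einterval (ereal a) \<infinity>) (\<lambda>y. exp (z * complex_of_real y))"
      using int by (simp add: set_integrable_def)
    show "(((\<lambda>y. exp (z * complex_of_real y) / z) \<circ> real_of_ereal) \<longlongrightarrow> exp (z * of_real a) / z) (at_right (ereal a))"
      unfolding ereal_tendsto_simps using z0 by (intro tendsto_intros) auto
    show "(((\<lambda>y. exp (z * complex_of_real y) / z) \<circ> real_of_ereal) \<longlongrightarrow> 0) (at_left \<infinity>)"
      unfolding ereal_tendsto_simps
    proof (rule tendsto_norm_zero_cancel)
      have "((\<lambda>y. exp (Re z * y) / cmod z) \<longlongrightarrow> 0) at_top"
        using z z0 by (intro tendsto_divide_zero) real_asymp
      then show "((\<lambda>y. norm (exp (z * complex_of_real y) / z)) \<longlongrightarrow> 0) at_top"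
        by (simp add: norm_divide)
    qed
  qed simp
  then have "(LINT y|lborel. indicat_real {a<..} y *\<^sub>R exp (z * of_real y)) = - exp (z * of_real a) / z"
    by (simp add: interval_lebesgue_integral_def set_lebesgue_integral_def)
  with int show ?thesis
    by (simp add: has_bochner_integral_iff)
qed

lemma has_bochner_integral_exp_lower:
  fixes z :: complex and a :: real
  assumes z: "0 < Re z"
  shows "has_bochner_integral lborel (\<lambda>y. indicator {..<a} y *\<^sub>R exp (z * of_real y)) (exp (z * of_real a) / z)"
proof -
  have "has_bochner_integral lborel (\<lambda>y. indicator {- a<..} y *\<^sub>R exp (- z * of_real y)) (- exp (- z * of_real (- a)) / - z)"
    using z by (intro has_bochner_integral_exp_upper) simp
  then have "has_bochner_integral lborel (\<lambda>y. indicat_real {- a<..} (0 + - 1 * y) *\<^sub>R exp (- z * of_real (0 + - 1 * y))) ((- exp (- z * of_real (- a)) / - z) /\<^sub>R \<bar>- 1\<bar>)"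
    by (subst (asm) lborel_has_bochner_integral_real_affine_iff[where c="- 1" and t=0]) auto
  moreover have "indicat_real {- a<..} (0 + - 1 * y) = indicator {..<a} y" for y
    by (auto simp: indicator_def)
  ultimately show ?thesis by simp
qed

text \<open>
  That \<open>p\<close> has total mass one is the case \<open>\<theta> = 0\<close> of the hypothesis.
\<close>

lemma (in prob_space) distributed_by_characteristic_function:
  fixes Y :: "'a \<Rightarrow> real" and p :: "real \<Rightarrow> real"
  assumes Y[measurable]: "Y \<in> borel_measurable M" and p[measurable]: "p \<in> borel_measurable borel" and p0: "\<And>y. 0 \<le> p y"
    and char: "\<And>\<theta>. has_bochner_integral lborel (\<lambda>y. p y *\<^sub>R iexp (\<theta> * y)) (\<integral>\<omega>. iexp (\<theta> * Y \<omega>) \<partial>M)"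
  shows "distributed M lborel Y (\<lambda>y. ennreal (p y))"
proof -
  let ?N = "density lborel (\<lambda>y. ennreal (p y))"
  have "has_bochner_integral lborel (\<lambda>y. complex_of_real (p y)) 1"
    using char[of 0] by (simp add: scaleR_conv_of_real prob_space)
  from has_bochner_integral_bounded_linear[OF bounded_linear_Re this]
  have p1: "has_bochner_integral lborel p 1" by simp
  have "prob_space ?N"
  proof (rule prob_spaceI)
    have "(\<integral>\<^sup>+y. ennreal (p y) \<partial>lborel) = 1"
      using p1 p0 by (simp add: has_bochner_integral_iff nn_integral_eq_integral)
    then show "emeasure ?N (space ?N) = 1"
      by (simp add: emeasure_density)
  qed
  then have "real_distribution ?N"
    unfolding real_distribution_def real_distribution_axioms_def by simp
  moreover have "real_distribution (distr M borel Y)"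
    by (rule real_distribution_distr) simp
  moreover have "Characteristic_Functions.char (distr M borel Y) = Characteristic_Functions.char ?N"
  proof
    fix \<theta>
    have "Characteristic_Functions.char (distr M borel Y) \<theta> = (\<integral>\<omega>. iexp (\<theta> * Y \<omega>) \<partial>M)"
      unfolding char_def by (subst integral_distr) auto
    also have "\<dots> = (\<integral>y. p y *\<^sub>R iexp (\<theta> * y) \<partial>lborel)"
      using char[of \<theta>] by (simp add: has_bochner_integral_iff)
    also have "\<dots> = Characteristic_Functions.char ?N \<theta>"
      unfolding char_def using p0 by (subst integral_density) auto
    finally show "Characteristic_Functions.char (distr M borel Y) \<theta> = Characteristic_Functions.char ?N \<theta>" .
  qed
  ultimately have "distr M borel Y = ?N"
    by (intro Levy_uniqueness)
  moreover have "distr M lborel Y = distr M borel Y"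
    by (rule distr_cong) auto
  ultimately show ?thesis
    unfolding distributed_def by simp
qed

lemma free_symbol_partial_fractions:
  fixes \<theta> :: real
  assumes "0 < q"
  shows "free_symbol \<mu> q \<theta> = q / sqrt (\<mu>\<^sup>2 + 2 * q) * (1 / (root_hi \<mu> q + \<i> * \<theta>) - 1 / (root_lo \<mu> q + \<i> * \<theta>))"
proof -
  let ?a = "complex_of_real (root_lo \<mu> q) + \<i> * \<theta>" and ?b = "complex_of_real (root_hi \<mu> q) + \<i> * \<theta>"
  let ?s = "complex_of_real (sqrt (\<mu>\<^sup>2 + 2 * q))"
  have nz: "?a \<noteq> 0" "?b \<noteq> 0" using root_plus_imaginary_nonzero[OF assms] by auto
  have "0 < sqrt (\<mu>\<^sup>2 + 2 * q)" using assms by (simp add: add_nonneg_pos)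
  then have s: "?s \<noteq> 0" by simp
  have "?b - ?a = 2 * ?s"
    using arg_cong[OF roots(5)[OF assms, of \<mu>], of complex_of_real] by simp
  then have "?a - ?b = - (2 * ?s)"
    by (metis minus_diff_eq)
  moreover have "1 / ?b - 1 / ?a = (?a - ?b) / (?a * ?b)"
    using nz by (simp add: divide_simps)
  ultimately have "1 / ?b - 1 / ?a = - (2 * ?s) / (?a * ?b)"
    by (simp only:)
  then show ?thesis
    unfolding free_symbol_def using s by simp
qed

definition potential_density_right :: "real \<Rightarrow> real \<Rightarrow> real \<Rightarrow> real \<Rightarrow> real \<Rightarrow> real \<Rightarrow> real" where
  "potential_density_right \<beta> \<mu>p \<mu>m q x y = (
        if 0 < y then
          q * exp (\<mu>p * (y - x)) / sqrt (\<mu>p\<^sup>2 + 2 * q)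
            * (exp (- \<bar>y - x\<bar> * sqrt (\<mu>p\<^sup>2 + 2 * q)) - exp (- (x + y) * sqrt (\<mu>p\<^sup>2 + 2 * q)))
          + 2 * (1 + \<beta>) * q / D_const \<beta> \<mu>p \<mu>m q
            * exp (\<mu>p * (y - x) - (x + y) * sqrt (\<mu>p\<^sup>2 + 2 * q))
        else if y < 0 then
          2 * (1 - \<beta>) * q / D_const \<beta> \<mu>p \<mu>m q
            * exp ((- \<mu>p - sqrt (\<mu>p\<^sup>2 + 2 * q)) * x) * exp ((\<mu>m + sqrt (\<mu>m\<^sup>2 + 2 * q)) * y)
        else 0)"

definition potential_density_left :: "real \<Rightarrow> real \<Rightarrow> real \<Rightarrow> real \<Rightarrow> real \<Rightarrow> real \<Rightarrow> real" where
  "potential_density_left \<beta> \<mu>p \<mu>m q x y = (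
        if 0 < y then
          2 * (1 + \<beta>) * q / D_const \<beta> \<mu>p \<mu>m q
            * exp ((- \<mu>m + sqrt (\<mu>m\<^sup>2 + 2 * q)) * x) * exp ((\<mu>p - sqrt (\<mu>p\<^sup>2 + 2 * q)) * y)
        else if y < 0 then
          q * exp (\<mu>m * (y - x)) / sqrt (\<mu>m\<^sup>2 + 2 * q)
            * (exp (- \<bar>y - x\<bar> * sqrt (\<mu>m\<^sup>2 + 2 * q)) - exp ((x + y) * sqrt (\<mu>m\<^sup>2 + 2 * q)))
          + 2 * (1 - \<beta>) * q / D_const \<beta> \<mu>p \<mu>m q
            * exp (\<mu>m * (y - x) + (x + y) * sqrt (\<mu>m\<^sup>2 + 2 * q))
        else 0)"

text \<open>
  The map \<open>y \<mapsto> - y\<close> sends the process to one with parameters \<open>- \<beta>\<close>, \<open>- \<mu>m\<close>, \<open>- \<mu>p\<close>. Only the formula on the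
  right half line thus has to be integrated.
\<close>

lemma potential_density_left_reflect:
  "potential_density_left \<beta> \<mu>p \<mu>m q x y = potential_density_right (- \<beta>) (- \<mu>m) (- \<mu>p) q (- x) (- y)"
proof -
  have "D_const (- \<beta>) (- \<mu>m) (- \<mu>p) q = D_const \<beta> \<mu>p \<mu>m q"
    by (simp add: D_const_def)
  then show ?thesis
    unfolding potential_density_left_def potential_density_right_def
    by (simp add: abs_minus_commute algebra_simps)
qed

lemma potential_density_right_nonneg:
  assumes "- 1 < \<beta>" "\<beta> < 1" "0 < q" "0 \<le> x"
  shows "0 \<le> potential_density_right \<beta> \<mu>p \<mu>m q x y"
proof -
  note D = D_const_pos[OF assms(1-3), of \<mu>p \<mu>m]
  have s: "0 < sqrt (\<mu>\<^sup>2 + 2 * q)" for \<mu>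
    using assms by (simp add: add_nonneg_pos)
  have "exp (- (x + y) * sqrt (\<mu>p\<^sup>2 + 2 * q)) \<le> exp (- \<bar>y - x\<bar> * sqrt (\<mu>p\<^sup>2 + 2 * q))" if "0 < y"
    unfolding exp_le_cancel_iff using \<open>0 \<le> x\<close> that s[of \<mu>p] by (intro mult_right_mono) auto
  then show ?thesis
    using assms D s[of \<mu>p] s[of \<mu>m] unfolding potential_density_right_def
    by (auto intro!: add_nonneg_nonneg mult_nonneg_nonneg divide_nonneg_nonneg)
qed

lemma potential_density_measurable [measurable]:
  "potential_density_right \<beta> \<mu>p \<mu>m q x \<in> borel_measurable borel"
  "potential_density_left \<beta> \<mu>p \<mu>m q x \<in> borel_measurable borel"
  unfolding potential_density_right_def[abs_def] potential_density_left_def[abs_def] by measurable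

text \<open>
  A combination of exponentials on half lines. The part of the line between \<open>0\<close> and \<open>x\<close> is the
  difference of two half lines on which \<open>exp (b * y)\<close> is integrable.
\<close>

lemma potential_density_right_eq:
  fixes \<beta> \<mu>p \<mu>m q x y :: real
  assumes x: "0 \<le> x" and y: "y \<noteq> 0" "y \<noteq> x"
  defines "a \<equiv> root_lo \<mu>p q" and "b \<equiv> root_hi \<mu>p q" and "r \<equiv> q / sqrt (\<mu>p\<^sup>2 + 2 * q)"
    and "D \<equiv> D_const \<beta> \<mu>p \<mu>m q"
  shows "potential_density_right \<beta> \<mu>p \<mu>m q x y =
      r * exp (- a * x) * (indicator {x<..} y * exp (a * y))
    + r * exp (- b * x) * (indicator {..<x} y * exp (b * y))
    - r * exp (- b * x) * (indicator {..<0} y * exp (b * y))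
    + (2 * (1 + \<beta>) * q / D - r) * exp (- b * x) * (indicator {0<..} y * exp (a * y))
    + 2 * (1 - \<beta>) * q / D * exp (- b * x) * (indicator {..<0} y * exp (root_hi \<mu>m q * y))"
proof -
  let ?s = "sqrt (\<mu>p\<^sup>2 + 2 * q)"
  have far: "exp (\<mu>p * (y - x)) * exp (- (x + y) * ?s) = exp (- b * x) * exp (a * y)"
    "exp (\<mu>p * (y - x) - (x + y) * ?s) = exp (- b * x) * exp (a * y)"
    unfolding a_def b_def root_lo_def root_hi_def by (simp_all add: algebra_simps flip: exp_add)
  have above: "exp (\<mu>p * (y - x)) * exp (- \<bar>y - x\<bar> * ?s) = exp (- a * x) * exp (a * y)" if "x < y"
    using that unfolding a_def root_lo_def by (simp add: algebra_simps flip: exp_add)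
  have below: "exp (\<mu>p * (y - x)) * exp (- \<bar>y - x\<bar> * ?s) = exp (- b * x) * exp (b * y)" if "y < x"
    using that unfolding b_def root_hi_def by (simp add: algebra_simps flip: exp_add)
  have pos: "potential_density_right \<beta> \<mu>p \<mu>m q x y
      = r * (exp (\<mu>p * (y - x)) * exp (- \<bar>y - x\<bar> * ?s)) + (2 * (1 + \<beta>) * q / D - r) * exp (- b * x) * exp (a * y)" if "0 < y"
  proof -
    have "potential_density_right \<beta> \<mu>p \<mu>m q x y
      = r * (exp (\<mu>p * (y - x)) * exp (- \<bar>y - x\<bar> * ?s))
        - r * (exp (\<mu>p * (y - x)) * exp (- (x + y) * ?s))
        + 2 * (1 + \<beta>) * q / D * exp (\<mu>p * (y - x) - (x + y) * ?s)"
      using that unfolding potential_density_right_def r_def D_def by (simp add: algebra_simps)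
    then show ?thesis
      unfolding far by (simp add: algebra_simps)
  qed
  consider "y < 0" | "0 < y" "y < x" | "0 < y" "x < y" using y by linarith
  then show ?thesis
  proof cases
    case 1
    then show ?thesis
      using x unfolding potential_density_right_def D_def b_def root_hi_def by (simp add: indicator_def algebra_simps)
  next
    case 2
    then show ?thesis
      using x unfolding pos[OF 2(1)] below[OF 2(2)] by (simp add: indicator_def algebra_simps)
  next
    case 3
    then show ?thesis
      using x unfolding pos[OF 3(1)] above[OF 3(2)] by (simp add: indicator_def algebra_simps)
  qed
qed

lemma exp_real_iexp: "complex_of_real (i * exp (c * y)) * iexp (\<theta> * y) = i *\<^sub>R exp ((complex_of_real c + \<i> * \<theta>) * of_real y)"
proof -
  have "(complex_of_real c + \<i> * \<theta>) * of_real y = of_real (c * y) + \<i> * of_real (\<theta> * y)"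
    by (simp add: algebra_simps)
  then have "exp ((complex_of_real c + \<i> * \<theta>) * of_real y) = of_real (exp (c * y)) * iexp (\<theta> * y)"
    by (simp only: exp_add exp_of_real)
  then show ?thesis
    by (simp add: scaleR_conv_of_real)
qed

text \<open>
  The two terms with weight \<open>A\<close> and \<open>B\<close> and endpoint \<open>x\<close> combine by partial fractions into the free symbol; the
  terms with endpoint \<open>0\<close> carry the factor \<open>exp (- root_hi \<mu>p q * x)\<close>, the Laplace transform of the
  time at which the process first reaches \<open>0\<close>.
\<close>

lemma potential_density_right_characteristic:
  fixes \<beta> \<mu>p \<mu>m q x \<theta> :: real
  assumes q: "0 < q" and x: "0 \<le> x"
  shows "has_bochner_integral lborel (\<lambda>y. potential_density_right \<beta> \<mu>p \<mu>m q x y *\<^sub>R iexp (\<theta> * y))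
    (free_symbol \<mu>p q \<theta> * exp (\<i> * \<theta> * x) + (zero_symbol \<beta> \<mu>p \<mu>m q \<theta> - free_symbol \<mu>p q \<theta>) * exp (- root_hi \<mu>p q * x))"
proof -
  let ?a = "root_lo \<mu>p q" and ?b = "root_hi \<mu>p q" and ?c = "root_hi \<mu>m q" and ?r = "q / sqrt (\<mu>p\<^sup>2 + 2 * q)"
  let ?D = "D_const \<beta> \<mu>p \<mu>m q"
  define za zb zc where "za = complex_of_real ?a + \<i> * \<theta>" "zb = complex_of_real ?b + \<i> * \<theta>" "zc = complex_of_real ?c + \<i> * \<theta>"
  note z_def = this
  have Re: "Re za < 0" "0 < Re zb" "0 < Re zc"
    using roots(1,2)[OF q] by (simp_all add: z_def)
  define A B P Q where "A = ?r * exp (- ?a * x)" "B = ?r * exp (- ?b * x)"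
    "P = (2 * (1 + \<beta>) * q / ?D - ?r) * exp (- ?b * x)" "Q = 2 * (1 - \<beta>) * q / ?D * exp (- ?b * x)"
  note c_def = this
  let ?sum = "\<lambda>y. complex_of_real A * (indicator {x<..} y *\<^sub>R exp (za * of_real y))
      + complex_of_real B * (indicator {..<x} y *\<^sub>R exp (zb * of_real y))
      - complex_of_real B * (indicator {..<0} y *\<^sub>R exp (zb * of_real y))
      + complex_of_real P * (indicator {0<..} y *\<^sub>R exp (za * of_real y))
      + complex_of_real Q * (indicator {..<0} y *\<^sub>R exp (zc * of_real y))"
  let ?val = "A * (- exp (za * of_real x) / za) + B * (exp (zb * of_real x) / zb) - B * (exp (zb * of_real 0) / zb)
      + P * (- exp (za * of_real 0) / za) + Q * (exp (zc * of_real 0) / zc)"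
  have int: "has_bochner_integral lborel ?sum
    ?val"
    using Re by (intro has_bochner_integral_add has_bochner_integral_diff has_bochner_integral_mult_right
        has_bochner_integral_exp_upper has_bochner_integral_exp_lower)
  define R where "R = complex_of_real q / complex_of_real (sqrt (\<mu>p\<^sup>2 + 2 * q))"
  define E where "E = complex_of_real (exp (- ?b * x))"
  define I where "I = exp (\<i> * \<theta> * x)"
  define S1 S2 where "S1 = complex_of_real (2 * (1 + \<beta>) * q / ?D)" "S2 = complex_of_real (2 * (1 - \<beta>) * q / ?D)"
  note S_def = this
  have cancel: "complex_of_real A * exp (za * of_real x) = R * I" "complex_of_real B * exp (zb * of_real x) = R * I"
    unfolding c_def z_def R_def I_def by (simp_all add: distrib_right flip: exp_of_real exp_add)
  have coeff: "complex_of_real B = R * E" "complex_of_real P = (S1 - R) * E" "complex_of_real Q = S2 * E"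
    unfolding c_def R_def E_def S_def by simp_all
  have collect: "- (R * I) * u + (R * I) * v - R * E * v - (S1 - R) * E * u + S2 * E * w
      = R * (v - u) * I + (S2 * w - S1 * u - R * (v - u)) * E" for u v w :: complex
    by (simp add: algebra_simps)
  have separate: "n * (u / w - v / z) = n * u * (1 / w) - n * v * (1 / z)" for n u v w z :: complex
    by (simp add: right_diff_distrib)
  have S_factor: "S1 = complex_of_real (2 * q / ?D) * complex_of_real (1 + \<beta>)" "S2 = complex_of_real (2 * q / ?D) * complex_of_real (1 - \<beta>)"
    unfolding S_def of_real_mult[symmetric] by simp_all
  have val: "?val
    = free_symbol \<mu>p q \<theta> * exp (\<i> * \<theta> * x) + (zero_symbol \<beta> \<mu>p \<mu>m q \<theta> - free_symbol \<mu>p q \<theta>) * exp (- ?b * x)"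
  proof -
    have "?val
      = - (A * exp (za * of_real x)) * (1 / za) + (B * exp (zb * of_real x)) * (1 / zb) - B * (1 / zb) - P * (1 / za) + Q * (1 / zc)"
      by simp
    also have "\<dots> = - (R * I) * (1 / za) + (R * I) * (1 / zb) - R * E * (1 / zb) - (S1 - R) * E * (1 / za) + S2 * E * (1 / zc)"
      unfolding cancel unfolding coeff by (rule refl)
    also have "\<dots> = R * (1 / zb - 1 / za) * I + (S2 * (1 / zc) - S1 * (1 / za) - R * (1 / zb - 1 / za)) * E"
      by (rule collect)
    also have "S2 * (1 / zc) - S1 * (1 / za) = zero_symbol \<beta> \<mu>p \<mu>m q \<theta>"
      unfolding zero_symbol_def z_def[symmetric] separate S_factor by simp
    also have "R * (1 / zb - 1 / za) = free_symbol \<mu>p q \<theta>"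
      unfolding free_symbol_partial_fractions[OF q, of \<mu>p] z_def R_def by simp
    finally show ?thesis
      unfolding E_def I_def .
  qed
  show ?thesis
  proof (rule has_bochner_integral_cong_AE[THEN iffD2, OF _ _ _ int[unfolded val]])
    show "AE y in lborel. potential_density_right \<beta> \<mu>p \<mu>m q x y *\<^sub>R iexp (\<theta> * y) =
      ?sum y"
      using AE_lborel_singleton[of 0] AE_lborel_singleton[of x]
    proof eventually_elim
      case (elim y)
      show ?case
        unfolding potential_density_right_eq[OF x elim(1) elim(2)] scaleR_conv_of_real[of "_ + _"] c_def[symmetric] z_def
        unfolding exp_real_iexp[symmetric] by (simp add: algebra_simps)
    qed
  qed measurable
qed

lemma symbol_reflect:
  fixes \<theta> :: real
  shows "root_lo (- \<mu>) q = - root_hi \<mu> q" "root_hi (- \<mu>) q = - root_lo \<mu> q"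
    "free_symbol (- \<mu>) q (- \<theta>) = free_symbol \<mu> q \<theta>"
    "zero_symbol (- \<beta>) (- \<mu>m) (- \<mu>p) q (- \<theta>) = zero_symbol \<beta> \<mu>p \<mu>m q \<theta>"
proof -
  show root: "root_lo (- \<mu>) q = - root_hi \<mu> q" "root_hi (- \<mu>) q = - root_lo \<mu> q" for \<mu>
    by (simp_all add: root_lo_def root_hi_def)
  show "free_symbol (- \<mu>) q (- \<theta>) = free_symbol \<mu> q \<theta>"
    unfolding free_symbol_def root by (simp add: algebra_simps)
  have neg: "v / (- z + - w) = - (v / (z + w))" for v z w :: complex
    by (metis minus_add_distrib minus_divide_right)
  have D: "D_const (- \<beta>) (- \<mu>m) (- \<mu>p) q = D_const \<beta> \<mu>p \<mu>m q"
    by (simp add: D_const_def)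
  show "zero_symbol (- \<beta>) (- \<mu>m) (- \<mu>p) q (- \<theta>) = zero_symbol \<beta> \<mu>p \<mu>m q \<theta>"
    unfolding zero_symbol_def root D of_real_minus mult_minus_right neg by simp
qed

lemma potential_density_left_characteristic:
  fixes \<beta> \<mu>p \<mu>m q x \<theta> :: real
  assumes q: "0 < q" and x: "x \<le> 0"
  shows "has_bochner_integral lborel (\<lambda>y. potential_density_left \<beta> \<mu>p \<mu>m q x y *\<^sub>R iexp (\<theta> * y))
    (free_symbol \<mu>m q \<theta> * exp (\<i> * \<theta> * x) + (zero_symbol \<beta> \<mu>p \<mu>m q \<theta> - free_symbol \<mu>m q \<theta>) * exp (- root_lo \<mu>m q * x))"
proof -
  let ?p = "potential_density_right (- \<beta>) (- \<mu>m) (- \<mu>p) q (- x)"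
  have "has_bochner_integral lborel (\<lambda>y. ?p y *\<^sub>R iexp (- \<theta> * y))
    (free_symbol \<mu>m q \<theta> * exp (\<i> * \<theta> * x) + (zero_symbol \<beta> \<mu>p \<mu>m q \<theta> - free_symbol \<mu>m q \<theta>) * exp (- root_lo \<mu>m q * x))"
    using potential_density_right_characteristic[OF q, of "- x" "- \<beta>" "- \<mu>m" "- \<mu>p" "- \<theta>"] x
    by (simp add: symbol_reflect)
  from lborel_has_bochner_integral_real_affine_iff[where c="- 1" and t=0, THEN iffD1, OF _ this]
  show ?thesis
    by (simp add: potential_density_left_reflect)
qed

lemma (in skew_brownian_motion_at_zero) characteristic_at_exponential_time:
  assumes q: "0 < q"
    and e_exp: "distributed M lborel e (\<lambda>t. ennreal (exponential_density q t))"
    and e_nonneg: "\<And>\<omega>. \<omega> \<in> space M \<Longrightarrow> 0 \<le> e \<omega>"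
    and e_indep: "indep_set {e -` A \<inter> space M | A. A \<in> sets borel}
      {(\<lambda>\<omega>. \<lambda>t\<in>{0..}. X t \<omega>) -` A \<inter> space M | A. A \<in> sets (PiM {0..} (\<lambda>_. borel))}"
  shows "(\<lambda>\<omega>. X (e \<omega>) \<omega>) \<in> borel_measurable M"
    and "(\<integral>\<omega>. iexp (\<theta> * X (e \<omega>) \<omega>) \<partial>M) = potential_symbol q \<theta>"
proof -
  have e: "e \<in> borel_measurable M"
    using distributed_measurable[OF e_exp] by simp
  have bound: "\<bar>Re (w * exp (\<i> * \<theta> * of_real y))\<bar> \<le> cmod w" for w y
    using abs_Re_le_cmod[of "w * exp (\<i> * \<theta> * of_real y)"] by (simp add: norm_mult)
  have cont: "continuous_on UNIV (\<lambda>y. Re (w * exp (\<i> * \<theta> * of_real y)))" for w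
    by (intro continuous_intros)
  note time = expectation_at_independent_time[OF e e_nonneg e_indep cont bound]
  show Xe[measurable]: "(\<lambda>\<omega>. X (e \<omega>) \<omega>) \<in> borel_measurable M"
    by (rule time(1))
  have int: "integrable M (\<lambda>\<omega>. iexp (\<theta> * X (e \<omega>) \<omega>))"
    by (rule integrable_const_bound[where B=1]) auto
  have proj: "Re (w * (\<integral>\<omega>. iexp (\<theta> * X (e \<omega>) \<omega>) \<partial>M)) = Re (w * potential_symbol q \<theta>)" for w
  proof -
    define k where "k t = expectation (\<lambda>\<omega>. Re (w * exp (\<i> * \<theta> * X (max 0 t) \<omega>)))" for t
    have k: "k \<in> borel_measurable borel"
      unfolding k_def by (intro borel_measurable_continuous_onI expectation_path_continuous[OF cont bound])
    have "Re (w * (\<integral>\<omega>. iexp (\<theta> * X (e \<omega>) \<omega>) \<partial>M)) = Re (\<integral>\<omega>. w * iexp (\<theta> * X (e \<omega>) \<omega>) \<partial>M)"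
      using int by simp
    also have "\<dots> = (\<integral>\<omega>. Re (w * iexp (\<theta> * X (e \<omega>) \<omega>)) \<partial>M)"
      by (rule integral_Re[symmetric]) (use int in simp)
    also have "\<dots> = (\<integral>\<omega>. Re (w * exp (\<i> * \<theta> * of_real (X (e \<omega>) \<omega>))) \<partial>M)"
      by (simp add: mult.assoc)
    also have "\<dots> = expectation (\<lambda>\<omega>. k (e \<omega>))"
      unfolding k_def by (rule time(2))
    also have "\<dots> = (\<integral>t. exponential_density q t * k t \<partial>lborel)"
      using distributed_integral[OF e_exp, of k] k exponential_density_nonneg[OF q] by simp
    also have "\<dots> = Re (w * potential_symbol q \<theta>)"
      unfolding k_def by (rule potential_of_exponential[OF q])
    finally show ?thesis .
  qed
  show "(\<integral>\<omega>. iexp (\<theta> * X (e \<omega>) \<omega>) \<partial>M) = potential_symbol q \<theta>"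
    using proj[of 1] proj[of "- \<i>"] by (simp add: complex_eq_iff)
qed

section \<open>The potential measure\<close>

theorem proposition1:
  fixes M :: "'a measure" and F :: "real \<Rightarrow> 'a measure" and B X :: "real \<Rightarrow> 'a \<Rightarrow> real"
    and e :: "'a \<Rightarrow> real" and \<beta> \<mu>p \<mu>m q x :: real
  assumes \<beta>: "- 1 < \<beta>" "\<beta> < 1"
    and q: "0 < q"
    and X: "refracted_skew_brownian_motion M F B X \<beta> \<mu>p \<mu>m 0"
    and X0: "AE \<omega> in M. X 0 \<omega> = x"
    and e_exp: "distributed M lborel e (\<lambda>t. ennreal (exponential_density q t))"
    and e_nonneg: "\<And>\<omega>. \<omega> \<in> space M \<Longrightarrow> 0 \<le> e \<omega>"
    and e_indep: "prob_space.indep_set M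
      {e -` A \<inter> space M | A. A \<in> sets borel}
      {(\<lambda>\<omega>. \<lambda>t\<in>{0..}. X t \<omega>) -` A \<inter> space M | A. A \<in> sets (PiM {0..} (\<lambda>_. borel))}"
  shows
    "(0 \<le> x \<longrightarrow> distributed M lborel (\<lambda>\<omega>. X (e \<omega>) \<omega>) (\<lambda>y. ennreal (
        if 0 < y then
          q * exp (\<mu>p * (y - x)) / sqrt (\<mu>p\<^sup>2 + 2 * q)
            * (exp (- \<bar>y - x\<bar> * sqrt (\<mu>p\<^sup>2 + 2 * q)) - exp (- (x + y) * sqrt (\<mu>p\<^sup>2 + 2 * q)))
          + 2 * (1 + \<beta>) * q / D_const \<beta> \<mu>p \<mu>m q
            * exp (\<mu>p * (y - x) - (x + y) * sqrt (\<mu>p\<^sup>2 + 2 * q))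
        else if y < 0 then
          2 * (1 - \<beta>) * q / D_const \<beta> \<mu>p \<mu>m q
            * exp ((- \<mu>p - sqrt (\<mu>p\<^sup>2 + 2 * q)) * x) * exp ((\<mu>m + sqrt (\<mu>m\<^sup>2 + 2 * q)) * y)
        else 0)))
     \<and> (x \<le> 0 \<longrightarrow> distributed M lborel (\<lambda>\<omega>. X (e \<omega>) \<omega>) (\<lambda>y. ennreal (
        if 0 < y then
          2 * (1 + \<beta>) * q / D_const \<beta> \<mu>p \<mu>m q
            * exp ((- \<mu>m + sqrt (\<mu>m\<^sup>2 + 2 * q)) * x) * exp ((\<mu>p - sqrt (\<mu>p\<^sup>2 + 2 * q)) * y)
        else if y < 0 then
          q * exp (\<mu>m * (y - x)) / sqrt (\<mu>m\<^sup>2 + 2 * q)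
            * (exp (- \<bar>y - x\<bar> * sqrt (\<mu>m\<^sup>2 + 2 * q)) - exp ((x + y) * sqrt (\<mu>m\<^sup>2 + 2 * q)))
          + 2 * (1 - \<beta>) * q / D_const \<beta> \<mu>p \<mu>m q
            * exp (\<mu>m * (y - x) + (x + y) * sqrt (\<mu>m\<^sup>2 + 2 * q))
        else 0)))"
proof -
  interpret refracted_skew_brownian_motion M F B X \<beta> \<mu>p \<mu>m 0 by (rule X)
  interpret skew_brownian_motion_at_zero M F B X \<beta> \<mu>p \<mu>m x
    by unfold_locales (rule X0)
  note Xe = characteristic_at_exponential_time(1)[OF q e_exp e_nonneg e_indep]
  have symbol_eq: "(\<integral>\<omega>. iexp (\<theta> * X (e \<omega>) \<omega>) \<partial>M) = potential_symbol q \<theta>" for \<theta>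
    by (rule characteristic_at_exponential_time(2)[OF q e_exp e_nonneg e_indep])
  have right: "distributed M lborel (\<lambda>\<omega>. X (e \<omega>) \<omega>) (\<lambda>y. ennreal (potential_density_right \<beta> \<mu>p \<mu>m q x y))" if x: "0 \<le> x"
  proof (rule distributed_by_characteristic_function[OF Xe])
    show "has_bochner_integral lborel (\<lambda>y. potential_density_right \<beta> \<mu>p \<mu>m q x y *\<^sub>R iexp (\<theta> * y)) (\<integral>\<omega>. iexp (\<theta> * X (e \<omega>) \<omega>) \<partial>M)" for \<theta>
      unfolding symbol_eq potential_symbol_def using potential_density_right_characteristic[OF q x, of \<beta> \<mu>p \<mu>m \<theta>] x by simp
  qed (use potential_density_right_nonneg[OF \<beta> q x] in simp_all)
  have left: "distributed M lborel (\<lambda>\<omega>. X (e \<omega>) \<omega>) (\<lambda>y. ennreal (potential_density_left \<beta> \<mu>p \<mu>m q x y))" if x: "x \<le> 0"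
  proof (rule distributed_by_characteristic_function[OF Xe])
    show "has_bochner_integral lborel (\<lambda>y. potential_density_left \<beta> \<mu>p \<mu>m q x y *\<^sub>R iexp (\<theta> * y)) (\<integral>\<omega>. iexp (\<theta> * X (e \<omega>) \<omega>) \<partial>M)" for \<theta>
      unfolding symbol_eq potential_symbol_def using potential_density_left_characteristic[OF q x, of \<beta> \<mu>p \<mu>m \<theta>] x by (auto split: if_splits)
  qed (use potential_density_right_nonneg[of "- \<beta>" q "- x"] \<beta> q x in \<open>simp_all add: potential_density_left_reflect\<close>)
  show ?thesis
    using right left unfolding potential_density_right_def potential_density_left_def by blast
qed

end
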